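(* Consider the truncated Rademacher sparse 3-tensor PCA model and its quenched Franz–Parisi potential $\mathcal F_\lambda$ (both defined in the context). There exist constants $c,C,C'>0$ such that the following holds. If $\beta>0$ is a small enough constant and $k=n^{\beta+o(1)}$, then for any $q\ge1$, $$\mathcal F_\lambda(q)-\mathcal F_\lambda(0)\ \ge\ -\lambda^2q-Ck\log(n/k)+c\,\lambda\,k\,q^{1/3}/\sqrt{\log n}.$$ In particular, if $\lambda=k^{\epsilon+o(1)}$ for any $\epsilon\in(0,1)$ (i.e., for values of $\lambda\ge n^{\Omega(1)}\lambda_{\mathrm{ALG}}$), then as long as $C(\log n)^3\le q\le(\log n)^d$ for some $d>3$, it holds that $$\mathcal F_\lambda(q)-\mathcal F_\lambda(0)\ge k^{1+\Omega(1)}>0,$$ and therefore, for all $d>3$, the quenched Franz–Parisi potential $\mathcal F_\lambda(q)$ is not a decreasing function for $q\in[0,(\log n)^d]$.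
   Context: Model. Let $k=n^{\beta+o(1)}$ with $\beta\in(0,1/2)$. Let $u\in\mathbb R^n$ have i.i.d. entries with $\mathbb P(u_i=1)=\mathbb P(u_i=-1)=k/(2n)$ and $u_i=0$ otherwise. Set $v=u$ if $\|u\|_0\in[k/2,2k]$ and $v=1_{[k]}$ (indicator vector of the first $k$ coordinates) otherwise. The signal is $X=\mathrm{vec}(v^{\otimes3})\in\mathbb R^{N}$, $N=n^3$, and at signal-to-noise ratio $\lambda>0$ one observes $Y=\sqrt\lambda X+Z$ with $Z\sim N(0,I_N)$ independent of $X$. Quenched Franz–Parisi potential. With $X'=\mathrm{vec}((v')^{\otimes3})$ an independent copy of $X$ (independent of $X,Z$), $$\mathcal F_\lambda(q):=-\mathbb E_{X,Z}\log\mathbb E_{X'}\Big[1_{\langle X,X'\rangle=q}\exp\big(-\tfrac12\|Y-\sqrt\lambda X'\|_2^2\big)\Big],\qquad Y=\sqrt\lambda X+Z.$$ Note that $\langle X,X'\rangle=\langle v,v'\rangle^3$. $\lambda_{\mathrm{ALG}}=\widetilde\Theta(1)$ denotes the algorithmic threshold of the model, where $\widetilde\Theta$ hides polylogarithmic factors in $n$. Asymptotics are as $n\to\infty$.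
   Formalization: The first inequality is stated with λ as amplitude, i.e. for the potential at signal-to-noise ratio λ² instead of λ, since with ratio λ it fails (e.g. λ=1/k, q=(k/2)³); the later claims are given for both ratio λ and ratio λ². *)

theory Defs
  imports "HOL-Probability.Probability"
begin

text \<open>
  Vectors of length \<open>n\<close> are functions on \<open>nat\<close> supported on \<open>{..<n}\<close>; coordinates are
  numbered from 0.  An order-3 tensor, i.e. a vector of length \<open>n\<^sup>3\<close>, is a function on index
  triples in \<open>{..<n} \<times> {..<n} \<times> {..<n}\<close>.
\<close>

type_synonym tensor = "nat \<times> nat \<times> nat \<Rightarrow> real"

definition tensor_index :: "nat \<Rightarrow> (nat \<times> nat \<times> nat) set" where
  "tensor_index n = {..<n} \<times> {..<n} \<times> {..<n}"

definition tensor_cube :: "(nat \<Rightarrow> real) \<Rightarrow> tensor" where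
  "tensor_cube v = (\<lambda>(i, j, l). v i * v j * v l)"

definition tensor_inner :: "nat \<Rightarrow> tensor \<Rightarrow> tensor \<Rightarrow> real" where
  "tensor_inner n A B = (\<Sum>t\<in>tensor_index n. A t * B t)"

text \<open>A nonzero entry occurs with probability \<open>k / n\<close> and then has a fair sign; for
  \<open>0 < n\<close>, \<open>k \<le> n\<close> the point masses are those of \<open>pmf_rademacher_entry\<close> below.\<close>

definition rademacher_entry :: "nat \<Rightarrow> nat \<Rightarrow> real pmf" where
  "rademacher_entry n k =
     bernoulli_pmf (real k / real n) \<bind>
       (\<lambda>b. if b then pmf_of_set {-1, 1} else return_pmf 0)"

lemma pmf_rademacher_entry:
  assumes "0 < n" "k \<le> n"
  shows "pmf (rademacher_entry n k) 1 = real k / (2 * real n)"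
    and "pmf (rademacher_entry n k) (-1) = real k / (2 * real n)"
    and "pmf (rademacher_entry n k) 0 = 1 - real k / real n"
  using assms
  by (auto simp: rademacher_entry_def pmf_bind integral_measure_pmf[of UNIV] UNIV_bool
      pmf_of_set field_simps indicator_def)

definition truncate_vec :: "nat \<Rightarrow> nat \<Rightarrow> (nat \<Rightarrow> real) \<Rightarrow> (nat \<Rightarrow> real)" where
  "truncate_vec n k u =
     (if real (card {i\<in>{..<n}. u i \<noteq> 0}) \<in> {real k / 2 .. 2 * real k}
      then u else indicator {..<k})"

definition signal_pmf :: "nat \<Rightarrow> nat \<Rightarrow> tensor pmf" where
  "signal_pmf n k =
     map_pmf (\<lambda>u. tensor_cube (truncate_vec n k u))
       (Pi_pmf {..<n} 0 (\<lambda>_. rademacher_entry n k))"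

definition noise_measure :: "nat \<Rightarrow> tensor measure" where
  "noise_measure n = PiM (tensor_index n) (\<lambda>_. std_normal_distribution)"

text \<open>The inner expectation, over the independent copy \<open>X'\<close> of the signal.\<close>

definition overlap_partition :: "nat \<Rightarrow> nat \<Rightarrow> real \<Rightarrow> real \<Rightarrow> tensor \<Rightarrow> tensor \<Rightarrow> real" where
  "overlap_partition n k snr q X Y =
     measure_pmf.expectation (signal_pmf n k)
       (\<lambda>X'. if tensor_inner n X X' = q
             then exp (- (\<Sum>t\<in>tensor_index n. (Y t - sqrt snr * X' t)\<^sup>2) / 2) else 0)"

lemma overlap_partition_bounds:
  "0 \<le> overlap_partition n k snr q X Y" "overlap_partition n k snr q X Y \<le> 1"
proof -
  let ?f = "\<lambda>X'. if tensor_inner n X X' = q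
    then exp (- (\<Sum>t\<in>tensor_index n. (Y t - sqrt snr * X' t)\<^sup>2) / 2) else 0"
  have le: "?f X' \<le> 1" for X'
    by (simp add: sum_nonneg)
  show "0 \<le> overlap_partition n k snr q X Y"
    unfolding overlap_partition_def by (intro Bochner_Integration.integral_nonneg) auto
  show "overlap_partition n k snr q X Y \<le> 1"
    unfolding overlap_partition_def
    by (rule measure_pmf.integral_le_const)
      (use le in \<open>auto intro!: measure_pmf.integrable_const_bound[where B = 1] simp: sum_nonneg\<close>)
qed

text \<open>Since the inner expectation lies in \<open>[0, 1]\<close>, its negative logarithm is well-defined in
  \<open>[0, \<infinity>]\<close>, with \<open>- log 0 = \<infinity>\<close> (unlike \<open>ln 0 = 0\<close> on the reals).  So the potential is a
  nonnegative integral; it is infinite at values \<open>q\<close> that are not attained.\<close>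

definition neg_log :: "real \<Rightarrow> ennreal" where
  "neg_log w = (if w \<le> 0 then \<infinity> else ennreal (- ln w))"

text \<open>The argument \<open>snr\<close> is the signal-to-noise ratio, i.e. the squared amplitude in
  \<open>Y = sqrt snr * X + Z\<close>: at amplitude \<open>\<lambda>\<close> the potential is \<open>franz_parisi n k (\<lambda>\<^sup>2)\<close>.\<close>

definition franz_parisi :: "nat \<Rightarrow> nat \<Rightarrow> real \<Rightarrow> real \<Rightarrow> ereal" where
  "franz_parisi n k snr q =
     enn2ereal (\<integral>\<^sup>+ (X, Z). neg_log (overlap_partition n k snr q X (\<lambda>t. sqrt snr * X t + Z t))
       \<partial>(measure_pmf (signal_pmf n k) \<Otimes>\<^sub>M noise_measure n))"

text \<open>\<open>a = b^(e + o(1))\<close> as \<open>n \<rightarrow> \<infinity>\<close>.\<close>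

definition power_scale :: "(nat \<Rightarrow> real) \<Rightarrow> (nat \<Rightarrow> real) \<Rightarrow> real \<Rightarrow> bool" where
  "power_scale a b e \<longleftrightarrow>
     (\<exists>\<eta>. \<eta> \<longlonglongrightarrow> 0 \<and> (\<forall>\<^sub>F n in sequentially. a n = b n powr (e + \<eta> n)))"

text \<open>\<open>L\<close> is of order 1 up to factors polylogarithmic in \<open>n\<close>.\<close>

definition soft_Theta_one :: "(nat \<Rightarrow> real) \<Rightarrow> bool" where
  "soft_Theta_one L \<longleftrightarrow>
     (\<exists>D. \<forall>\<^sub>F n in sequentially. ln (real n) powr (- D) \<le> L n \<and> L n \<le> ln (real n) powr D)"

end

(*
  For a fixed signal, completing the square turns F(q) - F(0) into - lambda^2 q plus the difference
  of two log-partition functions of the Gaussian forms <Z, w^(x)3>, over the w orthogonal to the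
  planted vector v and over the w with <v, w> = m, m^3 = q. Both are within
  k log(n/k) of lambda times a maximum of forms. Among the w of sparsity s, an overlap of m with v
  costs m log(n/k^2) of entropy. Since the maximum over N nearly independent forms of variance s^3
  is close to sqrt(2 s^3 log N), this lowers it by about s m sqrt(log n).

  The maximum over the orthogonal vectors must therefore be known up to an error of order
  s sqrt(log n), well below the scale s^(3/2) of Gaussian concentration. The second moment method
  gives this: for small beta it succeeds with probability at least 1 - 1/s^2 at a level where about
  s^4 of the forms are expected. Vectors with disjoint supports give independent forms, and for the
  rare other pairs Chernoff's bound on the sum of the two forms suffices.
*)

theory Submission
  imports Defs "HOL-Real_Asymp.Real_Asymp"
begin

subsection \<open>Linear forms of a standard Gaussian vector\<close>

text \<open>Errors are counted in units of \<open>unit_gap\<close>, the standard deviation of a form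
  divided by \<open>peak\<close>. This is how far the maximum moves when the logarithm of the number
  of forms changes by one, and it is of order k / sqrt(log n). The claim asks for a fixed fraction
  of m units at overlap m, while the entropy deficit is worth nearly m log n units. The surplus pays
  for every loss of order log k: the factor s^4 in the level, the union over the sizes, the passage
  from probability to expectation. Hence log n has to exceed a large fixed multiple of log k, which
  is what a small beta provides.

  The signal may have any sparsity between k/2 and 2k, and the forms of different sizes have
  different variances and different penalties lambda^2 s^3 / 2. The size that is best at overlap m
  is therefore reused in the orthogonal slice, where the penalties cancel. At overlap m only an
  upper bound is needed, and a first moment of exponentials gives it; the second moment serves the
  orthogonal slice alone.\<close>

abbreviation gauss :: "'i set \<Rightarrow> ('i \<Rightarrow> real) measure" where
  "gauss I \<equiv> PiM I (\<lambda>_. std_normal_distribution)"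

lemma prob_space_std_normal: "prob_space std_normal_distribution"
  by (rule prob_space_normal_density) simp

lemma prob_space_gauss: "prob_space (gauss I)"
  by (intro prob_space_PiM prob_space_std_normal)

lemma measurable_gauss_component [measurable (raw)]:
  "t \<in> I \<Longrightarrow> (\<lambda>Z. Z t) \<in> borel_measurable (gauss I)"
  using measurable_component_singleton[of t I "\<lambda>_. std_normal_distribution"] by simp

lemma measurable_gauss_linear [measurable]:
  "(\<lambda>Z. \<Sum>t\<in>I. U t * Z t) \<in> borel_measurable (gauss I)"
  by measurable

lemma std_normal_mgf:
  "integrable std_normal_distribution (\<lambda>x. exp (a * x))"
  "(\<integral>x. exp (a * x) \<partial>std_normal_distribution) = exp (a\<^sup>2 / 2)"
proof -
  have eq: "std_normal_density x * exp (a * x) = exp (a\<^sup>2 / 2) * normal_density a 1 x" for x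
  proof -
    have "- x\<^sup>2 / 2 + a * x = a\<^sup>2 / 2 + - (x - a)\<^sup>2 / 2"
      by (simp add: power2_eq_square field_simps)
    then have "exp (- x\<^sup>2 / 2) * exp (a * x) = exp (a\<^sup>2 / 2) * exp (- (x - a)\<^sup>2 / 2)"
      by (simp only: exp_add[symmetric])
    then show ?thesis
      by (simp add: normal_density_def)
  qed
  show "integrable std_normal_distribution (\<lambda>x. exp (a * x))"
    by (subst integrable_density) (auto simp: eq)
  show "(\<integral>x. exp (a * x) \<partial>std_normal_distribution) = exp (a\<^sup>2 / 2)"
    by (subst integral_density) (auto simp: eq)
qed

lemma gauss_mgf:
  assumes "finite I"
  shows "integrable (gauss I) (\<lambda>Z. exp (\<Sum>t\<in>I. U t * Z t))"
    and "(\<integral>Z. exp (\<Sum>t\<in>I. U t * Z t) \<partial>gauss I) = exp ((\<Sum>t\<in>I. (U t)\<^sup>2) / 2)"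
proof -
  interpret product_sigma_finite "\<lambda>_::'a. std_normal_distribution"
    by (simp add: product_sigma_finite_def prob_space_std_normal prob_space_imp_sigma_finite)
  show "integrable (gauss I) (\<lambda>Z. exp (\<Sum>t\<in>I. U t * Z t))"
    unfolding exp_sum[OF assms] by (intro product_integrable_prod assms std_normal_mgf)
  show "(\<integral>Z. exp (\<Sum>t\<in>I. U t * Z t) \<partial>gauss I) = exp ((\<Sum>t\<in>I. (U t)\<^sup>2) / 2)"
    unfolding exp_sum[OF assms] sum_divide_distrib
    by (subst product_integral_prod) (auto intro: assms std_normal_mgf simp: std_normal_mgf)
qed

lemma gauss_component_distributed:
  assumes "t \<in> I"
  shows "distributed (gauss I) lborel (\<lambda>Z. Z t) std_normal_density"
proof -
  have "distr (gauss I) std_normal_distribution (\<lambda>Z. Z t) = std_normal_distribution"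
    by (rule distr_PiM_component[OF _ assms]) (rule prob_space_std_normal)
  moreover have "distr (gauss I) std_normal_distribution (\<lambda>Z. Z t) = distr (gauss I) lborel (\<lambda>Z. Z t)"
    by (rule distr_cong) auto
  ultimately show ?thesis
    unfolding distributed_def using assms by simp
qed

lemma gauss_indep_components:
  assumes "I \<noteq> {}"
  shows "prob_space.indep_vars (gauss I) (\<lambda>_. borel) (\<lambda>t Z. Z t) I"
proof -
  interpret prob_space "gauss I" by (rule prob_space_gauss)
  have rv: "\<And>t. t \<in> I \<Longrightarrow> random_variable std_normal_distribution (\<lambda>Z. Z t)"
    by (rule measurable_component_singleton)
  have "distr (gauss I) (gauss I) (\<lambda>x. \<lambda>i\<in>I. x i) = distr (gauss I) (gauss I) (\<lambda>x. x)"
    by (rule distr_cong) (auto simp: space_PiM PiE_def extensional_restrict)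
  also have "\<dots> = gauss I" by (simp add: distr_id2)
  also have "\<dots> = PiM I (\<lambda>i. distr (gauss I) std_normal_distribution (\<lambda>Z. Z i))"
    by (intro PiM_cong refl distr_PiM_component[symmetric] prob_space_std_normal)
  finally have "indep_vars (\<lambda>_. std_normal_distribution) (\<lambda>t Z. Z t) I"
    by (intro indep_vars_iff_distr_eq_PiM'[OF assms rv, THEN iffD2])
  then show ?thesis
    unfolding indep_vars_def by simp
qed

lemma gauss_linear_distributed:
  assumes I: "finite I" and S: "(\<Sum>t\<in>I. (U t)\<^sup>2) > 0"
  shows "distributed (gauss I) lborel (\<lambda>Z. \<Sum>t\<in>I. U t * Z t)
    (normal_density 0 (sqrt (\<Sum>t\<in>I. (U t)\<^sup>2)))"
proof -
  interpret prob_space "gauss I" by (rule prob_space_gauss)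
  \<comment> \<open>A term with zero coefficient has no normal density, so the theorem on sums of
    independent normals is applied to the other terms only.\<close>
  define J where "J = {t\<in>I. U t \<noteq> 0}"
  have J: "finite J" "J \<subseteq> I" using I by (auto simp: J_def)
  have sq: "(\<Sum>t\<in>I. (U t)\<^sup>2) = (\<Sum>t\<in>J. (U t)\<^sup>2)"
    by (rule sum.mono_neutral_right[OF I J(2)]) (auto simp: J_def)
  have J0: "J \<noteq> {}" using S unfolding sq by auto
  then have I0: "I \<noteq> {}" using J by auto
  have "indep_vars (\<lambda>_. borel) (\<lambda>t. (\<lambda>x. U t * x) \<circ> (\<lambda>Z. Z t)) J"
    by (rule indep_vars_compose[OF indep_vars_subset[OF gauss_indep_components[OF I0] J(2)]]) auto
  then have ind: "indep_vars (\<lambda>_. borel) (\<lambda>t Z. U t * Z t) J"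
    by (simp add: comp_def)
  have "distributed (gauss I) lborel (\<lambda>Z. U t * Z t) (normal_density 0 \<bar>U t\<bar>)" if "t \<in> J" for t
  proof -
    have "t \<in> I" "U t \<noteq> 0" using that by (auto simp: J_def)
    from normal_density_affine[OF gauss_component_distributed[OF this(1)] _ this(2), of 0]
    show ?thesis by simp
  qed
  from sum_indep_normal[OF J(1) J0 ind _ this]
  have "distributed (gauss I) lborel (\<lambda>Z. \<Sum>t\<in>J. U t * Z t)
    (normal_density (\<Sum>t\<in>J. 0) (sqrt (\<Sum>t\<in>J. \<bar>U t\<bar>\<^sup>2)))"
    by (auto simp: J_def)
  moreover have "(\<Sum>t\<in>J. U t * Z t) = (\<Sum>t\<in>I. U t * Z t)" for Z :: "'a \<Rightarrow> real"
    by (rule sum.mono_neutral_left[OF I J(2)]) (auto simp: J_def)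
  ultimately show ?thesis by (simp add: sq)
qed

text \<open>Only the interval from \<open>\<tau> * \<sigma>\<close> to
  \<open>(\<tau> + \<delta>) * \<sigma>\<close> is kept, where the density is at least its value at
  the right end. With \<open>\<tau>\<close> = T - 1/T and \<open>\<delta>\<close> = 1/T this loses
  only a factor of order T against exp(-T^2/2).\<close>

lemma gauss_linear_tail_lower:
  assumes I: "finite I" and S: "(\<Sum>t\<in>I. (U t)\<^sup>2) = \<sigma>\<^sup>2" "\<sigma> > 0" and "0 \<le> \<tau>" "0 \<le> \<delta>"
  shows "measure (gauss I) {Z \<in> space (gauss I). (\<Sum>t\<in>I. U t * Z t) \<ge> \<tau> * \<sigma>}
    \<ge> \<delta> * exp (- (\<tau> + \<delta>)\<^sup>2 / 2) / sqrt (2 * pi)"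
proof -
  interpret prob_space "gauss I" by (rule prob_space_gauss)
  let ?X = "\<lambda>Z. \<Sum>t\<in>I. U t * Z t"
  have D: "distributed (gauss I) lborel ?X (normal_density 0 \<sigma>)"
    using gauss_linear_distributed[OF I, of U] S by simp
  let ?A = "{\<tau> * \<sigma>..(\<tau> + \<delta>) * \<sigma>}"
  have "ennreal (\<delta> * exp (- (\<tau> + \<delta>)\<^sup>2 / 2) / sqrt (2 * pi)) =
    (\<integral>\<^sup>+x. ennreal (exp (- (\<tau> + \<delta>)\<^sup>2 / 2) / (sqrt (2 * pi) * \<sigma>)) * indicator ?A x \<partial>lborel)"
    using assms
    by (subst nn_integral_cmult_indicator)
      (auto simp: mult_right_mono ennreal_mult'[symmetric] field_simps)
  also have "\<dots> \<le> (\<integral>\<^sup>+x. ennreal (normal_density 0 \<sigma> x) * indicator ?A x \<partial>lborel)"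
  proof (intro nn_integral_mono)
    fix x
    show "ennreal (exp (- (\<tau> + \<delta>)\<^sup>2 / 2) / (sqrt (2 * pi) * \<sigma>)) * indicator ?A x
      \<le> ennreal (normal_density 0 \<sigma> x) * indicator ?A x"
    proof (cases "x \<in> ?A")
      case True
      then have "0 \<le> x" "x \<le> (\<tau> + \<delta>) * \<sigma>" using assms
        by (auto intro: order_trans[of _ "\<tau> * \<sigma>"])
      then have "x\<^sup>2 \<le> ((\<tau> + \<delta>) * \<sigma>)\<^sup>2" by (intro power_mono)
      then have "x\<^sup>2 / \<sigma>\<^sup>2 \<le> (\<tau> + \<delta>)\<^sup>2"
        using S by (simp add: power_mult_distrib divide_le_eq)
      then have "- (\<tau> + \<delta>)\<^sup>2 / 2 \<le> - (x - 0)\<^sup>2 / (2 * \<sigma>\<^sup>2)"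
        by (simp add: field_simps)
      then have "exp (- (\<tau> + \<delta>)\<^sup>2 / 2) / (sqrt (2 * pi) * \<sigma>) \<le> normal_density 0 \<sigma> x"
        using S by (simp add: normal_density_def real_sqrt_mult divide_right_mono)
      then show ?thesis by (intro mult_right_mono ennreal_leI) auto
    qed auto
  qed
  also have "\<dots> = emeasure (gauss I) (?X -` ?A \<inter> space (gauss I))"
    by (rule distributed_emeasure[OF D, symmetric]) simp
  also have "\<dots> \<le> emeasure (gauss I) {Z \<in> space (gauss I). ?X Z \<ge> \<tau> * \<sigma>}"
    by (intro emeasure_mono) auto
  finally show ?thesis
    by (simp add: emeasure_eq_measure)
qed

lemma gauss_linear_disjoint_indep:
  assumes I: "finite I" "I \<noteq> {}" and disj: "\<And>t. t \<in> I \<Longrightarrow> U t = 0 \<or> V t = 0"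
  shows "measure (gauss I) {Z \<in> space (gauss I). (\<Sum>t\<in>I. U t * Z t) \<ge> a \<and> (\<Sum>t\<in>I. V t * Z t) \<ge> b}
    = measure (gauss I) {Z \<in> space (gauss I). (\<Sum>t\<in>I. U t * Z t) \<ge> a}
      * measure (gauss I) {Z \<in> space (gauss I). (\<Sum>t\<in>I. V t * Z t) \<ge> b}"
proof -
  interpret prob_space "gauss I" by (rule prob_space_gauss)
  define A where "A = {t\<in>I. U t \<noteq> 0}"
  define B where "B = {t\<in>I. V t \<noteq> 0}"
  have AB: "A \<inter> B = {}" "A \<subseteq> I" "B \<subseteq> I" using disj by (auto simp: A_def B_def)
  have "indep_var borel ((\<lambda>f. \<Sum>t\<in>A. U t * f t) \<circ> (\<lambda>Z. restrict (\<lambda>t. Z t) A))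
      borel ((\<lambda>f. \<Sum>t\<in>B. V t * f t) \<circ> (\<lambda>Z. restrict (\<lambda>t. Z t) B))"
    by (intro indep_var_compose[OF indep_var_restrict[OF gauss_indep_components[OF I(2)] AB]]) auto
  moreover have "(\<lambda>f. \<Sum>t\<in>A. U t * f t) \<circ> (\<lambda>Z. restrict (\<lambda>t. Z t) A) = (\<lambda>Z. \<Sum>t\<in>I. U t * Z t)"
    by (rule ext) (auto simp: A_def I intro!: sum.mono_neutral_cong_left)
  moreover have "(\<lambda>f. \<Sum>t\<in>B. V t * f t) \<circ> (\<lambda>Z. restrict (\<lambda>t. Z t) B) = (\<lambda>Z. \<Sum>t\<in>I. V t * Z t)"
    by (rule ext) (auto simp: B_def I intro!: sum.mono_neutral_cong_left)
  ultimately have "indep_var borel (\<lambda>Z. \<Sum>t\<in>I. U t * Z t) borel (\<lambda>Z. \<Sum>t\<in>I. V t * Z t)"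
    by simp
  from indep_varD[OF this, of "{a..}" "{b..}"] show ?thesis
    by (simp add: vimage_def Int_def conj_commute)
qed

lemma gauss_linear_moments:
  assumes I: "finite I" and S: "(\<Sum>t\<in>I. (U t)\<^sup>2) = \<sigma>\<^sup>2" "\<sigma> > 0"
  shows "integrable (gauss I) (\<lambda>Z. \<Sum>t\<in>I. U t * Z t)"
    and "(\<integral>Z. (\<Sum>t\<in>I. U t * Z t) \<partial>gauss I) = 0"
    and "integrable (gauss I) (\<lambda>Z. (\<Sum>t\<in>I. U t * Z t)\<^sup>2)"
    and "(\<integral>Z. (\<Sum>t\<in>I. U t * Z t)\<^sup>2 \<partial>gauss I) = \<sigma>\<^sup>2"
proof -
  interpret prob_space "gauss I" by (rule prob_space_gauss)
  have D: "distributed (gauss I) lborel (\<lambda>Z. \<Sum>t\<in>I. U t * Z t) (normal_density 0 \<sigma>)"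
    using gauss_linear_distributed[OF I, of U] S by simp
  show 1: "integrable (gauss I) (\<lambda>Z. \<Sum>t\<in>I. U t * Z t)"
    using distributed_integrable[OF D, of "\<lambda>x. x"] integrable_normal_moment[OF S(2), of 0 1]
    by simp
  show 2: "(\<integral>Z. (\<Sum>t\<in>I. U t * Z t) \<partial>gauss I) = 0"
    by (rule normal_distributed_expectation[OF S(2) D])
  show "integrable (gauss I) (\<lambda>Z. (\<Sum>t\<in>I. U t * Z t)\<^sup>2)"
    using distributed_integrable[OF D, of "\<lambda>x. x\<^sup>2"] integrable_normal_moment[OF S(2), of 0 2]
    by simp
  show "(\<integral>Z. (\<Sum>t\<in>I. U t * Z t)\<^sup>2 \<partial>gauss I) = \<sigma>\<^sup>2"
    using normal_distributed_variance[OF S(2) D] 2 by simp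
qed

lemma gauss_shifted_square_integrable:
  assumes "finite I"
  shows "integrable (gauss I) (\<lambda>Z. \<Sum>t\<in>I. (a t + Z t)\<^sup>2)"
proof (intro Bochner_Integration.integrable_sum)
  fix t assume t: "t \<in> I"
  interpret prob_space "gauss I" by (rule prob_space_gauss)
  note D = gauss_component_distributed[OF t]
  have 1: "integrable (gauss I) (\<lambda>Z. Z t)"
    using distributed_integrable[OF D, of "\<lambda>x. x"] integrable_std_normal_moment[of 1] by simp
  have 2: "integrable (gauss I) (\<lambda>Z. (Z t)\<^sup>2)"
    using distributed_integrable[OF D, of "\<lambda>x. x\<^sup>2"] integrable_std_normal_moment[of 2] by simp
  show "integrable (gauss I) (\<lambda>Z. (a t + Z t)\<^sup>2)"
    unfolding power2_sum using 1 2 by simp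
qed

subsection \<open>Sparse sign vectors\<close>

definition sign_vecs :: "nat set \<Rightarrow> nat \<Rightarrow> (nat \<Rightarrow> real) set" where
  "sign_vecs U s = {w. (\<forall>i. w i \<in> {-1, 0, 1}) \<and> {i. w i \<noteq> 0} \<subseteq> U \<and> card {i. w i \<noteq> 0} = s}"

text \<open>Coordinates of opposite sign are left out: they only lower the inner product, so the
  cardinality bounds it from above, and on this set w is determined by v.\<close>

definition agree :: "(nat \<Rightarrow> real) \<Rightarrow> (nat \<Rightarrow> real) \<Rightarrow> nat set" where
  "agree v w = {i. w i = v i \<and> v i \<noteq> 0}"

lemma card_sign_vecs:
  assumes U: "finite U"
  shows "finite (sign_vecs U s)" "card (sign_vecs U s) = (card U choose s) * 2 ^ s"
proof -
  define S where "S = (SIGMA A:{A. A \<subseteq> U \<and> card A = s}. Pow A)"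
  define f :: "nat set \<times> nat set \<Rightarrow> nat \<Rightarrow> real"
    where "f = (\<lambda>(A, B) i. if i \<in> A then if i \<in> B then -1 else 1 else 0)"
  have bij: "bij_betw f S (sign_vecs U s)"
  proof (rule bij_betw_byWitness[where f' = "\<lambda>w. ({i. w i \<noteq> 0}, {i. w i = -1})"])
    show "\<forall>a\<in>S. ({i. f a i \<noteq> 0}, {i. f a i = -1}) = a"
      by (auto simp: S_def f_def)
    show "\<forall>w\<in>sign_vecs U s. f ({i. w i \<noteq> 0}, {i. w i = - 1}) = w"
      by (force simp: sign_vecs_def f_def fun_eq_iff)
    show "f ` S \<subseteq> sign_vecs U s"
      by (auto simp: S_def f_def sign_vecs_def split: if_splits)
    show "(\<lambda>w. ({i. w i \<noteq> 0}, {i. w i = - 1})) ` sign_vecs U s \<subseteq> S"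
      by (auto simp: sign_vecs_def S_def)
  qed
  have fin: "finite A" if "A \<subseteq> U" for A using that U by (rule finite_subset)
  have finS: "finite S"
    unfolding S_def using U fin by (intro finite_SigmaI) auto
  then show "finite (sign_vecs U s)" using bij bij_betw_finite by auto
  have "card (sign_vecs U s) = card S" using bij_betw_same_card[OF bij] by simp
  also have "\<dots> = (\<Sum>A\<in>{A. A \<subseteq> U \<and> card A = s}. card (Pow A))"
    unfolding S_def using U fin by (intro card_SigmaI) auto
  also have "\<dots> = (\<Sum>A\<in>{A. A \<subseteq> U \<and> card A = s}. 2 ^ s)"
    using fin by (intro sum.cong) (auto simp: card_Pow)
  also have "\<dots> = (card U choose s) * 2 ^ s"
    using n_subsets[OF U] by simp
  finally show "card (sign_vecs U s) = (card U choose s) * 2 ^ s" .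
qed

text \<open>Union bound over the l-subsets D of the support of v. Erasing D from w loses no
  information, because the erased values are those of v, and leaves a vector of sparsity s -
  l.\<close>

lemma card_sign_vecs_agree_le:
  assumes U: "finite U" and A: "finite A" and v: "v \<in> sign_vecs A r"
  shows "card {w \<in> sign_vecs U s. l \<le> card (agree v w)} \<le> (r choose l) * card (sign_vecs U (s - l))"
proof -
  let ?V = "{i. v i \<noteq> 0}"
  have V: "finite ?V" "card ?V = r"
    using v A by (auto simp: sign_vecs_def dest: finite_subset)
  let ?D = "{D. D \<subseteq> ?V \<and> card D = l}"
  have finD: "finite ?D" using V by simp
  have sub: "{w \<in> sign_vecs U s. l \<le> card (agree v w)}
    \<subseteq> (\<Union>D\<in>?D. {w \<in> sign_vecs U s. D \<subseteq> agree v w})"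
  proof
    fix w assume w: "w \<in> {w \<in> sign_vecs U s. l \<le> card (agree v w)}"
    then obtain D where "D \<subseteq> agree v w" "card D = l"
      using obtain_subset_with_card_n by blast
    moreover have "agree v w \<subseteq> ?V" by (auto simp: agree_def)
    ultimately show "w \<in> (\<Union>D\<in>?D. {w \<in> sign_vecs U s. D \<subseteq> agree v w})" using w by auto
  qed
  have each: "card {w \<in> sign_vecs U s. D \<subseteq> agree v w} \<le> card (sign_vecs U (s - l))" if D: "D \<in> ?D" for D
  proof (rule card_inj_on_le[where f = "\<lambda>w i. if i \<in> D then 0 else w i"])
    show "inj_on (\<lambda>w i. if i \<in> D then 0 else w i) {w \<in> sign_vecs U s. D \<subseteq> agree v w}"
    proof (rule inj_onI)
      fix w w' assume *: "w \<in> {w \<in> sign_vecs U s. D \<subseteq> agree v w}" "w' \<in> {w \<in> sign_vecs U s. D \<subseteq> agree v w}"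
        and eq: "(\<lambda>i. if i \<in> D then 0 else w i) = (\<lambda>i. if i \<in> D then 0 else w' i)"
      show "w = w'"
      proof
        fix i show "w i = w' i"
        proof (cases "i \<in> D")
          case True
          then have "i \<in> agree v w" "i \<in> agree v w'" using * by blast+
          then show ?thesis by (simp add: agree_def)
        qed (use fun_cong[OF eq, of i] in simp)
      qed
    qed
    show "(\<lambda>w i. if i \<in> D then 0 else w i) ` {w \<in> sign_vecs U s. D \<subseteq> agree v w} \<subseteq> sign_vecs U (s - l)"
    proof clarify
      fix w assume w: "w \<in> sign_vecs U s" and Dw: "D \<subseteq> agree v w"
      have eq: "{i. (if i \<in> D then 0 else w i) \<noteq> 0} = {i. w i \<noteq> 0} - D" by auto
      have "D \<subseteq> {i. w i \<noteq> 0}" using Dw by (auto simp: agree_def)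
      moreover have "finite D" using D V by (auto dest: finite_subset)
      ultimately have "card ({i. w i \<noteq> 0} - D) = s - l"
        using w D by (subst card_Diff_subset) (auto simp: sign_vecs_def)
      then show "(\<lambda>i. if i \<in> D then 0 else w i) \<in> sign_vecs U (s - l)"
        using w unfolding sign_vecs_def mem_Collect_eq eq by auto
    qed
    show "finite (sign_vecs U (s - l))" by (rule card_sign_vecs[OF U])
  qed
  have "card {w \<in> sign_vecs U s. l \<le> card (agree v w)}
    \<le> card (\<Union>D\<in>?D. {w \<in> sign_vecs U s. D \<subseteq> agree v w})"
    by (rule card_mono[OF _ sub]) (use finD card_sign_vecs(1)[OF U] in auto)
  also have "\<dots> \<le> (\<Sum>D\<in>?D. card {w \<in> sign_vecs U s. D \<subseteq> agree v w})"
    by (rule card_UN_le[OF finD])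
  also have "\<dots> \<le> (\<Sum>D\<in>?D. card (sign_vecs U (s - l)))"
    by (rule sum_mono) (rule each)
  also have "\<dots> = (r choose l) * card (sign_vecs U (s - l))"
    using n_subsets[OF V(1)] V(2) by simp
  finally show ?thesis .
qed

text \<open>Iterates (j+1) binom(N, j+1) = (N-j) binom(N, j): each removed entry costs a factor of
  at most s / (2(N - s)), where the 2 is the lost choice of a sign.\<close>

lemma card_sign_vecs_ratio:
  assumes U: "finite U" and "l \<le> s" "s \<le> card U"
  shows "real (card (sign_vecs U (s - l))) * (2 * (real (card U) - real s)) ^ l
    \<le> real s ^ l * real (card (sign_vecs U s))"
  using assms(2)
proof (induction l)
  case 0 show ?case by simp
next
  case (Suc l)
  let ?N = "card U"
  define j where "j = s - Suc l"
  have j: "s - l = Suc j" "Suc j \<le> s" "j < ?N" using Suc.prems assms(3) by (auto simp: j_def)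
  have "Suc j * (?N choose Suc j) = (?N - j) * (?N choose j)"
    using binomial_absorb_comp[of ?N j] binomial_absorption[of j ?N] by simp
  then have "real (Suc j) * real (?N choose Suc j) = (real ?N - real j) * real (?N choose j)"
    using j by (metis of_nat_mult of_nat_diff less_imp_le)
  then have eq: "real (Suc j) * real (?N choose Suc j) * 2 ^ Suc j
      = (real ?N - real j) * real (?N choose j) * 2 ^ Suc j" by simp
  have "real (card (sign_vecs U j)) * (2 * (real ?N - real s))
    = (real ?N - real s) * (real (?N choose j) * 2 ^ Suc j)"
    by (simp add: card_sign_vecs[OF U])
  also have "\<dots> \<le> (real ?N - real j) * (real (?N choose j) * 2 ^ Suc j)"
    using j by (intro mult_right_mono) auto
  also have "\<dots> = real (Suc j) * (real (?N choose Suc j) * 2 ^ Suc j)" using eq by (simp only: mult.assoc)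
  also have "\<dots> \<le> real s * (real (?N choose Suc j) * 2 ^ Suc j)"
    using j by (intro mult_right_mono) auto
  also have "\<dots> = real s * real (card (sign_vecs U (s - l)))"
    by (simp add: card_sign_vecs[OF U] j)
  finally have step: "real (card (sign_vecs U j)) * (2 * (real ?N - real s))
    \<le> real s * real (card (sign_vecs U (s - l)))" .
  have "real (card (sign_vecs U j)) * (2 * (real ?N - real s)) ^ Suc l
    = (real (card (sign_vecs U j)) * (2 * (real ?N - real s))) * (2 * (real ?N - real s)) ^ l" by simp
  also have "\<dots> \<le> (real s * real (card (sign_vecs U (s - l)))) * (2 * (real ?N - real s)) ^ l"
    using assms(3) by (intro mult_right_mono step) auto
  also have "\<dots> \<le> real s * (real s ^ l * real (card (sign_vecs U s)))"
    using mult_left_mono[OF Suc.IH, of "real s"] Suc.prems by (simp add: mult.assoc)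
  finally show ?case by (simp add: j_def)
qed

text \<open>Discarding r points multiplies the choices for the next point by (n-r-s)/(n-s) = 1 -
  r/(n-s). Replacing s by the fixed bound S gives the same factor at every step of the
  induction.\<close>

lemma binomial_diff_lower:
  assumes "r + S < n" "s \<le> S"
  shows "(1 - real r / (real n - real S)) ^ s * real (n choose s) \<le> real (n - r choose s)"
  using assms(2)
proof (induction s)
  case 0 show ?case by simp
next
  case (Suc s)
  define x where "x = 1 - real r / (real n - real S)"
  have x: "0 \<le> x" using assms by (simp add: x_def)
  have rec: "real (Suc s) * real (N choose Suc s) = (real N - real s) * real (N choose s)"
    if "s < N" for N
  proof -
    have "Suc s * (N choose Suc s) = (N - s) * (N choose s)"
      using binomial_absorb_comp[of N s] binomial_absorption[of s N] by simp
    then show ?thesis using that by (metis of_nat_mult of_nat_diff less_imp_le)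
  qed
  have "real r / (real n - real s) \<le> real r / (real n - real S)"
    using Suc.prems assms(1) by (intro divide_left_mono) auto
  then have "x \<le> 1 - real r / (real n - real s)" by (simp add: x_def)
  then have "x * (real n - real s) \<le> (1 - real r / (real n - real s)) * (real n - real s)"
    using Suc.prems assms(1) by (intro mult_right_mono) auto
  also have "\<dots> = real (n - r) - real s"
    using Suc.prems assms(1) by (simp add: field_simps)
  finally have le: "x * (real n - real s) \<le> real (n - r) - real s" .
  have "real (Suc s) * (x ^ Suc s * real (n choose Suc s)) = x ^ Suc s * ((real n - real s) * real (n choose s))"
    using rec[of n] Suc.prems assms(1) by (simp only: mult.left_commute[of "real (Suc s)"])
  also have "\<dots> = (x * (real n - real s)) * (x ^ s * real (n choose s))" by simp
  also have "\<dots> \<le> (real (n - r) - real s) * (x ^ s * real (n choose s))"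
    using x by (intro mult_right_mono le) auto
  also have "\<dots> \<le> (real (n - r) - real s) * real (n - r choose s)"
    using Suc x_def assms(1) by (intro mult_left_mono) auto
  also have "\<dots> = real (Suc s) * real (n - r choose Suc s)"
    using rec[of "n - r"] Suc.prems assms(1) by simp
  finally show ?case by (simp add: x_def del: of_nat_Suc)
qed

lemma card_sign_vecs_bounds:
  assumes U: "finite U" and "0 < s" "s \<le> card U"
  shows "(2 * real (card U) / real s) ^ s \<le> real (card (sign_vecs U s))"
    and "real (card (sign_vecs U s)) \<le> (2 * real (card U)) ^ s"
proof -
  have "(real (card U) / real s) ^ s \<le> real (card U choose s)"
    using binomial_ge_n_over_k_pow_k[OF assms(3), where 'a = real] by simp
  then have "(real (card U) / real s) ^ s * 2 ^ s \<le> real (card U choose s) * 2 ^ s" by simp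
  then show "(2 * real (card U) / real s) ^ s \<le> real (card (sign_vecs U s))"
    by (simp add: card_sign_vecs[OF U] power_mult_distrib power_divide mult.commute)
  have "(card U choose s) * 2 ^ s \<le> card U ^ s * 2 ^ s"
    using binomial_le_pow[OF assms(3)] by simp
  then have "real ((card U choose s) * 2 ^ s) \<le> real (card U ^ s * 2 ^ s)"
    by (simp only: of_nat_le_iff)
  then show "real (card (sign_vecs U s)) \<le> (2 * real (card U)) ^ s"
    by (simp add: card_sign_vecs[OF U] power_mult_distrib mult.commute)
qed

section \<open>Inner products of sparse sign vectors and of their tensor cubes\<close>

definition dot :: "nat \<Rightarrow> (nat \<Rightarrow> real) \<Rightarrow> (nat \<Rightarrow> real) \<Rightarrow> real" where
  "dot n v w = (\<Sum>i<n. v i * w i)"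

lemma tensor_inner_cube: "tensor_inner n (tensor_cube v) (tensor_cube w) = dot n v w ^ 3"
proof -
  have "tensor_inner n (tensor_cube v) (tensor_cube w) =
    (\<Sum>i<n. \<Sum>j<n. \<Sum>l<n. (v i * w i) * ((v j * w j) * (v l * w l)))"
    by (simp add: tensor_inner_def tensor_index_def tensor_cube_def sum.cartesian_product
        case_prod_unfold mult_ac)
  also have "\<dots> = dot n v w ^ 3"
    by (simp add: dot_def sum_distrib_left[symmetric] sum_distrib_right[symmetric] power3_eq_cube)
  finally show ?thesis .
qed

lemma sign_vecsD:
  assumes "w \<in> sign_vecs U s"
  shows "w i \<in> {-1, 0, 1}" "w i \<noteq> 0 \<Longrightarrow> i \<in> U" "card {i. w i \<noteq> 0} = s"
  using assms by (auto simp: sign_vecs_def)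

lemma sign_vecs_mono: "U \<subseteq> U' \<Longrightarrow> sign_vecs U s \<subseteq> sign_vecs U' s"
  by (auto simp: sign_vecs_def)

lemma uminus_sign_vecs: "v \<in> sign_vecs U s \<Longrightarrow> (\<lambda>i. - v i) \<in> sign_vecs U s"
  unfolding sign_vecs_def by (simp add: minus_equation_iff[of "_ :: real"]) (metis minus_minus)

lemma dot_self:
  assumes "w \<in> sign_vecs {..<n} s"
  shows "dot n w w = real s"
proof -
  have "dot n w w = (\<Sum>i<n. if w i \<noteq> 0 then 1 else 0)"
    unfolding dot_def using sign_vecsD(1)[OF assms] by (intro sum.cong) force+
  also have "\<dots> = real (card ({..<n} \<inter> {i. w i \<noteq> 0}))" by (simp add: sum.If_cases)
  also have "{..<n} \<inter> {i. w i \<noteq> 0} = {i. w i \<noteq> 0}" using sign_vecsD(2)[OF assms] by auto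
  finally show ?thesis using sign_vecsD(3)[OF assms] by simp
qed

lemma dot_le_agree:
  assumes "v \<in> sign_vecs {..<n} r" "w \<in> sign_vecs {..<n} s"
  shows "dot n v w \<le> real (card (agree v w))"
proof -
  have "dot n v w \<le> (\<Sum>i<n. if w i = v i \<and> v i \<noteq> 0 then 1 else 0)"
    unfolding dot_def
  proof (rule sum_mono)
    fix i
    show "v i * w i \<le> (if w i = v i \<and> v i \<noteq> 0 then 1 else 0)"
      using sign_vecsD(1)[OF assms(1), of i] sign_vecsD(1)[OF assms(2), of i] by auto
  qed
  also have "\<dots> = real (card ({..<n} \<inter> {i. w i = v i \<and> v i \<noteq> 0}))" by (simp add: sum.If_cases)
  also have "{..<n} \<inter> {i. w i = v i \<and> v i \<noteq> 0} = agree v w"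
    using sign_vecsD(2)[OF assms(1)] by (auto simp: agree_def)
  finally show ?thesis .
qed

lemma card_agree_le:
  assumes "finite A" "v \<in> sign_vecs A r"
  shows "card (agree v w) \<le> r"
proof -
  have "finite {i. v i \<noteq> 0}" using assms by (auto simp: sign_vecs_def dest: finite_subset)
  then have "card (agree v w) \<le> card {i. v i \<noteq> 0}"
    by (intro card_mono) (auto simp: agree_def)
  then show ?thesis using assms by (simp add: sign_vecs_def)
qed

lemma agree_full:
  assumes "finite U" "v \<in> sign_vecs U s" "w \<in> sign_vecs U s" "s \<le> card (agree v w)"
  shows "w = v"
proof -
  have fin: "finite {i. v i \<noteq> 0}" "finite {i. w i \<noteq> 0}"
    using assms by (auto simp: sign_vecs_def dest: finite_subset)
  have "agree v w = {i. v i \<noteq> 0}"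
    using assms by (intro card_seteq fin) (auto simp: sign_vecs_def agree_def)
  moreover have "agree v w = {i. w i \<noteq> 0}"
    using assms by (intro card_seteq fin) (auto simp: sign_vecs_def agree_def)
  ultimately show "w = v" by (fastforce simp: agree_def)
qed

lemma dot_Ints:
  assumes "v \<in> sign_vecs A r" "w \<in> sign_vecs B s"
  shows "dot n v w \<in> \<int>"
  unfolding dot_def
proof (rule Ints_sum)
  fix i show "v i * w i \<in> \<int>"
    using sign_vecsD(1)[OF assms(1), of i] sign_vecsD(1)[OF assms(2), of i] by auto
qed

subsection \<open>Cubic forms of the noise\<close>

lemma gauss_linear_prob_eq:
  assumes I: "finite I" and "(\<Sum>t\<in>I. (U t)\<^sup>2) = (\<Sum>t\<in>I. (V t)\<^sup>2)" "(\<Sum>t\<in>I. (V t)\<^sup>2) > 0"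
  shows "measure (gauss I) {Z \<in> space (gauss I). a \<le> (\<Sum>t\<in>I. U t * Z t)}
    = measure (gauss I) {Z \<in> space (gauss I). a \<le> (\<Sum>t\<in>I. V t * Z t)}"
proof -
  have "measure (gauss I) {Z \<in> space (gauss I). a \<le> (\<Sum>t\<in>I. W t * Z t)}
    = measure (density lborel (\<lambda>x. ennreal (normal_density 0 (sqrt (\<Sum>t\<in>I. (W t)\<^sup>2)) x))) {a..}"
    if "(\<Sum>t\<in>I. (W t)\<^sup>2) > 0" for W
  proof -
    note D = gauss_linear_distributed[OF I that]
    have "measure (density lborel (\<lambda>x. ennreal (normal_density 0 (sqrt (\<Sum>t\<in>I. (W t)\<^sup>2)) x))) {a..}
      = measure (distr (gauss I) lborel (\<lambda>Z. \<Sum>t\<in>I. W t * Z t)) {a..}"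
      using distributed_distr_eq_density[OF D] by simp
    also have "\<dots> = measure (gauss I) ((\<lambda>Z. \<Sum>t\<in>I. W t * Z t) -` {a..} \<inter> space (gauss I))"
      by (rule measure_distr) auto
    finally show ?thesis by (simp add: vimage_def Int_def conj_commute)
  qed
  from this[of U] this[of V] show ?thesis using assms by simp
qed

text \<open>Chebyshev's inequality for the number of events that occur: if none does, the deviation
  from the mean is the mean itself. The variance stays a sum of covariances, so that independent
  pairs drop out.\<close>

lemma (in prob_space) none_occurs_second_moment:
  assumes W: "finite W" "W \<noteq> {}" and E: "\<And>w. w \<in> W \<Longrightarrow> E w \<in> events"
    and P: "\<And>w. w \<in> W \<Longrightarrow> prob (E w) = p" "p > 0"
  shows "prob {x \<in> space M. \<forall>w\<in>W. x \<notin> E w}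
    \<le> (\<Sum>v\<in>W. \<Sum>w\<in>W. prob (E v \<inter> E w) - p\<^sup>2) / (real (card W) * p)\<^sup>2"
proof -
  define N where "N = (\<lambda>x. \<Sum>w\<in>W. indicator (E w) x :: real)"
  define \<mu> where "\<mu> = real (card W) * p"
  have \<mu>: "\<mu> > 0" using W P by (simp add: \<mu>_def card_gt_0_iff)
  have [measurable]: "E w \<in> events" if "w \<in> W" for w using E that by simp
  have int1: "integrable M N"
    unfolding N_def using E by (intro Bochner_Integration.integrable_sum) (auto simp: integrable_indicator_iff emeasure_eq_measure)
  have N2: "(N x)\<^sup>2 = (\<Sum>v\<in>W. \<Sum>w\<in>W. indicator (E v \<inter> E w) x)" for x
    by (simp add: N_def power2_eq_square sum_product indicator_inter_arith)
  have int2: "integrable M (\<lambda>x. (N x)\<^sup>2)"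
    unfolding N2 using E by (intro Bochner_Integration.integrable_sum) (auto simp: integrable_indicator_iff emeasure_eq_measure)
  have EN: "expectation N = \<mu>"
    unfolding N_def using E P
    by (subst Bochner_Integration.integral_sum) (auto simp: integrable_indicator_iff emeasure_eq_measure \<mu>_def)
  have EN2: "expectation (\<lambda>x. (N x)\<^sup>2) = (\<Sum>v\<in>W. \<Sum>w\<in>W. prob (E v \<inter> E w))"
  proof -
    have i: "integrable M (\<lambda>x. indicator (E v \<inter> E w) x :: real)" if "v \<in> W" "w \<in> W" for v w
      using E that by (auto simp: integrable_indicator_iff emeasure_eq_measure)
    have "expectation (\<lambda>x. (N x)\<^sup>2) = (\<Sum>v\<in>W. expectation (\<lambda>x. \<Sum>w\<in>W. indicator (E v \<inter> E w) x))"
      unfolding N2 by (intro Bochner_Integration.integral_sum Bochner_Integration.integrable_sum i)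
    also have "\<dots> = (\<Sum>v\<in>W. \<Sum>w\<in>W. expectation (\<lambda>x. indicator (E v \<inter> E w) x))"
      by (intro sum.cong refl Bochner_Integration.integral_sum i)
    also have "\<dots> = (\<Sum>v\<in>W. \<Sum>w\<in>W. prob (E v \<inter> E w))"
      using E by (intro sum.cong refl) (simp add: sets.Int)
    finally show ?thesis .
  qed
  have meas: "{x \<in> space M. \<forall>w\<in>W. x \<notin> E w} \<in> events"
    using W(1) by measurable
  have "prob {x \<in> space M. \<forall>w\<in>W. x \<notin> E w} = expectation (indicator {x \<in> space M. \<forall>w\<in>W. x \<notin> E w})"
    using meas by simp
  also have "\<dots> \<le> expectation (\<lambda>x. (N x - \<mu>)\<^sup>2 / \<mu>\<^sup>2)"
  proof (rule integral_mono)
    show "integrable M (indicator {x \<in> space M. \<forall>w\<in>W. x \<notin> E w} :: 'a \<Rightarrow> real)"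
      using meas by (auto simp: integrable_indicator_iff emeasure_eq_measure)
    show "integrable M (\<lambda>x. (N x - \<mu>)\<^sup>2 / \<mu>\<^sup>2)"
      unfolding power2_diff using int1 int2 by simp
    fix x show "indicator {x \<in> space M. \<forall>w\<in>W. x \<notin> E w} x \<le> (N x - \<mu>)\<^sup>2 / \<mu>\<^sup>2"
      using \<mu> by (auto simp: indicator_def N_def)
  qed
  also have "\<dots> = (expectation (\<lambda>x. (N x)\<^sup>2) - \<mu>\<^sup>2) / \<mu>\<^sup>2"
    unfolding power2_diff using int1 int2 EN by (simp add: prob_space power2_eq_square)
  also have "expectation (\<lambda>x. (N x)\<^sup>2) - \<mu>\<^sup>2 = (\<Sum>v\<in>W. \<Sum>w\<in>W. prob (E v \<inter> E w) - p\<^sup>2)"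
    unfolding EN2 by (simp add: sum_subtractf \<mu>_def power2_eq_square)
  finally show ?thesis by (simp add: \<mu>_def)
qed

section \<open>Moments, tails and independence of the cubic forms\<close>

definition cube_form :: "nat \<Rightarrow> (nat \<Rightarrow> real) \<Rightarrow> tensor \<Rightarrow> real" where
  "cube_form n w Z = (\<Sum>t\<in>tensor_index n. tensor_cube w t * Z t)"

lemma finite_tensor_index [simp]: "finite (tensor_index n)"
  by (simp add: tensor_index_def)

lemma prob_space_noise: "prob_space (noise_measure n)"
  unfolding noise_measure_def by (rule prob_space_gauss)

lemma measurable_cube_form [measurable]: "cube_form n w \<in> borel_measurable (noise_measure n)"
  unfolding cube_form_def[abs_def] noise_measure_def by measurable

lemma sum_tensor_cube_square:
  assumes "w \<in> sign_vecs {..<n} s"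
  shows "(\<Sum>t\<in>tensor_index n. (tensor_cube w t)\<^sup>2) = real s ^ 3"
  using tensor_inner_cube[of n w w] dot_self[OF assms]
  by (simp add: tensor_inner_def power2_eq_square)

lemma cube_form_mgf:
  assumes "w \<in> sign_vecs {..<n} s"
  shows "integrable (noise_measure n) (\<lambda>Z. exp (\<theta> * cube_form n w Z))"
    and "(\<integral>Z. exp (\<theta> * cube_form n w Z) \<partial>noise_measure n) = exp (\<theta>\<^sup>2 * real s ^ 3 / 2)"
proof -
  have eq: "\<theta> * cube_form n w Z = (\<Sum>t\<in>tensor_index n. (\<theta> * tensor_cube w t) * Z t)" for Z
    by (simp add: cube_form_def sum_distrib_left mult_ac)
  show "integrable (noise_measure n) (\<lambda>Z. exp (\<theta> * cube_form n w Z))"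
    unfolding eq noise_measure_def by (rule gauss_mgf) simp
  show "(\<integral>Z. exp (\<theta> * cube_form n w Z) \<partial>noise_measure n) = exp (\<theta>\<^sup>2 * real s ^ 3 / 2)"
    unfolding eq noise_measure_def
    by (subst gauss_mgf) (auto simp: power_mult_distrib sum_distrib_left[symmetric] sum_tensor_cube_square[OF assms])
qed

lemma cube_form_moments:
  assumes "w \<in> sign_vecs {..<n} s" "s > 0"
  shows "integrable (noise_measure n) (cube_form n w)"
    and "(\<integral>Z. cube_form n w Z \<partial>noise_measure n) = 0"
    and "integrable (noise_measure n) (\<lambda>Z. (cube_form n w Z)\<^sup>2)"
    and "(\<integral>Z. (cube_form n w Z)\<^sup>2 \<partial>noise_measure n) = real s ^ 3"
proof -
  have *: "(\<Sum>t\<in>tensor_index n. (tensor_cube w t)\<^sup>2) = (sqrt (real s ^ 3))\<^sup>2" "sqrt (real s ^ 3) > 0"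
    using sum_tensor_cube_square[OF assms(1)] assms(2) by simp_all
  note m = gauss_linear_moments[OF finite_tensor_index *]
  show "integrable (noise_measure n) (cube_form n w)"
    "(\<integral>Z. cube_form n w Z \<partial>noise_measure n) = 0"
    "integrable (noise_measure n) (\<lambda>Z. (cube_form n w Z)\<^sup>2)"
    "(\<integral>Z. (cube_form n w Z)\<^sup>2 \<partial>noise_measure n) = real s ^ 3"
    using m by (simp_all add: cube_form_def[abs_def] noise_measure_def)
qed

text \<open>Chernoff's bound for the sum of the two forms.\<close>

lemma cube_form_joint_tail:
  assumes v: "v \<in> sign_vecs {..<n} s" and w: "w \<in> sign_vecs {..<n} s" and s: "s > 0" and \<tau>: "\<tau> \<ge> 0"
  shows "measure (noise_measure n) {Z \<in> space (noise_measure n).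
      \<tau> * sqrt (real s ^ 3) \<le> cube_form n v Z \<and> \<tau> * sqrt (real s ^ 3) \<le> cube_form n w Z}
    \<le> exp (- \<tau>\<^sup>2 / (1 + (real (card (agree v w)) / real s) ^ 3))"
proof -
  interpret prob_space "noise_measure n" by (rule prob_space_noise)
  define \<sigma> where "\<sigma> = sqrt (real s ^ 3)"
  have \<sigma>: "\<sigma> > 0" "\<sigma>\<^sup>2 = real s ^ 3" using s by (simp_all add: \<sigma>_def)
  define a where "a = real (card (agree v w))"
  define \<rho> where "\<rho> = (a / real s) ^ 3"
  have \<rho>: "0 \<le> \<rho>" by (simp add: \<rho>_def a_def)
  have rs: "\<rho> * \<sigma>\<^sup>2 = a ^ 3" using s \<sigma> by (simp add: \<rho>_def power_divide)
  \<comment> \<open>Minimiser of the Chernoff exponent \<open>\<theta>\<^sup>2 * \<sigma>\<^sup>2 *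
    (1 + \<rho>) - 2 * \<theta> * \<tau> * \<sigma>\<close>, in which the variance of the sum of the
    forms is replaced by its bound \<open>2 * \<sigma>\<^sup>2 * (1 + \<rho>)\<close>.\<close>
  define \<theta> where "\<theta> = \<tau> / (\<sigma> * (1 + \<rho>))"
  have \<theta>: "\<theta> \<ge> 0" using \<tau> \<sigma> \<rho> by (simp add: \<theta>_def)
  let ?U = "\<lambda>t. \<theta> * (tensor_cube v t + tensor_cube w t)"
  let ?X = "\<lambda>Z. \<Sum>t\<in>tensor_index n. ?U t * Z t"
  have X: "?X Z = \<theta> * (cube_form n v Z + cube_form n w Z)" for Z
    by (simp add: cube_form_def sum_distrib_left sum.distrib[symmetric] algebra_simps)
  have int: "integrable (noise_measure n) (\<lambda>Z. exp (?X Z))"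
    unfolding noise_measure_def by (rule gauss_mgf) simp
  have "(\<Sum>t\<in>tensor_index n. (tensor_cube v t + tensor_cube w t)\<^sup>2)
    = 2 * \<sigma>\<^sup>2 + 2 * dot n v w ^ 3"
    unfolding power2_sum sum.distrib sum_tensor_cube_square[OF v] sum_tensor_cube_square[OF w] \<sigma>
    by (simp add: tensor_inner_cube[symmetric] tensor_inner_def mult.assoc sum_distrib_left[symmetric])
  \<comment> \<open>The cube is monotone on negative numbers too, so the sign of the inner product
    does not matter.\<close>
  moreover have "dot n v w ^ 3 \<le> a ^ 3"
    using dot_le_agree[OF v w] by (simp add: a_def power_mono_odd)
  ultimately have var: "(\<Sum>t\<in>tensor_index n. (tensor_cube v t + tensor_cube w t)\<^sup>2) \<le> 2 * \<sigma>\<^sup>2 * (1 + \<rho>)"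
    using rs by (simp add: algebra_simps)
  have "prob {Z \<in> space (noise_measure n). \<tau> * \<sigma> \<le> cube_form n v Z \<and> \<tau> * \<sigma> \<le> cube_form n w Z}
    \<le> prob {Z \<in> space (noise_measure n). exp (2 * \<theta> * \<tau> * \<sigma>) \<le> exp (?X Z)}"
  proof (rule finite_measure_mono)
    show "{Z \<in> space (noise_measure n). \<tau> * \<sigma> \<le> cube_form n v Z \<and> \<tau> * \<sigma> \<le> cube_form n w Z}
      \<subseteq> {Z \<in> space (noise_measure n). exp (2 * \<theta> * \<tau> * \<sigma>) \<le> exp (?X Z)}"
    proof
      fix Z assume Z: "Z \<in> {Z \<in> space (noise_measure n). \<tau> * \<sigma> \<le> cube_form n v Z \<and> \<tau> * \<sigma> \<le> cube_form n w Z}"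
      then have "\<theta> * (\<tau> * \<sigma> + \<tau> * \<sigma>) \<le> \<theta> * (cube_form n v Z + cube_form n w Z)"
        using \<theta> by (intro mult_left_mono add_mono) auto
      then show "Z \<in> {Z \<in> space (noise_measure n). exp (2 * \<theta> * \<tau> * \<sigma>) \<le> exp (?X Z)}"
        using Z unfolding X by (simp add: algebra_simps)
    qed
    show "{Z \<in> space (noise_measure n). exp (2 * \<theta> * \<tau> * \<sigma>) \<le> exp (?X Z)} \<in> events"
      unfolding X by measurable
  qed
  also have "\<dots> \<le> expectation (\<lambda>Z. exp (?X Z)) / exp (2 * \<theta> * \<tau> * \<sigma>)"
    by (rule integral_Markov_inequality_measure[OF int]) auto
  also have "expectation (\<lambda>Z. exp (?X Z)) = exp ((\<Sum>t\<in>tensor_index n. (?U t)\<^sup>2) / 2)"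
    unfolding noise_measure_def by (rule gauss_mgf) simp
  also have "(\<Sum>t\<in>tensor_index n. (?U t)\<^sup>2) / 2
    = \<theta>\<^sup>2 * (\<Sum>t\<in>tensor_index n. (tensor_cube v t + tensor_cube w t)\<^sup>2) / 2"
    by (simp add: power_mult_distrib sum_distrib_left)
  also have "exp \<dots> / exp (2 * \<theta> * \<tau> * \<sigma>) \<le> exp (\<theta>\<^sup>2 * (2 * \<sigma>\<^sup>2 * (1 + \<rho>)) / 2) / exp (2 * \<theta> * \<tau> * \<sigma>)"
    using mult_left_mono[OF var, of "\<theta>\<^sup>2"] by (intro divide_right_mono) (auto simp: mult_ac)
  also have "\<dots> = exp (\<theta>\<^sup>2 * (2 * \<sigma>\<^sup>2 * (1 + \<rho>)) / 2 - 2 * \<theta> * \<tau> * \<sigma>)"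
    by (simp add: exp_diff)
  also have "\<theta>\<^sup>2 * (2 * \<sigma>\<^sup>2 * (1 + \<rho>)) / 2 - 2 * \<theta> * \<tau> * \<sigma> = - \<tau>\<^sup>2 / (1 + \<rho>)"
  proof -
    have 1: "1 + \<rho> \<noteq> 0" using \<rho> by simp
    have "\<theta> * \<sigma> = \<tau> / (1 + \<rho>)" using \<sigma> by (simp add: \<theta>_def)
    then have e: "(\<theta> * \<sigma>) * (1 + \<rho>) = \<tau>" using 1 by simp
    have "\<theta>\<^sup>2 * (2 * \<sigma>\<^sup>2 * (1 + \<rho>)) / 2 - 2 * \<theta> * \<tau> * \<sigma> = (\<theta> * \<sigma>) * ((\<theta> * \<sigma>) * (1 + \<rho>)) - 2 * \<tau> * (\<theta> * \<sigma>)"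
      by (simp add: power2_eq_square)
    also have "\<dots> = - \<tau> * (\<theta> * \<sigma>)" unfolding e by simp
    also have "\<dots> = - \<tau>\<^sup>2 / (1 + \<rho>)" unfolding \<open>\<theta> * \<sigma> = \<tau> / (1 + \<rho>)\<close> by (simp add: power2_eq_square)
    finally show ?thesis .
  qed
  finally show ?thesis by (simp add: \<sigma>_def \<rho>_def a_def)
qed

lemma cube_form_disjoint_indep:
  assumes n: "0 < n" and "\<And>i. v i = 0 \<or> w i = 0"
  shows "measure (noise_measure n) {Z \<in> space (noise_measure n). a \<le> cube_form n v Z \<and> b \<le> cube_form n w Z}
    = measure (noise_measure n) {Z \<in> space (noise_measure n). a \<le> cube_form n v Z}
      * measure (noise_measure n) {Z \<in> space (noise_measure n). b \<le> cube_form n w Z}"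
  unfolding cube_form_def noise_measure_def
proof (rule gauss_linear_disjoint_indep)
  show "tensor_index n \<noteq> {}" using n by (auto simp: tensor_index_def)
  fix t show "tensor_cube v t = 0 \<or> tensor_cube w t = 0"
    using assms(2) by (cases t) (force simp: tensor_cube_def)
qed simp

lemma cube_form_tail_lower:
  assumes "w \<in> sign_vecs {..<n} s" "s > 0" "0 \<le> \<tau>" "0 \<le> \<delta>"
  shows "measure (noise_measure n) {Z \<in> space (noise_measure n). \<tau> * sqrt (real s ^ 3) \<le> cube_form n w Z}
    \<ge> \<delta> * exp (- (\<tau> + \<delta>)\<^sup>2 / 2) / sqrt (2 * pi)"
  unfolding cube_form_def noise_measure_def
  by (rule gauss_linear_tail_lower) (use assms sum_tensor_cube_square[OF assms(1)] in auto)

lemma cube_form_tail_eq: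
  assumes "v \<in> sign_vecs {..<n} s" "w \<in> sign_vecs {..<n} s" "s > 0"
  shows "measure (noise_measure n) {Z \<in> space (noise_measure n). a \<le> cube_form n v Z}
    = measure (noise_measure n) {Z \<in> space (noise_measure n). a \<le> cube_form n w Z}"
  unfolding cube_form_def noise_measure_def
  by (rule gauss_linear_prob_eq) (use assms in \<open>auto simp: sum_tensor_cube_square\<close>)

subsection \<open>Second moment bound for the maximum of the forms\<close>

definition log_count :: "nat \<Rightarrow> nat \<Rightarrow> real" where
  "log_count M s = ln (real ((M choose s) * 2 ^ s))"

text \<open>In units of the standard deviation of \<open>cube_form n w\<close>, the level that about \<open>s ^ 4\<close> of the
  \<open>exp (log_count M s)\<close> forms are expected to exceed.\<close>

definition peak :: "nat \<Rightarrow> nat \<Rightarrow> real" where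
  "peak M s = sqrt (2 * log_count M s - 8 * ln (real s))"

text \<open>The power 160 makes log M dominate the multiples of log s that arise in counting
  overlapping pairs. The last inequality gives \<open>peak M s \<le> real s\<close>, so that a
  factor of \<open>peak\<close> costs at most a power of s. The bound 6 absorbs numerical
  constants.\<close>

definition sparse_regime :: "nat \<Rightarrow> nat \<Rightarrow> bool" where
  "sparse_regime M s \<longleftrightarrow> 6 \<le> s \<and> s ^ 160 \<le> M \<and> 2 * ln (2 * real M) \<le> real s"

lemma sparse_regimeD:
  assumes "sparse_regime M s"
  shows "6 \<le> s" "2 * s \<le> M" "160 * ln (real s) \<le> ln (real M)" "ln 2 \<le> ln (real s)"
    "2 * ln (2 * real M) \<le> real s"
proof -
  show s: "6 \<le> s" and "2 * ln (2 * real M) \<le> real s" using assms by (auto simp: sparse_regime_def)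
  have le: "s ^ 160 \<le> M" using assms by (simp add: sparse_regime_def)
  have "s ^ 2 \<le> s ^ 160" using s by (intro power_increasing) auto
  moreover have "2 * s \<le> s ^ 2" using s by (simp add: power2_eq_square)
  ultimately show "2 * s \<le> M" using le by linarith
  have "real s ^ 160 \<le> real M" using le by (metis of_nat_le_iff of_nat_power)
  then have "ln (real s ^ 160) \<le> ln (real M)" using s by (intro ln_mono) auto
  then show "160 * ln (real s) \<le> ln (real M)" using s by (simp add: ln_realpow)
  show "ln 2 \<le> ln (real s)" using s by simp
qed

lemma exp_log_count:
  assumes "finite U" "s \<le> card U"
  shows "exp (log_count (card U) s) = real (card (sign_vecs U s))"
  using assms by (simp add: log_count_def card_sign_vecs)

lemma log_count_bounds:
  assumes "0 < s" "s \<le> M"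
  shows "real s * (ln 2 + ln (real M) - ln (real s)) \<le> log_count M s"
    and "log_count M s \<le> real s * (ln 2 + ln (real M))"
proof -
  have eq: "real (card (sign_vecs {..<M} s)) = real ((M choose s) * 2 ^ s)"
    by (simp add: card_sign_vecs)
  note b = card_sign_vecs_bounds[of "{..<M}" s, unfolded eq, simplified card_lessThan, OF _ assms]
  have "real s * (ln 2 + ln (real M) - ln (real s)) = ln ((2 * real M / real s) ^ s)"
    using assms by (simp add: ln_realpow ln_div ln_mult)
  also have "\<dots> \<le> log_count M s"
    unfolding log_count_def using b(1) assms by (intro ln_mono) auto
  finally show "real s * (ln 2 + ln (real M) - ln (real s)) \<le> log_count M s" .
  have "log_count M s \<le> ln ((2 * real M) ^ s)"
    unfolding log_count_def using b(2) assms by (intro ln_mono) auto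
  also have "\<dots> = real s * (ln 2 + ln (real M))"
    using assms by (simp add: ln_realpow ln_mult algebra_simps)
  finally show "log_count M s \<le> real s * (ln 2 + ln (real M))" .
qed

lemma peak_bounds:
  assumes "sparse_regime M s"
  shows "(peak M s)\<^sup>2 = 2 * log_count M s - 8 * ln (real s)"
    and "real s * ln (real M) \<le> (peak M s)\<^sup>2"
    and "(peak M s)\<^sup>2 \<le> 2 * real s * ln (2 * real M)"
    and "1 \<le> peak M s" "peak M s \<le> real s"
proof -
  note r = sparse_regimeD[OF assms]
  have s: "0 < s" "s \<le> M" "1 \<le> real s" "0 < M" using r(1,2) by auto
  note b = log_count_bounds[OF s(1,2)]
  have ls: "0 \<le> ln (real s)" using s by simp
  have lm: "ln (real M) \<ge> 160 * ln (real s)" by (rule r)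
  have ls1: "1 \<le> ln (real s)"
  proof -
    have "exp 1 \<le> real s" using r(1) exp_le by linarith
    then show ?thesis using s by (simp add: ln_ge_iff)
  qed
  have "real s * (ln (real M) - ln (real s)) \<le> real s * (ln 2 + ln (real M) - ln (real s))"
    by (intro mult_left_mono) auto
  moreover have "real s * ln (real M) + real s * (ln (real M) - 2 * ln (real s))
    = 2 * (real s * (ln (real M) - ln (real s)))" by (simp add: algebra_simps)
  ultimately have "real s * ln (real M) + real s * (ln (real M) - 2 * ln (real s)) \<le> 2 * log_count M s"
    using b(1) by linarith
  moreover have "1 * (158 * ln (real s)) \<le> real s * (ln (real M) - 2 * ln (real s))"
    using s lm ls by (intro mult_mono) auto
  ultimately have lo: "real s * ln (real M) \<le> 2 * log_count M s - 8 * ln (real s)" using ls by linarith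
  have pos: "1 * 1 \<le> real s * ln (real M)" using s ls1 lm by (intro mult_mono) auto
  show sq: "(peak M s)\<^sup>2 = 2 * log_count M s - 8 * ln (real s)"
    using lo pos by (simp add: peak_def)
  show "real s * ln (real M) \<le> (peak M s)\<^sup>2" using lo sq by simp
  then have "1 \<le> (peak M s)\<^sup>2" using pos by simp
  then show "1 \<le> peak M s"
    using sq lo pos by (simp add: peak_def)
  show hi: "(peak M s)\<^sup>2 \<le> 2 * real s * ln (2 * real M)"
  proof -
    have "2 * real s * ln (2 * real M) = 2 * (real s * (ln 2 + ln (real M)))"
      using s by (simp add: ln_mult)
    then show ?thesis unfolding sq using b(2) ls by linarith
  qed
  have "2 * real s * ln (2 * real M) \<le> real s * real s"
    using mult_left_mono[OF r(5), of "real s"] by (simp add: mult_ac)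
  then have "(peak M s)\<^sup>2 \<le> (real s)\<^sup>2" using hi by (simp add: power2_eq_square)
  then show "peak M s \<le> real s" by (rule power2_le_imp_le) simp
qed

text \<open>For a pair with fraction of agreement x, Chernoff's bound exceeds exp(-T^2) by the
  factor exp(T^2 x^3 / (1 + x^3)), and T^2 is at most twice the log count. Agreement lowers the log
  number of partners by about the fraction x of the log count. Since x enters the excess through its
  cube, the excess is smaller by a definite factor while x stays away from 1.\<close>

lemma overlap_rate_small:
  fixes x :: real
  assumes "0 \<le> x" "x \<le> 3 / 4"
  shows "2 * (x ^ 3 / (1 + x ^ 3)) \<le> 9 / 10 * x"
proof -
  have "x\<^sup>2 \<le> (3 / 4)\<^sup>2" using assms by (intro power_mono) auto
  then have "0 \<le> 20 * x + 15 - 9 * x\<^sup>2 - 27 / 4 * x - 81 / 16"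
    using assms by (simp add: power2_eq_square)
  then have "0 \<le> (3 / 4 - x) * (20 * x + 15 - 9 * x\<^sup>2 - 27 / 4 * x - 81 / 16)"
    using assms by (intro mult_nonneg_nonneg) auto
  \<comment> \<open>Division by x - 3/4: the remainder 99/64 is the value at 3/4, and the cofactor
    is nonnegative on the range in question.\<close>
  moreover have "9 + 9 * x ^ 3 - 20 * x\<^sup>2
    = 99 / 64 + (3 / 4 - x) * (20 * x + 15 - 9 * x\<^sup>2 - 27 / 4 * x - 81 / 16)"
    by (simp add: power2_eq_square power3_eq_cube field_simps)
  ultimately have "20 * x\<^sup>2 \<le> 9 + 9 * x ^ 3" by linarith
  then have "x * (20 * x\<^sup>2) \<le> x * (9 + 9 * x ^ 3)" using assms by (intro mult_left_mono)
  then have "20 * x ^ 3 \<le> 9 * x * (1 + x ^ 3)"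
    by (simp add: power2_eq_square power3_eq_cube algebra_simps)
  moreover have "0 < 1 + x ^ 3" using assms by (simp add: add_pos_nonneg)
  ultimately show ?thesis by (simp add: divide_le_eq)
qed

text \<open>Near full agreement the log number of partners is about the fraction 1 - x of the log
  count, and the exponent left over has to beat this fraction with a margin. It equals (1 - x)(1 + x
  + x^2) / (1 + x^3), and 9/8 is the bound 9/4 for the middle factor over the bound 2 for the
  denominator.\<close>

lemma overlap_rate_large:
  fixes x :: real
  assumes "3 / 4 \<le> x" "x \<le> 1"
  shows "9 / 8 * (1 - x) \<le> 1 - 2 * (x ^ 3 / (1 + x ^ 3))"
proof -
  have x3: "0 \<le> x ^ 3" "x ^ 3 \<le> 1" using assms by (auto simp: power_le_one)
  have "9 / 4 \<le> 1 + x + x\<^sup>2"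
    using assms mult_mono[OF assms(1) assms(1)] by (auto simp: power2_eq_square)
  then have "(1 - x) * (9 / 4) \<le> (1 - x) * (1 + x + x\<^sup>2)"
    using assms by (intro mult_left_mono) auto
  also have "\<dots> = 1 - x ^ 3" by (simp add: power2_eq_square power3_eq_cube algebra_simps)
  finally have 1: "9 / 8 * (1 - x) * 2 \<le> 1 - x ^ 3" by simp
  have "9 / 8 * (1 - x) * (1 + x ^ 3) \<le> 9 / 8 * (1 - x) * 2"
    using assms x3 by (intro mult_left_mono) auto
  with 1 have "9 / 8 * (1 - x) * (1 + x ^ 3) \<le> 1 - x ^ 3" by linarith
  moreover have "1 - 2 * (x ^ 3 / (1 + x ^ 3)) = (1 - x ^ 3) / (1 + x ^ 3)"
  proof -
    have "1 + x ^ 3 \<noteq> 0" using x3 by linarith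
    then show ?thesis by (simp add: field_simps)
  qed
  moreover have "0 < 1 + x ^ 3" using x3 by linarith
  ultimately show ?thesis by (simp only: pos_le_divide_eq)
qed

text \<open>The partners of v that agree with it in at least l places, weighted by the excess of
  Chernoff's bound over exp(-T^2), are a negligible part of all vectors. Up to x = 3/4, fixing l
  entries lowers the log count by about l log M, against an excess of 9/10 of that. Beyond 3/4, the
  j = s - l free entries contribute only about j log M, against a remaining budget of 9/8 of that.
  The power 13 leaves s^10 after summation over l and division by the squared tail
  probability.\<close>

lemma card_agree_tilted:
  assumes U: "finite U" and reg: "sparse_regime (card U) s" and v: "v \<in> sign_vecs U s"
    and l: "1 \<le> l" "l < s"
  shows "real (card {w \<in> sign_vecs U s. l \<le> card (agree v w)})
      * exp ((peak (card U) s)\<^sup>2 * ((real l / real s) ^ 3 / (1 + (real l / real s) ^ 3)))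
    \<le> real (card (sign_vecs U s)) / real s ^ 13"
proof -
  define M where "M = card U"
  note r = sparse_regimeD[OF reg, folded M_def]
  note p = peak_bounds[OF reg, folded M_def]
  have s: "0 < s" "s \<le> M" "0 < M" "1 \<le> real s" using r(1,2) by auto
  note lc = log_count_bounds[OF s(1,2)]
  define \<Lambda> where "\<Lambda> = log_count M s"
  define ls lm where "ls = ln (real s)" and "lm = ln (real M)"
  have es: "exp ls = real s" "exp lm = real M" "exp (ln 2) = (2::real)" using s by (simp_all add: ls_def lm_def)
  have ls0: "0 \<le> ls" using s by (simp add: ls_def)
  have W: "real (card (sign_vecs U s)) = exp \<Lambda>"
    using exp_log_count[OF U] s by (simp add: \<Lambda>_def M_def)
  have \<Lambda>0: "0 \<le> \<Lambda>"
  proof -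
    have "0 \<le> ln 2 + lm - ls" using r(3) ls0 ln_ge_zero[of "2::real"] unfolding lm_def ls_def by linarith
    then have "0 \<le> real s * (ln 2 + lm - ls)" by simp
    then show ?thesis using lc(1) by (simp add: \<Lambda>_def lm_def ls_def)
  qed
  define x where "x = real l / real s"
  have x: "0 \<le> x" "x \<le> 1" using l by (auto simp: x_def)
  define q where "q = x ^ 3 / (1 + x ^ 3)"
  have q: "0 \<le> q" using x by (simp add: q_def)
  have pq: "(peak M s)\<^sup>2 * q \<le> 2 * \<Lambda> * q"
    using p(1) ls0 q by (intro mult_right_mono) (auto simp: \<Lambda>_def ls_def)
  have goal': "exp \<Lambda> / real s ^ 13 = exp (\<Lambda> - 13 * ls)"
    using exp_of_nat_mult[of 13 ls] by (simp add: exp_diff es)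
  let ?C = "real (card {w \<in> sign_vecs U s. l \<le> card (agree v w)})"
  have C: "?C \<le> real (s choose l) * real (card (sign_vecs U (s - l)))"
    using card_sign_vecs_agree_le[OF U U v, of s l] by (simp only: of_nat_mult[symmetric] of_nat_le_iff)
  have "?C * exp ((peak M s)\<^sup>2 * q) \<le> exp (\<Lambda> - 13 * ls)"
  proof (cases "x \<le> 3 / 4")
    case True
    have "real (card (sign_vecs U (s - l))) * real M ^ l
        \<le> real (card (sign_vecs U (s - l))) * (2 * (real M - real s)) ^ l"
      using r(2) by (intro mult_left_mono power_mono) auto
    also have "\<dots> \<le> real s ^ l * exp \<Lambda>"
      using card_sign_vecs_ratio[OF U, of l s] l s by (simp add: M_def W)
    finally have "real (card (sign_vecs U (s - l))) \<le> real s ^ l * exp \<Lambda> / real M ^ l"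
      using s by (simp add: le_divide_eq)
    moreover have "real (s choose l) \<le> real s ^ l"
      using binomial_le_pow[of l s] l by (metis of_nat_le_iff of_nat_power less_imp_le)
    ultimately have "?C \<le> real s ^ l * (real s ^ l * exp \<Lambda> / real M ^ l)"
      using C by (intro order_trans[OF C] mult_mono) auto
    also have "\<dots> = exp (real l * ls) * (exp (real l * ls) * exp \<Lambda> / exp (real l * lm))"
      by (simp only: exp_of_nat_mult es)
    also have "\<dots> = exp (real l * ls + (real l * ls + \<Lambda> - real l * lm))"
      by (simp only: exp_add[symmetric] exp_diff[symmetric])
    also have "real l * ls + (real l * ls + \<Lambda> - real l * lm) = \<Lambda> + real l * (2 * ls - lm)"
      by (simp add: algebra_simps)
    finally have C': "?C \<le> exp (\<Lambda> + real l * (2 * ls - lm))" .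
    have "2 * \<Lambda> * q \<le> 2 * (real s * (ln 2 + lm)) * q"
      using lc(2) q by (intro mult_right_mono) (auto simp: \<Lambda>_def lm_def)
    also have "\<dots> = (real s * (ln 2 + lm)) * (2 * q)" by simp
    also have "\<dots> \<le> (real s * (ln 2 + lm)) * (9 / 10 * x)"
      using overlap_rate_small[OF x(1) True] r(3) ls0 s
      by (intro mult_left_mono) (auto simp: q_def lm_def ls_def)
    also have "\<dots> = 9 / 10 * real l * (ln 2 + lm)" using s by (simp add: x_def)
    finally have q': "(peak M s)\<^sup>2 * q \<le> 9 / 10 * real l * (ln 2 + lm)" using pq by linarith
    have "?C * exp ((peak M s)\<^sup>2 * q) \<le> exp (\<Lambda> + real l * (2 * ls - lm)) * exp (9 / 10 * real l * (ln 2 + lm))"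
      by (intro mult_mono C') (use q' in auto)
    also have "\<dots> = exp (\<Lambda> + real l * (2 * ls - lm / 10 + 9 / 10 * ln 2))"
      by (simp add: exp_add[symmetric] algebra_simps)
    also have "\<dots> \<le> exp (\<Lambda> - 13 * ls)"
    proof -
      \<comment> \<open>This step determines the power 160 in \<open>sparse_regime\<close>:
        \<open>lm / 10\<close> has to cover \<open>15 * ls\<close> and \<open>9 / 10 * ln 2\<close>,
        where \<open>ln 2 \<le> ls\<close>.\<close>
      have "real l * (2 * ls - lm / 10 + 9 / 10 * ln 2) \<le> real l * (- 13 * ls)"
        using r(3,4) ls0 by (intro mult_left_mono) (auto simp: ls_def lm_def)
      also have "\<dots> \<le> 1 * (- 13 * ls)"
        using l ls0 by (intro mult_right_mono_neg) auto
      finally show ?thesis by simp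
    qed
    finally show ?thesis .
  next
    case False
    define j where "j = s - l"
    have j: "1 \<le> j" "j \<le> s" "real j = real s - real l" using l by (auto simp: j_def)
    have "real (s choose l) \<le> real s ^ j"
      using binomial_le_pow[of j s] binomial_symmetric[of l s] l j
      by (metis j_def of_nat_le_iff of_nat_power less_imp_le)
    moreover have "real (card (sign_vecs U j)) \<le> (2 * real M) ^ j"
      unfolding M_def using j s by (intro card_sign_vecs_bounds U) (auto simp: M_def)
    ultimately have "?C \<le> real s ^ j * (2 * real M) ^ j"
      by (intro order_trans[OF C] mult_mono) (auto simp: j_def)
    also have "\<dots> = exp (real j * (ls + ln 2 + lm))"
      by (simp add: exp_of_nat_mult exp_add es power_mult_distrib)
    finally have C': "?C \<le> exp (real j * (ls + ln 2 + lm))" .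
    have "9 / 8 * (1 - x) \<le> 1 - 2 * q"
      using overlap_rate_large[of x] False x by (simp add: q_def)
    then have "9 / 8 * (1 - x) * \<Lambda> \<le> (1 - 2 * q) * \<Lambda>" using \<Lambda>0 by (intro mult_right_mono)
    moreover have "9 / 8 * (1 - x) * (real s * (lm - ls + ln 2)) \<le> 9 / 8 * (1 - x) * \<Lambda>"
      using lc(1) x by (intro mult_left_mono) (auto simp: \<Lambda>_def ls_def lm_def algebra_simps)
    moreover have "9 / 8 * (1 - x) * (real s * (lm - ls + ln 2)) = 9 / 8 * real j * (lm - ls + ln 2)"
      using s by (simp add: x_def j(3) field_simps)
    moreover have "(1 - 2 * q) * \<Lambda> = \<Lambda> - 2 * \<Lambda> * q" by (simp add: algebra_simps)
    ultimately have q': "(peak M s)\<^sup>2 * q \<le> \<Lambda> - 9 / 8 * real j * (lm - ls + ln 2)"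
      using pq by linarith
    have "?C * exp ((peak M s)\<^sup>2 * q) \<le> exp (real j * (ls + ln 2 + lm)) * exp (\<Lambda> - 9 / 8 * real j * (lm - ls + ln 2))"
      by (intro mult_mono C') (use q' in auto)
    also have "\<dots> = exp (\<Lambda> + real j * (17 / 8 * ls - lm / 8 - ln 2 / 8))"
      by (simp add: exp_add[symmetric] field_simps)
    also have "\<dots> \<le> exp (\<Lambda> - 13 * ls)"
    proof -
      have "17 / 8 * ls - lm / 8 - ln 2 / 8 \<le> - 13 * ls"
        using r(3) ls0 ln_ge_zero[of "2::real"] unfolding ls_def lm_def by linarith
      then have "real j * (17 / 8 * ls - lm / 8 - ln 2 / 8) \<le> real j * (- 13 * ls)"
        by (rule mult_left_mono) simp
      also have "\<dots> \<le> 1 * (- 13 * ls)"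
        using j ls0 by (intro mult_right_mono_neg) auto
      finally show ?thesis by simp
    qed
    finally show ?thesis .
  qed
  then show ?thesis unfolding W goal' by (simp add: q_def x_def M_def)
qed

text \<open>The level lies 1/T below the peak, so a single form exceeds it with probability at least
  exp(-T^2/2) / (T sqrt(2 pi)). There are s^4 exp(T^2/2) forms and T is at most s, so at least s^3/3
  exceedances are expected. In the normalised variance the identical pairs contribute at most 3/s^3,
  pairs with disjoint supports nothing, all other pairs at most 162/s^10.\<close>

lemma cube_forms_all_small_prob:
  assumes U: "U \<subseteq> {..<n}" and reg: "sparse_regime (card U) s"
  defines "T \<equiv> peak (card U) s"
  shows "measure (noise_measure n)
      {Z \<in> space (noise_measure n). \<forall>w\<in>sign_vecs U s. cube_form n w Z < (T - 1 / T) * sqrt (real s ^ 3)}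
    \<le> 1 / (real s)\<^sup>2"
proof -
  interpret prob_space "noise_measure n" by (rule prob_space_noise)
  have fU: "finite U" using U by (rule finite_subset) simp
  note r = sparse_regimeD[OF reg]
  note p = peak_bounds[OF reg, folded T_def]
  have s: "0 < s" "s \<le> card U" "1 \<le> real s" "6 \<le> real s" using r(1,2) by auto
  have n0: "0 < n" using U s by (cases n) auto
  define W where "W = sign_vecs U s"
  have Wn: "w \<in> sign_vecs {..<n} s" if "w \<in> W" for w
    using that sign_vecs_mono[OF U] by (auto simp: W_def)
  define cW where "cW = real (card W)"
  have cW: "cW = exp (log_count (card U) s)"
    unfolding cW_def W_def by (rule exp_log_count[OF fU s(2), symmetric])
  have cW0: "0 < cW" by (simp add: cW)
  have fW: "finite W" unfolding W_def by (rule card_sign_vecs[OF fU])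
  have W0: "W \<noteq> {}" using cW0 by (auto simp: cW_def)
  define \<tau> where "\<tau> = T - 1 / T"
  define \<sigma> where "\<sigma> = sqrt (real s ^ 3)"
  have "1 / T \<le> 1" using p(4) by simp
  then have "1 / T \<le> T" using p(4) by linarith
  then have \<tau>: "0 \<le> \<tau>" "\<tau> \<le> T" using p(4) by (auto simp: \<tau>_def)
  define E where "E w = {Z \<in> space (noise_measure n). \<tau> * \<sigma> \<le> cube_form n w Z}" for w
  have Em: "E w \<in> events" for w unfolding E_def by measurable
  obtain w0 where w0: "w0 \<in> W" using W0 by auto
  define P1 where "P1 = prob (E w0)"
  have P1: "prob (E w) = P1" if "w \<in> W" for w
    unfolding P1_def E_def by (rule cube_form_tail_eq[OF Wn[OF that] Wn[OF w0] s(1)])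
  have low: "exp (- T\<^sup>2 / 2) / (T * sqrt (2 * pi)) \<le> P1"
    using cube_form_tail_lower[OF Wn[OF w0] s(1) \<tau>(1), of "1 / T"] p(4)
    by (simp add: P1_def E_def \<sigma>_def \<tau>_def)
  have "0 < exp (- T\<^sup>2 / 2) / (T * sqrt (2 * pi))" using p(4) by simp
  then have P10: "0 < P1" using low by linarith
  have pi4: "sqrt (2 * pi) \<le> 3"
    using pi_less_4 by (intro real_le_lsqrt) (auto intro: order_trans[OF mult_left_mono[of pi 4 2]])
  have e2: "exp 2 \<le> (9::real)"
  proof -
    have "exp (2::real) = exp 1 * exp 1" by (simp add: exp_add[symmetric])
    also have "\<dots> \<le> 3 * 3" by (intro mult_mono exp_le) auto
    finally show ?thesis by simp
  qed

  have pairs: "(\<Sum>w\<in>W. prob (E v \<inter> E w) - P1\<^sup>2) \<le> P1 + exp (2 - T\<^sup>2) * (cW * (2 / real s ^ 12))"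
    if v: "v \<in> W" for v
  proof -
    define a where "a w = card (agree v w)" for w
    define rr where "rr l = (real l / real s) ^ 3 / (1 + (real l / real s) ^ 3)" for l
    \<comment> \<open>Summing over all thresholds up to \<open>a w\<close> overestimates the single
      term needed, but turns the sum over w into the counts bounded above. The last summand covers
      vectors that meet the support of v with opposite signs only: they are not independent of v,
      but agree with -v somewhere, and the same count shows that they are rare.\<close>
    define g where "g w = (\<Sum>l=1..<s. if l \<le> a w then exp (T\<^sup>2 * rr l) else 0)
      + (if 1 \<le> card (agree (\<lambda>i. - v i) w) then exp (T\<^sup>2 * rr 1) else 0)" for w
    have rr0: "0 \<le> rr l" for l by (simp add: rr_def)
    have g0: "0 \<le> g w" for w unfolding g_def by (intro add_nonneg_nonneg sum_nonneg) auto
    have pw: "prob (E v \<inter> E w) - P1\<^sup>2 \<le> (if w = v then P1 else 0) + exp (2 - T\<^sup>2) * g w"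
      if w: "w \<in> W" for w
    proof (cases "w = v")
      case True
      have "0 \<le> exp (2 - T\<^sup>2) * g w" using g0 by simp
      moreover have "0 \<le> P1\<^sup>2" by simp
      ultimately have "P1 - P1\<^sup>2 \<le> P1 + exp (2 - T\<^sup>2) * g w" by linarith
      moreover have "prob (E v \<inter> E w) = P1" using True P1[OF v] by simp
      ultimately show ?thesis using True by (simp only: if_True simp_thms)
    next
      case False
      have Eeq: "E v \<inter> E w = {Z \<in> space (noise_measure n). \<tau> * \<sigma> \<le> cube_form n v Z \<and> \<tau> * \<sigma> \<le> cube_form n w Z}"
        by (auto simp: E_def)
      show ?thesis
      proof (cases "\<forall>i. v i = 0 \<or> w i = 0")
        case True
        have "prob (E v \<inter> E w) = prob (E v) * prob (E w)"
          unfolding Eeq unfolding E_def using True by (intro cube_form_disjoint_indep n0) auto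
        then show ?thesis using P1[OF v] P1[OF w] g0[of w] False by (simp add: power2_eq_square)
      next
        case inter: False
        have aw: "a w < s"
        proof (rule ccontr)
          assume "\<not> a w < s"
          then have "w = v" using agree_full[OF fU, of v s w] v w by (simp add: W_def a_def)
          then show False using False by simp
        qed
        have "exp (T\<^sup>2 * rr (a w)) \<le> g w"
        proof (cases "a w = 0")
          case True
          obtain i where i: "v i \<noteq> 0" "w i \<noteq> 0" using inter by auto
          have fin: "finite (agree x w)" if "x \<in> sign_vecs U s" for x
            using that fU by (auto simp: agree_def sign_vecs_def intro: finite_subset[of _ U])
          have "i \<notin> agree v w" using True fin[of v] v by (auto simp: a_def W_def)
          then have "w i \<noteq> v i" using i by (simp add: agree_def)
          then have "i \<in> agree (\<lambda>i. - v i) w"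
            using i v w sign_vecsD(1)[of v U s i] sign_vecsD(1)[of w U s i]
            by (auto simp: W_def agree_def)
          moreover have "finite (agree (\<lambda>i. - v i) w)" using fin uminus_sign_vecs v by (auto simp: W_def)
          ultimately have "1 \<le> card (agree (\<lambda>i. - v i) w)" by (metis One_nat_def Suc_leI card_gt_0_iff empty_iff)
          then have "exp (T\<^sup>2 * rr 1) \<le> g w"
            unfolding g_def by (auto intro!: sum_nonneg)
          moreover have "exp (T\<^sup>2 * rr (a w)) \<le> exp (T\<^sup>2 * rr 1)"
            using True rr0[of 1] by (simp add: rr_def)
          ultimately show ?thesis by linarith
        next
          case False
          have "exp (T\<^sup>2 * rr (a w)) \<le> (\<Sum>l=1..<s. if l \<le> a w then exp (T\<^sup>2 * rr l) else 0)"
            using member_le_sum[of "a w" "{1..<s}" "\<lambda>l. if l \<le> a w then exp (T\<^sup>2 * rr l) else 0"] False aw by simp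
          also have "\<dots> \<le> g w" unfolding g_def by simp
          finally show ?thesis .
        qed
        moreover have "prob (E v \<inter> E w) \<le> exp (2 - T\<^sup>2) * exp (T\<^sup>2 * rr (a w))"
        proof -
          define \<rho> where "\<rho> = (real (a w) / real s) ^ 3"
          have \<rho>: "0 \<le> \<rho>" by (simp add: \<rho>_def)
          have "prob (E v \<inter> E w) \<le> exp (- \<tau>\<^sup>2 / (1 + \<rho>))"
            unfolding Eeq \<sigma>_def \<rho>_def a_def
            by (rule cube_form_joint_tail[OF Wn[OF v] Wn[OF w] s(1) \<tau>(1)])
          also have "- \<tau>\<^sup>2 / (1 + \<rho>) \<le> 2 - T\<^sup>2 + T\<^sup>2 * rr (a w)"
          proof -
            \<comment> \<open>Source of the factor exp 2: lowering the level by 1/T changes its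
              square by less than 2.\<close>
            have "T\<^sup>2 - \<tau>\<^sup>2 = 2 - (1 / T)\<^sup>2"
              using p(4) by (simp add: \<tau>_def power2_diff)
            then have "T\<^sup>2 - \<tau>\<^sup>2 \<le> 2" by simp
            also have "2 \<le> 2 * (1 + \<rho>)" using \<rho> by simp
            finally have "T\<^sup>2 - \<tau>\<^sup>2 \<le> 2 * (1 + \<rho>)" .
            then have "(T\<^sup>2 - \<tau>\<^sup>2) / (1 + \<rho>) \<le> 2" using \<rho> by (simp add: divide_le_eq)
            moreover have "T\<^sup>2 * rr (a w) = T\<^sup>2 - T\<^sup>2 / (1 + \<rho>)"
            proof -
              have "1 + \<rho> \<noteq> 0" using \<rho> by linarith
              then have "rr (a w) = 1 - 1 / (1 + \<rho>)"
                unfolding rr_def \<rho>_def[symmetric] by (simp add: field_simps)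
              then show ?thesis by (simp only: right_diff_distrib) simp
            qed
            ultimately show ?thesis by (simp add: diff_divide_distrib)
          qed
          finally show ?thesis by (simp add: exp_add)
        qed
        ultimately have "prob (E v \<inter> E w) \<le> exp (2 - T\<^sup>2) * g w"
          by (meson exp_ge_zero mult_left_mono order_trans)
        then show ?thesis using False by (simp add: le_diff_eq add_increasing2 diff_le_eq)
      qed
    qed
    have gs: "(\<Sum>w\<in>W. g w) \<le> cW * (2 / real s ^ 12)"
    proof -
      have cnt: "(\<Sum>w\<in>W. if l \<le> card (agree x w) then exp (T\<^sup>2 * rr l) else 0) \<le> cW / real s ^ 13"
        if "1 \<le> l" "l < s" "x \<in> sign_vecs U s" for l x
      proof -
        have "(\<Sum>w\<in>W. if l \<le> card (agree x w) then exp (T\<^sup>2 * rr l) else 0)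
          = real (card {w \<in> sign_vecs U s. l \<le> card (agree x w)}) * exp (T\<^sup>2 * rr l)"
          using fW by (simp add: sum.If_cases W_def Int_def)
        also have "\<dots> \<le> cW / real s ^ 13"
          unfolding T_def rr_def cW_def W_def by (rule card_agree_tilted[OF fU reg that(3,1,2)])
        finally show ?thesis .
      qed
      have "(\<Sum>w\<in>W. g w) = (\<Sum>l=1..<s. \<Sum>w\<in>W. if l \<le> card (agree v w) then exp (T\<^sup>2 * rr l) else 0)
        + (\<Sum>w\<in>W. if 1 \<le> card (agree (\<lambda>i. - v i) w) then exp (T\<^sup>2 * rr 1) else 0)"
        unfolding g_def a_def by (simp add: sum.distrib) (rule sum.swap)
      \<comment> \<open>The s - 1 thresholds and the reflected term make s equal
        contributions.\<close>
      also have "\<dots> \<le> (\<Sum>l=1..<s. cW / real s ^ 13) + cW / real s ^ 13"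
        using r(1) v uminus_sign_vecs[of v U s] by (intro add_mono sum_mono cnt) (auto simp: W_def)
      also have "\<dots> = real s * (cW / real s ^ 13)"
        using s by (simp add: of_nat_diff algebra_simps diff_divide_distrib)
      also have "\<dots> = cW * (1 / real s ^ 12)"
        using s by (simp add: field_simps power_numeral_reduce)
      also have "\<dots> \<le> cW * (2 / real s ^ 12)"
        using cW0 by (intro mult_left_mono divide_right_mono) auto
      finally show ?thesis .
    qed
    have "(\<Sum>w\<in>W. prob (E v \<inter> E w) - P1\<^sup>2) \<le> (\<Sum>w\<in>W. (if w = v then P1 else 0) + exp (2 - T\<^sup>2) * g w)"
      by (rule sum_mono) (rule pw)
    also have "\<dots> = P1 + exp (2 - T\<^sup>2) * (\<Sum>w\<in>W. g w)"
      using v fW by (simp add: sum.distrib sum_distrib_left[symmetric])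
    also have "\<dots> \<le> P1 + exp (2 - T\<^sup>2) * (cW * (2 / real s ^ 12))"
      by (intro add_left_mono mult_left_mono gs) simp
    finally show ?thesis .
  qed

  have "{Z \<in> space (noise_measure n). \<forall>w\<in>sign_vecs U s. cube_form n w Z < (T - 1 / T) * sqrt (real s ^ 3)}
    = {Z \<in> space (noise_measure n). \<forall>w\<in>W. Z \<notin> E w}"
    by (auto simp: E_def W_def \<tau>_def \<sigma>_def not_le)
  then have "prob {Z \<in> space (noise_measure n). \<forall>w\<in>sign_vecs U s. cube_form n w Z < (T - 1 / T) * sqrt (real s ^ 3)}
    \<le> (\<Sum>v\<in>W. \<Sum>w\<in>W. prob (E v \<inter> E w) - P1\<^sup>2) / (cW * P1)\<^sup>2"
    using none_occurs_second_moment[OF fW W0 Em P1 P10] by (simp add: cW_def)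
  also have "\<dots> \<le> (\<Sum>v\<in>W. P1 + exp (2 - T\<^sup>2) * (cW * (2 / real s ^ 12))) / (cW * P1)\<^sup>2"
    by (intro divide_right_mono sum_mono pairs) auto
  also have "\<dots> = 1 / (cW * P1) + 2 * exp (2 - T\<^sup>2) / (P1\<^sup>2 * real s ^ 12)"
    using cW0 P10 s by (simp add: cW_def[symmetric] field_simps power2_eq_square)
  also have "\<dots> \<le> 3 / real s ^ 3 + 162 / real s ^ 10"
  proof (rule add_mono)
    have "real s ^ 4 * exp (T\<^sup>2 / 2) = cW"
    proof -
      have half: "T\<^sup>2 / 2 = log_count (card U) s - 4 * ln (real s)" using p(1) by simp
      have "exp (4 * ln (real s)) = real s ^ 4"
        using exp_of_nat_mult[of 4 "ln (real s)"] s by simp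
      then show ?thesis unfolding half exp_diff cW using s by simp
    qed
    then have "real s ^ 4 = cW * exp (- T\<^sup>2 / 2)"
      by (metis exp_add exp_zero add.right_inverse minus_divide_left mult.assoc mult.right_neutral)
    then have "real s ^ 4 / (T * sqrt (2 * pi)) = cW * (exp (- T\<^sup>2 / 2) / (T * sqrt (2 * pi)))"
      by simp
    also have "\<dots> \<le> cW * P1" using low cW0 by (intro mult_left_mono) auto
    finally have "1 / (cW * P1) \<le> 1 / (real s ^ 4 / (T * sqrt (2 * pi)))"
      using s p(4) cW0 P10 by (intro divide_left_mono mult_pos_pos) auto
    also have "\<dots> = T * sqrt (2 * pi) / real s ^ 4" by simp
    also have "\<dots> \<le> real s * 3 / real s ^ 4"
      using p(4,5) pi4 by (intro divide_right_mono mult_mono) auto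
    also have "\<dots> = 3 / real s ^ 3" using s by (simp add: field_simps power_numeral_reduce)
    finally show "1 / (cW * P1) \<le> 3 / real s ^ 3" .
  next
    have T0: "0 < T" using p(4) by simp
    have "exp (- T\<^sup>2) / (9 * (real s)\<^sup>2) \<le> exp (- T\<^sup>2) / (T * sqrt (2 * pi))\<^sup>2"
    proof (rule divide_left_mono)
      have "(T * sqrt (2 * pi))\<^sup>2 \<le> (real s * 3)\<^sup>2"
        using p(4,5) pi4 by (intro power_mono mult_mono) auto
      then show "(T * sqrt (2 * pi))\<^sup>2 \<le> 9 * (real s)\<^sup>2" by (simp add: power_mult_distrib)
      show "0 < 9 * (real s)\<^sup>2 * (T * sqrt (2 * pi))\<^sup>2" using s T0 by simp
    qed simp
    also have "\<dots> = (exp (- T\<^sup>2 / 2) / (T * sqrt (2 * pi)))\<^sup>2"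
      by (simp add: power_divide exp_double[symmetric])
    also have "\<dots> \<le> P1\<^sup>2" using low T0 by (intro power_mono) auto
    finally have P1sq: "exp (- T\<^sup>2) / (9 * (real s)\<^sup>2) \<le> P1\<^sup>2" .
    have "2 * exp (2 - T\<^sup>2) / (P1\<^sup>2 * real s ^ 12)
      \<le> 2 * exp (2 - T\<^sup>2) / (exp (- T\<^sup>2) / (9 * (real s)\<^sup>2) * real s ^ 12)"
      using P1sq P10 s by (intro divide_left_mono mult_right_mono mult_pos_pos) auto
    also have "\<dots> = 18 * exp 2 / real s ^ 10"
      using s by (simp add: exp_diff exp_minus field_simps power_numeral_reduce)
    also have "\<dots> \<le> 162 / real s ^ 10" using e2 by (intro divide_right_mono) auto
    finally show "2 * exp (2 - T\<^sup>2) / (P1\<^sup>2 * real s ^ 12) \<le> 162 / real s ^ 10" .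
  qed
  also have "\<dots> \<le> 1 / (real s)\<^sup>2"
  proof -
    have "324 \<le> (6::real) ^ 8" by simp
    also have "\<dots> \<le> real s ^ 8" using s by (intro power_mono) auto
    finally have "162 * 2 \<le> real s ^ 8" by simp
    then have "162 / real s ^ 8 \<le> 1 / 2" using s by (simp add: divide_le_eq)
    moreover have "3 / real s \<le> 1 / 2" using s by (simp add: divide_le_eq)
    ultimately have "(3 / real s + 162 / real s ^ 8) / (real s)\<^sup>2 \<le> 1 / (real s)\<^sup>2"
      by (intro divide_right_mono) auto
    moreover have "(3 / real s + 162 / real s ^ 8) / (real s)\<^sup>2 = 3 / real s ^ 3 + 162 / real s ^ 10"
    proof -
      have "real s * (real s)\<^sup>2 = real s ^ 3" "real s ^ 8 * (real s)\<^sup>2 = real s ^ 10"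
        by (simp_all add: power2_eq_square power3_eq_cube)
          (simp add: power_add[symmetric] power2_eq_square[symmetric])
      then show ?thesis by (simp only: add_divide_distrib divide_divide_eq_left)
    qed
    ultimately show ?thesis by simp
  qed
  finally show ?thesis .
qed

text \<open>The 3 counts losses in units of the standard deviation over T: the lowered level, the
  level missed on the bad event, and the value of a single form there. A failure probability of
  1/s^2 suffices because T is at most s.\<close>

lemma expected_max_cube_form_lower:
  assumes U: "U \<subseteq> {..<n}" and reg: "sparse_regime (card U) s"
  defines "T \<equiv> peak (card U) s"
  shows "integrable (noise_measure n) (\<lambda>Z. Max ((\<lambda>w. cube_form n w Z) ` sign_vecs U s))"
    and "(\<integral>Z. Max ((\<lambda>w. cube_form n w Z) ` sign_vecs U s) \<partial>noise_measure n)
      \<ge> sqrt (real s ^ 3) / T * (T\<^sup>2 - 3)"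
proof -
  interpret prob_space "noise_measure n" by (rule prob_space_noise)
  have fU: "finite U" using U by (rule finite_subset) simp
  note r = sparse_regimeD[OF reg]
  note p = peak_bounds[OF reg, folded T_def]
  have s: "0 < s" "s \<le> card U" "1 \<le> real s" "6 \<le> real s" using r(1,2) by auto
  define W where "W = sign_vecs U s"
  have fW: "finite W" unfolding W_def by (rule card_sign_vecs[OF fU])
  have "0 < real (card W)" unfolding W_def using exp_log_count[OF fU s(2)] exp_gt_zero by metis
  then have W0: "W \<noteq> {}" by auto
  then obtain w0 where w0: "w0 \<in> W" by auto
  have Wn: "w \<in> sign_vecs {..<n} s" if "w \<in> W" for w
    using that sign_vecs_mono[OF U] by (auto simp: W_def)
  define F where "F Z = Max ((\<lambda>w. cube_form n w Z) ` W)" for Z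
  note mom = cube_form_moments[OF Wn s(1)]
  have Fm [measurable]: "F \<in> borel_measurable (noise_measure n)"
    unfolding F_def[abs_def] using fW W0 by (intro borel_measurable_Max) auto
  have Fint: "integrable (noise_measure n) F"
  proof (rule Bochner_Integration.integrable_bound[where f = "\<lambda>Z. \<Sum>w\<in>W. \<bar>cube_form n w Z\<bar>"])
    show "integrable (noise_measure n) (\<lambda>Z. \<Sum>w\<in>W. \<bar>cube_form n w Z\<bar>)"
      using mom(1) by (intro Bochner_Integration.integrable_sum integrable_abs) auto
    show "AE Z in noise_measure n. norm (F Z) \<le> norm (\<Sum>w\<in>W. \<bar>cube_form n w Z\<bar>)"
    proof (rule AE_I2)
      fix Z
      have "F Z \<in> (\<lambda>w. cube_form n w Z) ` W"
        unfolding F_def using fW W0 by (intro Max_in) auto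
      then obtain w where w: "w \<in> W" "F Z = cube_form n w Z" by auto
      have "\<bar>cube_form n w Z\<bar> \<le> (\<Sum>w\<in>W. \<bar>cube_form n w Z\<bar>)"
        by (rule member_le_sum[OF w(1)]) (use fW in auto)
      then show "norm (F Z) \<le> norm (\<Sum>w\<in>W. \<bar>cube_form n w Z\<bar>)" using w by simp
    qed
  qed measurable
  then show "integrable (noise_measure n) (\<lambda>Z. Max ((\<lambda>w. cube_form n w Z) ` sign_vecs U s))"
    by (simp add: F_def[abs_def] W_def)
  define \<tau> where "\<tau> = T - 1 / T"
  define \<sigma> where "\<sigma> = sqrt (real s ^ 3)"
  have \<sigma>: "0 < \<sigma>" "\<sigma>\<^sup>2 = real s ^ 3" using s by (simp_all add: \<sigma>_def)
  have T1: "1 \<le> T" "T \<le> real s" using p by auto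
  have \<tau>: "\<tau> \<le> T" "0 \<le> \<tau>"
  proof -
    show "\<tau> \<le> T" using T1 by (simp add: \<tau>_def)
    have "1 / T \<le> 1" using T1 by simp
    then have "1 / T \<le> T" using T1 by linarith
    then show "0 \<le> \<tau>" by (simp add: \<tau>_def)
  qed
  define B where "B = {Z \<in> space (noise_measure n). \<forall>w\<in>W. cube_form n w Z < \<tau> * \<sigma>}"
  have Bm [measurable]: "B \<in> events" unfolding B_def using fW by measurable
  have PB: "prob B \<le> 1 / (real s)\<^sup>2"
    using cube_forms_all_small_prob[OF U reg] by (simp add: B_def W_def \<tau>_def \<sigma>_def T_def)
  \<comment> \<open>On the bad event \<open>B\<close> the maximum is at least the single form \<open>w0\<close>; AM-GM splits
    \<open>\<bar>cube_form n w0 Z\<bar> * indicator B Z\<close> into its second moment and the probability of \<open>B\<close>.\<close>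
  define G where "G Z = \<sigma> * \<tau> - (\<sigma> * \<tau> + \<sigma> * real s / 2) * indicator B Z
      - (cube_form n w0 Z)\<^sup>2 / (2 * \<sigma> * real s)" for Z
  have ib: "integrable (noise_measure n) (indicator B :: _ \<Rightarrow> real)"
    using Bm by (auto simp: integrable_indicator_iff emeasure_eq_measure)
  have Gint: "integrable (noise_measure n) G"
    unfolding G_def[abs_def] using ib mom(3)[OF w0] by simp
  have "expectation G = \<sigma> * \<tau> - (\<sigma> * \<tau> + \<sigma> * real s / 2) * prob B - \<sigma>\<^sup>2 / (2 * \<sigma> * real s)"
    unfolding G_def[abs_def] using ib mom(3,4)[OF w0] Bm \<sigma> by (simp add: prob_space)
  also have "\<dots> \<ge> \<sigma> * \<tau> - (\<sigma> * T + \<sigma> * real s / 2) * (1 / (real s)\<^sup>2) - \<sigma>\<^sup>2 / (2 * \<sigma> * real s)"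
    using \<sigma> \<tau> PB T1 s by (intro diff_mono mult_mono add_mono order_refl) auto
  finally have EG: "\<sigma> * \<tau> - (\<sigma> * T + \<sigma> * real s / 2) * (1 / (real s)\<^sup>2) - \<sigma>\<^sup>2 / (2 * \<sigma> * real s) \<le> expectation G" .
  have "expectation G \<le> expectation F"
  proof (rule integral_mono[OF Gint Fint])
    fix Z assume Z: "Z \<in> space (noise_measure n)"
    have F_ge: "cube_form n w Z \<le> F Z" if "w \<in> W" for w
      unfolding F_def using that fW by (intro Max_ge) auto
    show "G Z \<le> F Z"
    proof (cases "Z \<in> B")
      case False
      then obtain w where w: "w \<in> W" "\<tau> * \<sigma> \<le> cube_form n w Z"
        using Z by (auto simp: B_def not_less)
      have "0 \<le> (cube_form n w0 Z)\<^sup>2 / (2 * \<sigma> * real s)" using \<sigma> by simp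
      then have "G Z \<le> \<tau> * \<sigma>" using False by (simp add: G_def mult.commute)
      then show ?thesis using w F_ge[OF w(1)] by linarith
    next
      case True
      have "0 \<le> (cube_form n w0 Z + \<sigma> * real s)\<^sup>2" by simp
      then have "- cube_form n w0 Z * (2 * \<sigma> * real s) \<le> (cube_form n w0 Z)\<^sup>2 + (\<sigma> * real s)\<^sup>2"
        by (simp add: power2_sum algebra_simps)
      then have "- cube_form n w0 Z \<le> ((cube_form n w0 Z)\<^sup>2 + (\<sigma> * real s)\<^sup>2) / (2 * \<sigma> * real s)"
        using \<sigma> s by (simp add: le_divide_eq)
      also have "\<dots> = (cube_form n w0 Z)\<^sup>2 / (2 * \<sigma> * real s) + \<sigma> * real s / 2"
        using \<sigma> s by (simp add: add_divide_distrib power2_eq_square)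
      finally have "G Z \<le> cube_form n w0 Z" using True by (simp add: G_def)
      then show ?thesis using F_ge[OF w0] by linarith
    qed
  qed
  \<comment> \<open>With weight \<open>\<sigma> * real s\<close> both halves of the AM-GM splitting
    have mean at most \<open>\<sigma> / (2 * real s)\<close>. Then T/s^2 \<le> 1/s \<le> 1/T turns
    each loss into one unit.\<close>
  moreover have "\<sigma> / T * (T\<^sup>2 - 3) \<le> \<sigma> * \<tau> - (\<sigma> * T + \<sigma> * real s / 2) * (1 / (real s)\<^sup>2) - \<sigma>\<^sup>2 / (2 * \<sigma> * real s)"
  proof -
    have "T / (real s)\<^sup>2 \<le> 1 / real s" "1 / real s \<le> 1 / T"
      using T1 s by (auto simp: divide_le_eq power2_eq_square le_divide_eq mult.commute)
    then have "T - 3 / T \<le> \<tau> - T / (real s)\<^sup>2 - 1 / real s" by (simp add: \<tau>_def)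
    then have "\<sigma> * (T - 3 / T) \<le> \<sigma> * (\<tau> - T / (real s)\<^sup>2 - 1 / real s)" using \<sigma> by simp
    moreover have "\<sigma> * (T - 3 / T) = \<sigma> / T * (T\<^sup>2 - 3)" using T1 by (simp add: field_simps power2_eq_square)
    moreover have "\<sigma> * (\<tau> - T / (real s)\<^sup>2 - 1 / real s)
      = \<sigma> * \<tau> - (\<sigma> * T + \<sigma> * real s / 2) * (1 / (real s)\<^sup>2) - \<sigma>\<^sup>2 / (2 * \<sigma> * real s)"
      using \<sigma> s by (simp add: field_simps power2_eq_square)
    ultimately show ?thesis by linarith
  qed
  ultimately show "(\<integral>Z. Max ((\<lambda>w. cube_form n w Z) ` sign_vecs U s) \<partial>noise_measure n)
      \<ge> sqrt (real s ^ 3) / T * (T\<^sup>2 - 3)"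
    using EG by (simp add: F_def[abs_def] W_def \<sigma>_def)
qed

subsection \<open>The potential at a fixed signal\<close>

definition sizes :: "nat \<Rightarrow> nat set" where
  "sizes k = {s. real k / 2 \<le> real s \<and> real s \<le> 2 * real k}"

definition signals :: "nat \<Rightarrow> nat \<Rightarrow> (nat \<Rightarrow> real) set" where
  "signals n k = (\<Union>s\<in>sizes k. sign_vecs {..<n} s)"

lemma finite_sizes [simp]: "finite (sizes k)"
  by (rule finite_subset[of _ "{..2 * k}"]) (auto simp: sizes_def)

lemma card_sizes: "card (sizes k) \<le> 2 * k + 1"
proof -
  have "sizes k \<subseteq> {..2 * k}" by (auto simp: sizes_def)
  from card_mono[OF _ this] show ?thesis by simp
qed

lemma sizes_self: "k \<in> sizes k"
  by (simp add: sizes_def)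

lemma finite_signals [simp]: "finite (signals n k)"
  by (auto simp: signals_def card_sign_vecs)

section \<open>Support and point masses of the signal\<close>

lemma set_rademacher_entry: "set_pmf (rademacher_entry n k) \<subseteq> {-1, 0, 1}"
  by (auto simp: rademacher_entry_def split: if_splits)

lemma truncate_vec_signals:
  assumes "u \<in> set_pmf (Pi_pmf {..<n} 0 (\<lambda>_. rademacher_entry n k))" "k \<le> n"
  shows "truncate_vec n k u \<in> signals n k"
proof -
  have u: "u i \<in> {-1, 0, 1}" "i \<notin> {..<n} \<Longrightarrow> u i = 0" for i
    using assms(1) set_rademacher_entry[of n k]
    by (auto simp: set_Pi_pmf PiE_dflt_def)
  have eq: "{i \<in> {..<n}. u i \<noteq> 0} = {i. u i \<noteq> 0}" using u(2) by auto
  show ?thesis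
  proof (cases "real (card {i\<in>{..<n}. u i \<noteq> 0}) \<in> {real k / 2 .. 2 * real k}")
    case True
    then have "u \<in> sign_vecs {..<n} (card {i\<in>{..<n}. u i \<noteq> 0})"
      unfolding sign_vecs_def eq using u by auto
    then show ?thesis using True by (auto simp: truncate_vec_def signals_def sizes_def)
  next
    case False
    have "{i. (indicator {..<k} i :: real) \<noteq> 0} = {..<k}" by (auto simp: indicator_def)
    then have "indicator {..<k} \<in> sign_vecs {..<n} k"
      using assms(2) by (auto simp: sign_vecs_def indicator_def)
    then show ?thesis using False sizes_self by (auto simp: truncate_vec_def signals_def)
  qed
qed

lemma set_signal_pmf:
  assumes "k \<le> n"
  shows "set_pmf (signal_pmf n k) \<subseteq> tensor_cube ` signals n k"
  unfolding signal_pmf_def using truncate_vec_signals[OF _ assms] by auto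

lemma finite_set_signal_pmf:
  assumes "k \<le> n"
  shows "finite (set_pmf (signal_pmf n k))"
  by (rule finite_subset[OF set_signal_pmf[OF assms]]) simp

text \<open>Worst case in both exponents: 2k nonzero entries and n zero entries. This is crude but
  costs only O(k log(n/k)), the order of the error term in the claim.\<close>

definition min_mass :: "nat \<Rightarrow> nat \<Rightarrow> real" where
  "min_mass n k = (real k / (2 * real n)) ^ (2 * k) * (1 - real k / real n) ^ n"

lemma min_mass_pos: "0 < k \<Longrightarrow> k < n \<Longrightarrow> 0 < min_mass n k"
  by (simp add: min_mass_def)

text \<open>Truncation fixes w, so the product mass of w survives. The default vector also collects
  the mass of all truncated draws, hence a lower bound only.\<close>

lemma pmf_signal_lower:
  assumes w: "w \<in> signals n k" and kn: "0 < k" "k < n"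
  shows "min_mass n k \<le> pmf (signal_pmf n k) (tensor_cube w)"
proof -
  let ?p = "Pi_pmf {..<n} 0 (\<lambda>_. rademacher_entry n k)"
  obtain s where s: "s \<in> sizes k" "w \<in> sign_vecs {..<n} s" using w by (auto simp: signals_def)
  have "{i\<in>{..<n}. w i \<noteq> 0} = {i. w i \<noteq> 0}" using sign_vecsD(2)[OF s(2)] by auto
  then have card: "card {i\<in>{..<n}. w i \<noteq> 0} = s" using sign_vecsD(3)[OF s(2)] by simp
  have tr: "truncate_vec n k w = w"
    unfolding truncate_vec_def card using s(1) by (simp add: sizes_def)
  have "pmf ?p w = (\<Prod>i<n. pmf (rademacher_entry n k) (w i))"
    using sign_vecsD(2)[OF s(2)] by (intro pmf_Pi') auto
  also have "\<dots> = (\<Prod>i<n. if w i \<noteq> 0 then real k / (2 * real n) else 1 - real k / real n)"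
  proof (rule prod.cong)
    fix i show "pmf (rademacher_entry n k) (w i) = (if w i \<noteq> 0 then real k / (2 * real n) else 1 - real k / real n)"
      using sign_vecsD(1)[OF s(2), of i] kn by (auto simp: pmf_rademacher_entry)
  qed simp
  also have "\<dots> = (real k / (2 * real n)) ^ card ({..<n} \<inter> {i. w i \<noteq> 0})
      * (1 - real k / real n) ^ card ({..<n} \<inter> - {i. w i \<noteq> 0})"
    by (simp add: prod.If_cases)
  also have "\<dots> \<ge> min_mass n k"
    unfolding min_mass_def
  proof (intro mult_mono power_decreasing)
    show "card ({..<n} \<inter> {i. w i \<noteq> 0}) \<le> 2 * k"
      using card s(1) by (simp add: Int_def sizes_def)
    show "card ({..<n} \<inter> - {i. w i \<noteq> 0}) \<le> n"
      using card_mono[of "{..<n}" "{..<n} \<inter> - {i. w i \<noteq> 0}"] by auto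
  qed (use kn in auto)
  finally have "min_mass n k \<le> pmf ?p w" .
  also have "\<dots> \<le> pmf (signal_pmf n k) (tensor_cube w)"
  proof -
    have "pmf ?p w = measure ?p {w}" by (simp add: pmf.rep_eq)
    also have "\<dots> \<le> measure ?p ((\<lambda>u. tensor_cube (truncate_vec n k u)) -` {tensor_cube w})"
      by (intro measure_pmf.finite_measure_mono) (auto simp: tr)
    finally show ?thesis by (simp add: signal_pmf_def pmf_map)
  qed
  finally show ?thesis .
qed

text \<open>Origin of the constant C = 6: the power 2k contributes 2k log(n/k), and the remaining
  terms are at most 4k, absorbed by log(n/k) \<ge> 1.\<close>

lemma ln_min_mass:
  assumes "0 < k" "2 * k \<le> n" "1 \<le> ln (real n / real k)"
  shows "- ln (min_mass n k) \<le> 6 * real k * ln (real n / real k)"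
proof -
  have n: "0 < n" using assms by simp
  define x where "x = real k / real n"
  have x: "0 < x" "x \<le> 1 / 2" using assms n by (auto simp: x_def divide_le_eq)
  have "- x - 2 * x\<^sup>2 \<le> ln (1 - x)" using x by (intro ln_one_minus_pos_lower_bound) auto
  moreover have "2 * x\<^sup>2 \<le> x" using x by (simp add: power2_eq_square)
  ultimately have "- ln (1 - x) \<le> 2 * x" by linarith
  then have "real n * - ln (1 - x) \<le> real n * (2 * x)" by (intro mult_left_mono) auto
  also have "\<dots> = 2 * real k" using n by (simp add: x_def)
  finally have 1: "- (real n * ln (1 - x)) \<le> 2 * real k" by simp
  have lx: "ln (real n / real k) = - ln x" using assms n by (simp add: x_def ln_div)
  have "min_mass n k = (x / 2) ^ (2 * k) * (1 - x) ^ n"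
    by (simp add: min_mass_def x_def mult.commute)
  then have "ln (min_mass n k) = real (2 * k) * ln (x / 2) + real n * ln (1 - x)"
    using x by (simp add: ln_mult ln_realpow)
  moreover have "ln (x / 2) = ln x - ln 2" using x by (simp add: ln_div)
  moreover have "ln 2 \<le> (1::real)" using ln_le_minus_one[of "2::real"] by simp
  moreover have "2 * real k * (- ln x + ln 2) \<le> 2 * real k * (- ln x + 1)"
    using \<open>ln 2 \<le> 1\<close> by (intro mult_left_mono) auto
  ultimately have "- ln (min_mass n k) \<le> 2 * real k * (- ln x + 1) + 2 * real k"
    using 1 by (simp add: algebra_simps)
  also have "\<dots> \<le> 6 * real k * (- ln x)"
  proof -
    have "real k * 1 \<le> real k * (- ln x)" using assms(3) lx by (intro mult_left_mono) auto
    then show ?thesis by (simp add: algebra_simps)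
  qed
  finally show ?thesis using lx by simp
qed

section \<open>Partition function and potential at a fixed signal\<close>

lemma overlap_partition_sum:
  assumes "k \<le> n"
  shows "overlap_partition n k snr q X Y = (\<Sum>X'\<in>set_pmf (signal_pmf n k). pmf (signal_pmf n k) X' *
    (if tensor_inner n X X' = q then exp (- (\<Sum>t\<in>tensor_index n. (Y t - sqrt snr * X' t)\<^sup>2) / 2) else 0))"
  unfolding overlap_partition_def
  by (subst integral_measure_pmf[OF finite_set_signal_pmf[OF assms]]) auto

definition slice_potential :: "nat \<Rightarrow> nat \<Rightarrow> real \<Rightarrow> real \<Rightarrow> tensor \<Rightarrow> ennreal" where
  "slice_potential n k snr q X =
    (\<integral>\<^sup>+Z. neg_log (overlap_partition n k snr q X (\<lambda>t. sqrt snr * X t + Z t)) \<partial>noise_measure n)"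

lemma measurable_neg_log [measurable]: "neg_log \<in> borel_measurable borel"
  unfolding neg_log_def[abs_def] by measurable

text \<open>The signal ranges over an uncountable type, so joint measurability is not automatic: the integrand
  depends on \<open>X\<close> through the finitely many coordinates \<open>X t\<close> only.\<close>

lemma franz_parisi_average:
  assumes kn: "k \<le> n"
  shows "franz_parisi n k snr q = enn2ereal (\<integral>\<^sup>+X. slice_potential n k snr q X \<partial>measure_pmf (signal_pmf n k))"
proof -
  interpret noise: prob_space "noise_measure n" by (rule prob_space_noise)
  have X: "(\<lambda>p. fst p t) \<in> borel_measurable (measure_pmf (signal_pmf n k) \<Otimes>\<^sub>M noise_measure n)" for t
  proof -
    have "(\<lambda>X. X t) \<in> borel_measurable (measure_pmf (signal_pmf n k))" by simp
    then show ?thesis by (rule measurable_compose[OF measurable_fst])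
  qed
  have Z: "(\<lambda>p. snd p t) \<in> borel_measurable (measure_pmf (signal_pmf n k) \<Otimes>\<^sub>M noise_measure n)"
    if "t \<in> tensor_index n" for t
  proof -
    have "(\<lambda>Z. Z t) \<in> borel_measurable (noise_measure n)"
      unfolding noise_measure_def by (rule measurable_gauss_component[OF that])
    then show ?thesis by (rule measurable_compose[OF measurable_snd])
  qed
  have meas: "(\<lambda>(X, Z). neg_log (overlap_partition n k snr q X (\<lambda>t. sqrt snr * X t + Z t)))
    \<in> borel_measurable (measure_pmf (signal_pmf n k) \<Otimes>\<^sub>M noise_measure n)"
    unfolding overlap_partition_sum[OF kn] case_prod_beta tensor_inner_def
    by (intro measurable_compose[OF _ measurable_neg_log] borel_measurable_sum borel_measurable_times
        borel_measurable_const measurable_If measurable_compose[OF _ borel_measurable_exp]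
        borel_measurable_divide
        borel_measurable_uminus borel_measurable_power borel_measurable_diff borel_measurable_add X Z
        borel_measurable_eq)
  show ?thesis
    unfolding franz_parisi_def slice_potential_def
    by (subst noise.nn_integral_fst[symmetric]) (use meas in auto)
qed

text \<open>Half the squared norm of the observation: the part of the exponent that all candidates
  share. Its mean cancels in the difference of two potentials.\<close>

definition quadratic_energy :: "nat \<Rightarrow> real \<Rightarrow> tensor \<Rightarrow> tensor \<Rightarrow> real" where
  "quadratic_energy n lam X Z = (\<Sum>t\<in>tensor_index n. (lam * X t + Z t)\<^sup>2) / 2"

lemma integrable_quadratic_energy:
  "integrable (noise_measure n) (quadratic_energy n lam X)"
  unfolding quadratic_energy_def[abs_def] noise_measure_def
  using gauss_shifted_square_integrable[of "tensor_index n" "\<lambda>t. lam * X t"] by simp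

lemma energy_expand:
  assumes "w \<in> sign_vecs {..<n} s"
  shows "- (\<Sum>t\<in>tensor_index n. (lam * X t + Z t - lam * tensor_cube w t)\<^sup>2) / 2
    = - quadratic_energy n lam X Z + lam\<^sup>2 * tensor_inner n X (tensor_cube w)
      + lam * cube_form n w Z - lam\<^sup>2 * real s ^ 3 / 2"
proof -
  have "(\<Sum>t\<in>tensor_index n. (lam * X t + Z t - lam * tensor_cube w t)\<^sup>2)
    = (\<Sum>t\<in>tensor_index n. (lam * X t + Z t)\<^sup>2 + lam\<^sup>2 * (tensor_cube w t)\<^sup>2
        - 2 * lam\<^sup>2 * (X t * tensor_cube w t) - 2 * lam * (tensor_cube w t * Z t))"
    by (intro sum.cong refl) (simp add: power2_eq_square algebra_simps)
  also have "\<dots> = 2 * quadratic_energy n lam X Z + lam\<^sup>2 * real s ^ 3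
      - 2 * lam\<^sup>2 * tensor_inner n X (tensor_cube w) - 2 * lam * cube_form n w Z"
    by (simp add: sum.distrib sum_subtractf sum_distrib_left[symmetric] sum_tensor_cube_square[OF assms]
        quadratic_energy_def tensor_inner_def cube_form_def)
  finally show ?thesis by simp
qed

lemma neg_log_le: "exp x \<le> w \<Longrightarrow> neg_log w \<le> ennreal (- x)"
proof -
  assume *: "exp x \<le> w"
  then have "0 < w" using exp_gt_zero[of x] by linarith
  moreover have "x \<le> ln w" using * \<open>0 < w\<close> by (simp add: ln_ge_iff)
  ultimately show ?thesis by (auto simp: neg_log_def intro!: ennreal_leI)
qed

lemma neg_log_ge: "w \<le> exp x \<Longrightarrow> ennreal (- x) \<le> neg_log w"
proof -
  assume *: "w \<le> exp x"
  show ?thesis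
  proof (cases "w \<le> 0")
    case False
    then have "ln w \<le> ln (exp x)" using * by (intro ln_mono) auto
    then show ?thesis using False by (auto simp: neg_log_def intro!: ennreal_leI)
  qed (simp add: neg_log_def)
qed

text \<open>One maximiser among the vectors of \<open>W\<close> already bounds the partition
  function from below, at the price of the logarithm of its prior mass. That \<open>A\<close> is
  nonnegative is needed because \<open>ennreal\<close> sends negative numbers to 0.\<close>

lemma slice_potential_upper:
  assumes kn: "0 < k" "k < n" and lam: "0 < lam" and s: "s \<in> sizes k"
    and W: "finite W" "W \<noteq> {}" "W \<subseteq> sign_vecs {..<n} s"
      "\<And>w. w \<in> W \<Longrightarrow> tensor_inner n X (tensor_cube w) = q"
    and int: "integrable (noise_measure n) (\<lambda>Z. Max ((\<lambda>w. cube_form n w Z) ` W))"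
  defines "A \<equiv> (\<integral>Z. quadratic_energy n lam X Z \<partial>noise_measure n) - lam\<^sup>2 * q - ln (min_mass n k)
      - lam * (\<integral>Z. Max ((\<lambda>w. cube_form n w Z) ` W) \<partial>noise_measure n) + lam\<^sup>2 * real s ^ 3 / 2"
  shows "slice_potential n k (lam\<^sup>2) q X \<le> ennreal A" "0 \<le> A"
proof -
  interpret prob_space "noise_measure n" by (rule prob_space_noise)
  define F where "F Z = Max ((\<lambda>w. cube_form n w Z) ` W)" for Z
  define g where "g Z = quadratic_energy n lam X Z - lam\<^sup>2 * q - ln (min_mass n k) - lam * F Z
    + lam\<^sup>2 * real s ^ 3 / 2" for Z
  note ints = integrable_quadratic_energy[of n lam X] int[folded F_def]
  have gi: "integrable (noise_measure n) g"
    unfolding g_def[abs_def] using ints by simp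
  have Eg: "expectation g = A"
    unfolding g_def[abs_def] A_def F_def[symmetric, abs_def] using ints by (simp add: prob_space)
  have sq: "sqrt (lam\<^sup>2) = lam" using lam by simp
  have ge: "exp (- g Z) \<le> overlap_partition n k (lam\<^sup>2) q X (\<lambda>t. sqrt (lam\<^sup>2) * X t + Z t)" for Z
  proof -
    have "F Z \<in> (\<lambda>w. cube_form n w Z) ` W"
      unfolding F_def using W by (intro Max_in) auto
    then obtain w where w: "w \<in> W" "F Z = cube_form n w Z" by auto
    have ws: "w \<in> sign_vecs {..<n} s" using w W by auto
    have wsig: "w \<in> signals n k" using ws s by (auto simp: signals_def)
    let ?e = "\<lambda>X'. - (\<Sum>t\<in>tensor_index n. (sqrt (lam\<^sup>2) * X t + Z t - sqrt (lam\<^sup>2) * X' t)\<^sup>2) / 2"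
    have e: "?e (tensor_cube w) = - g Z - ln (min_mass n k)"
      unfolding sq energy_expand[OF ws] using W(4)[OF w(1)] by (simp add: g_def w(2))
    have "exp (- g Z) = min_mass n k * exp (- g Z - ln (min_mass n k))"
      using min_mass_pos[OF kn] by (simp add: exp_diff)
    also have "\<dots> \<le> pmf (signal_pmf n k) (tensor_cube w) * exp (?e (tensor_cube w))"
      unfolding e using pmf_signal_lower[OF wsig kn] by (intro mult_right_mono) auto
    also have "\<dots> = pmf (signal_pmf n k) (tensor_cube w) *
        (if tensor_inner n X (tensor_cube w) = q then exp (?e (tensor_cube w)) else 0)"
      using W(4)[OF w(1)] by simp
    also have "\<dots> \<le> overlap_partition n k (lam\<^sup>2) q X (\<lambda>t. sqrt (lam\<^sup>2) * X t + Z t)"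
      unfolding overlap_partition_sum[OF less_imp_le[OF kn(2)]]
    proof (rule member_le_sum)
      have "0 < pmf (signal_pmf n k) (tensor_cube w)"
        using pmf_signal_lower[OF wsig kn] min_mass_pos[OF kn] by linarith
      then show "tensor_cube w \<in> set_pmf (signal_pmf n k)" by (simp add: set_pmf_iff)
    qed (use finite_set_signal_pmf kn in auto)
    finally show ?thesis .
  qed
  have g0: "0 \<le> g Z" for Z
  proof -
    have "exp (- g Z) \<le> 1" using ge[of Z] overlap_partition_bounds(2) order_trans by blast
    then show ?thesis by simp
  qed
  have "slice_potential n k (lam\<^sup>2) q X \<le> (\<integral>\<^sup>+Z. ennreal (g Z) \<partial>noise_measure n)"
    unfolding slice_potential_def using neg_log_le[OF ge] by (intro nn_integral_mono) simp
  also have "\<dots> = ennreal A"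
    using nn_integral_eq_integral[OF gi] g0 Eg by simp
  finally show "slice_potential n k (lam\<^sup>2) q X \<le> ennreal A" .
  show "0 \<le> A" unfolding Eg[symmetric] using g0 by (intro Bochner_Integration.integral_nonneg)
qed

text \<open>The prior weights sum to at most one over a slice, so the partition function is at most
  its largest exponential. \<open>R\<close> is an envelope, valid pointwise in the noise and for all
  sizes at once, so that only its mean has to be estimated.\<close>

lemma slice_potential_lower:
  assumes kn: "k \<le> n" and lam: "0 < lam"
    and bound: "\<And>s w Z. s \<in> sizes k \<Longrightarrow> w \<in> sign_vecs {..<n} s \<Longrightarrow> tensor_inner n X (tensor_cube w) = q \<Longrightarrow>
      lam * cube_form n w Z - lam\<^sup>2 * real s ^ 3 / 2 \<le> c + lam * R Z"
    and int: "integrable (noise_measure n) R"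
  shows "ennreal ((\<integral>Z. quadratic_energy n lam X Z \<partial>noise_measure n) - lam\<^sup>2 * q - c
      - lam * (\<integral>Z. R Z \<partial>noise_measure n)) \<le> slice_potential n k (lam\<^sup>2) q X"
proof -
  interpret prob_space "noise_measure n" by (rule prob_space_noise)
  define g where "g Z = quadratic_energy n lam X Z - lam\<^sup>2 * q - c - lam * R Z" for Z
  note ints = integrable_quadratic_energy[of n lam X] int
  have gi: "integrable (noise_measure n) g"
    unfolding g_def[abs_def] using ints by simp
  have Eg: "expectation g = expectation (quadratic_energy n lam X) - lam\<^sup>2 * q - c - lam * expectation R"
    unfolding g_def[abs_def] using ints by (simp add: prob_space)
  have sq: "sqrt (lam\<^sup>2) = lam" using lam by simp
  have le: "overlap_partition n k (lam\<^sup>2) q X (\<lambda>t. sqrt (lam\<^sup>2) * X t + Z t) \<le> exp (- g Z)" for Z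
  proof -
    let ?f = "\<lambda>X'. if tensor_inner n X X' = q then
      exp (- (\<Sum>t\<in>tensor_index n. (sqrt (lam\<^sup>2) * X t + Z t - sqrt (lam\<^sup>2) * X' t)\<^sup>2) / 2) else 0"
    have each: "?f X' \<le> exp (- g Z)" if "X' \<in> set_pmf (signal_pmf n k)" for X'
    proof (cases "tensor_inner n X X' = q")
      case True
      obtain w where w: "w \<in> signals n k" "X' = tensor_cube w" using set_signal_pmf[OF kn] \<open>X' \<in> _\<close> by auto
      then obtain s where s: "s \<in> sizes k" "w \<in> sign_vecs {..<n} s" by (auto simp: signals_def)
      have "- (\<Sum>t\<in>tensor_index n. (sqrt (lam\<^sup>2) * X t + Z t - sqrt (lam\<^sup>2) * X' t)\<^sup>2) / 2 \<le> - g Z"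
        unfolding sq w(2) energy_expand[OF s(2)]
        using bound[OF s, of Z] True w(2) by (simp add: g_def)
      then show ?thesis using True by simp
    qed simp
    have "overlap_partition n k (lam\<^sup>2) q X (\<lambda>t. sqrt (lam\<^sup>2) * X t + Z t)
      \<le> (\<Sum>X'\<in>set_pmf (signal_pmf n k). pmf (signal_pmf n k) X' * exp (- g Z))"
      unfolding overlap_partition_sum[OF kn] by (intro sum_mono mult_left_mono each) auto
    also have "\<dots> = exp (- g Z)"
      using finite_set_signal_pmf[OF kn] by (simp add: sum_distrib_right[symmetric] sum_pmf_eq_1)
    finally show ?thesis .
  qed
  have "ennreal (expectation g) \<le> (\<integral>\<^sup>+Z. ennreal (g Z) \<partial>noise_measure n)"
  proof -
    have "expectation g \<le> expectation (\<lambda>Z. max 0 (g Z))"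
      using gi by (intro integral_mono) auto
    then have "ennreal (expectation g) \<le> ennreal (expectation (\<lambda>Z. max 0 (g Z)))" by (rule ennreal_leI)
    also have "\<dots> = (\<integral>\<^sup>+Z. ennreal (max 0 (g Z)) \<partial>noise_measure n)"
      using gi by (intro nn_integral_eq_integral[symmetric]) auto
    also have "\<dots> = (\<integral>\<^sup>+Z. ennreal (g Z) \<partial>noise_measure n)"
      by (intro nn_integral_cong) (auto simp: max_def ennreal_neg)
    finally show ?thesis .
  qed
  also have "\<dots> \<le> slice_potential n k (lam\<^sup>2) q X"
    unfolding slice_potential_def using neg_log_ge[OF le] by (intro nn_integral_mono) simp
  finally show ?thesis unfolding Eg .
qed

text \<open>Chosen so that \<open>sparse_regime (n - r) s\<close> holds for every admissible size s,
  also after a support of size r has been deleted. As s lies between k/2 and 2k, the constants 6 and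
  2 there become 12 and 4, and s is bounded by 2k. The power 200 leaves room for replacing n by n -
  r and for comparing log n with multiples of log k.\<close>

definition very_sparse :: "nat \<Rightarrow> nat \<Rightarrow> bool" where
  "very_sparse n k \<longleftrightarrow> 12 \<le> k \<and> (2 * k) ^ 200 \<le> n \<and> 4 * ln (2 * real n) \<le> real k"

lemma very_sparseD:
  assumes "very_sparse n k"
  shows "12 \<le> k" "2 * (2 * k) ^ 160 \<le> n" "16 * k \<le> n" "200 * ln (2 * real k) \<le> ln (real n)"
    "2 \<le> ln (2 * real k)" "4 * ln (2 * real n) \<le> real k"
proof -
  show k: "12 \<le> k" and "4 * ln (2 * real n) \<le> real k" using assms by (auto simp: very_sparse_def)
  have n: "(2 * k) ^ 200 \<le> n" using assms by (simp add: very_sparse_def)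
  have "2 * (2 * k) ^ 160 \<le> (2 * k) * (2 * k) ^ 160" using k by (intro mult_right_mono) auto
  also have "\<dots> = (2 * k) ^ Suc 160" by (rule power_Suc[symmetric])
  also have "\<dots> \<le> (2 * k) ^ 200" using k by (intro power_increasing) auto
  finally show "2 * (2 * k) ^ 160 \<le> n" using n by linarith
  have "16 * k \<le> (2 * k) ^ 2" using k by (simp add: power2_eq_square)
  also have "\<dots> \<le> (2 * k) ^ 200" using k by (intro power_increasing) auto
  finally show "16 * k \<le> n" using n by linarith
  have "(2 * real k) ^ 200 \<le> real n" using n by (metis of_nat_le_iff of_nat_mult of_nat_numeral of_nat_power)
  then have "ln ((2 * real k) ^ 200) \<le> ln (real n)" using k by (intro ln_mono) auto
  then show "200 * ln (2 * real k) \<le> ln (real n)" using k by (subst (asm) ln_realpow) auto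
  have "exp (2::real) = exp 1 * exp 1" by (simp add: exp_add[symmetric])
  also have "\<dots> \<le> 3 * 3" by (intro mult_mono exp_le) auto
  finally have "exp 2 \<le> 2 * real k" using k by simp
  then show "2 \<le> ln (2 * real k)" using k by (simp add: ln_ge_iff)
qed

lemma very_sparse_regime:
  assumes vs: "very_sparse n k" and s: "s \<in> sizes k" and r: "r \<le> 2 * k"
  shows "sparse_regime (n - r) s"
proof -
  note d = very_sparseD[OF vs]
  have s': "6 \<le> s" "s \<le> 2 * k" "real k / 2 \<le> real s" using s d(1) by (auto simp: sizes_def)
  have "(2 * k) ^ 1 \<le> (2 * k) ^ 160" using d(1) by (intro power_increasing) auto
  moreover have "s ^ 160 \<le> (2 * k) ^ 160" using s' by (intro power_mono) auto
  ultimately have "s ^ 160 \<le> n - r" using d(2) r by simp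
  moreover have "2 * ln (2 * real (n - r)) \<le> real s"
  proof -
    have "ln (2 * real (n - r)) \<le> ln (2 * real n)" using d(3,1) r by (intro ln_mono) auto
    then show ?thesis using d(6) s'(3) by linarith
  qed
  ultimately show ?thesis using s' by (simp add: sparse_regime_def)
qed

text \<open>The derivative of the level sqrt(s^3) \<open>peak\<close> with respect to the log count:
  the shift of the maximum per unit of entropy. It also serves as the temperature at which the forms
  are exponentiated.\<close>

definition unit_gap :: "nat \<Rightarrow> nat \<Rightarrow> real" where
  "unit_gap M s = sqrt (real s ^ 3) / peak M s"

text \<open>The square of \<open>peak\<close> lies between s log(n) / 4 and 4 s log(n). The lower
  bound yields the constant c = 1/4 of the claim; the upper bound controls the mean of the
  envelope.\<close>

lemma unit_gap_bounds:
  assumes vs: "very_sparse n k" and s: "s \<in> sizes k" and r: "r \<le> 2 * k"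
  shows "real k / (4 * sqrt (ln (real n))) \<le> unit_gap (n - r) s"
    and "unit_gap (n - r) s \<le> 4 * real k / sqrt (ln (real n))"
proof -
  note d = very_sparseD[OF vs]
  note p = peak_bounds[OF very_sparse_regime[OF vs s r]]
  define T where "T = peak (n - r) s"
  have T: "0 < T" using p(4) by (simp add: T_def)
  have s': "0 < real s" "real k / 2 \<le> real s" "real s \<le> 2 * real k" using s d(1) by (auto simp: sizes_def)
  have n: "0 < n" "real n \<le> 2 * real (n - r)" "2 \<le> real n" using d(1,3) r by auto
  have l1: "1 \<le> ln (real n)" using d(4,5) by linarith
  have sq: "(unit_gap (n - r) s)\<^sup>2 = real s ^ 3 / T\<^sup>2"
    by (simp add: unit_gap_def power_divide T_def)
  have pos: "0 \<le> unit_gap (n - r) s" using T by (simp add: unit_gap_def T_def)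
  have l2: "ln (2 * real (n - r)) \<le> 2 * ln (real n)"
  proof -
    have "2 * real (n - r) \<le> real n * real n"
      using n by (intro mult_mono) auto
    then have "ln (2 * real (n - r)) \<le> ln (real n * real n)" using d(1,3) r by (intro ln_mono) auto
    then show ?thesis using n by (simp add: ln_mult)
  qed
  have l3: "ln (real n) / 4 \<le> ln (real (n - r))"
  proof -
    have "ln (real n) \<le> ln (2 * real (n - r))" using n by (intro ln_mono) auto
    also have "\<dots> = ln 2 + ln (real (n - r))" using n by (subst ln_mult) auto
    finally have "ln (real n) \<le> ln 2 + ln (real (n - r))" .
    moreover have "ln 2 \<le> (1::real)" using ln_le_minus_one[of "2::real"] by simp
    ultimately show ?thesis using d(4,5) by linarith
  qed
  have "(real k / (4 * sqrt (ln (real n))))\<^sup>2 = (real k / 2)\<^sup>2 / (4 * ln (real n))"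
    using l1 by (simp add: power_divide power_mult_distrib)
  also have "\<dots> \<le> (real s)\<^sup>2 / (4 * ln (real n))"
    using s' l1 by (intro divide_right_mono power_mono) auto
  also have "\<dots> = real s ^ 3 / (2 * real s * (2 * ln (real n)))"
    using s' l1 by (simp add: power2_eq_square power3_eq_cube)
  also have "\<dots> \<le> real s ^ 3 / T\<^sup>2"
  proof (rule divide_left_mono)
    show "T\<^sup>2 \<le> 2 * real s * (2 * ln (real n))"
      using p(3) mult_left_mono[OF l2, of "2 * real s"] by (simp add: T_def)
  qed (use s' l1 T in auto)
  also have "\<dots> = (unit_gap (n - r) s)\<^sup>2" by (simp add: sq)
  finally show "real k / (4 * sqrt (ln (real n))) \<le> unit_gap (n - r) s"
    using pos by (rule power2_le_imp_le)
  have "(unit_gap (n - r) s)\<^sup>2 \<le> real s ^ 3 / (real s * (ln (real n) / 4))"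
    unfolding sq
  proof (rule divide_left_mono)
    show "real s * (ln (real n) / 4) \<le> T\<^sup>2"
      using p(2) mult_left_mono[OF l3, of "real s"] by (simp add: T_def)
  qed (use s' l1 T in auto)
  also have "\<dots> = 4 * (real s)\<^sup>2 / ln (real n)"
    using s' l1 by (simp add: power2_eq_square power3_eq_cube)
  also have "\<dots> \<le> 4 * (2 * real k)\<^sup>2 / ln (real n)"
    using s' l1 by (intro divide_right_mono mult_left_mono power_mono) auto
  also have "\<dots> = (4 * real k / sqrt (ln (real n)))\<^sup>2"
    using l1 by (simp add: power_divide power_mult_distrib)
  finally show "unit_gap (n - r) s \<le> 4 * real k / sqrt (ln (real n))"
    using l1 by (intro power2_le_imp_le[of "unit_gap (n - r) s"]) auto
qed

text \<open>Each unit of overlap costs a factor 8 k^2 / n relative to the vectors that avoid the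
  support of v: at most 2k for its position in the support, at most 2k/n for the lost freedom of w,
  and 2 for passing from n to n - r coordinates.\<close>

lemma card_overlap_slice:
  assumes vs: "very_sparse n k" and v: "v \<in> sign_vecs {..<n} r" and r: "r \<le> 2 * k"
    and s: "s \<in> sizes k" and m: "1 \<le> m"
  shows "real (card {w \<in> sign_vecs {..<n} s. dot n v w = real m})
    \<le> exp (log_count (n - r) s - real m * ln (real n / (8 * (real k)\<^sup>2)))"
proof -
  note d = very_sparseD[OF vs]
  have s': "1 \<le> s" "s \<le> 2 * k" using s d(1) by (auto simp: sizes_def)
  have kn: "0 < real k" "0 < real n" "2 * k + 2 * k < n" using d(1,3) by auto
  let ?S = "{w \<in> sign_vecs {..<n} s. dot n v w = real m}"
  let ?T = "{w \<in> sign_vecs {..<n} s. m \<le> card (agree v w)}"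
  have fin: "finite (sign_vecs {..<n} s)" by (simp add: card_sign_vecs)
  have sub: "?S \<subseteq> ?T"
    using dot_le_agree[OF v] by force
  show ?thesis
  proof (cases "m \<le> s")
    case False
    have "card (agree v w) \<le> s" if "w \<in> sign_vecs {..<n} s" for w
    proof -
      have "agree v w = agree w v" by (auto simp: agree_def)
      then show ?thesis using card_agree_le[OF _ that, of v] by simp
    qed
    then have "?T = {}" using False by fastforce
    with sub have "?S = {}" by (simp only: subset_empty)
    then show ?thesis by (simp only: card.empty) simp
  next
    case True
    have M: "exp (log_count (n - r) s) = real (n - r choose s) * 2 ^ s"
    proof -
      have "0 < n - r choose s" using s' kn(3) r by (intro zero_less_binomial) auto
      then show ?thesis by (simp add: log_count_def)
    qed
    \<comment> \<open>At least half of all vectors avoid the support of v: s r is small against n,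
      and Bernoulli's inequality bounds the product of the s factors.\<close>
    have half: "real (card (sign_vecs {..<n} s)) \<le> 2 * exp (log_count (n - r) s)"
    proof -
      define x where "x = real r / (real n - real (2 * k))"
      have "8 * k * k \<le> n - 2 * k"
      proof -
        have "(2 * k) ^ 3 \<le> (2 * k) ^ 160" using d(1) by (intro power_increasing) auto
        moreover have "8 * k * k + 2 * k \<le> 2 * (2 * k) ^ 3" 
        proof -
          have "8 * k * k + 2 * k \<le> 8 * k * k + 8 * k * k" using d(1) by simp
          also have "\<dots> \<le> 2 * (2 * k) ^ 3" using d(1) by (simp add: power3_eq_cube)
          finally show ?thesis .
        qed
        ultimately show ?thesis using d(2) by linarith
      qed
      then have "real (8 * k * k) \<le> real (n - 2 * k)" by (simp only: of_nat_le_iff)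
      then have big: "8 * real k * real k \<le> real n - real (2 * k)" using kn(3) by (simp add: of_nat_diff)
      have x: "0 \<le> x" "real s * x \<le> 1 / 2"
      proof -
        show "0 \<le> x" using kn(3) by (simp add: x_def)
        have "real s * real r \<le> (2 * real k) * (2 * real k)"
          using s' r by (intro mult_mono) auto
        also have "\<dots> \<le> (real n - real (2 * k)) / 2" using big by simp
        finally show "real s * x \<le> 1 / 2" using kn(3) by (simp add: x_def divide_le_eq)
      qed
      have "1 \<le> real s" using s' by simp
      then have "1 * x \<le> real s * x" using x by (intro mult_right_mono) auto
      then have "1 + real s * (- x) \<le> (1 + - x) ^ s"
        using x by (intro Bernoulli_inequality) auto
      then have "1 / 2 \<le> (1 - x) ^ s" using x by simp
      then have "1 / 2 * real (n choose s) \<le> (1 - x) ^ s * real (n choose s)"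
        by (intro mult_right_mono) auto
      also have "\<dots> \<le> real (n - r choose s)"
        unfolding x_def using r kn(3) s' by (intro binomial_diff_lower) auto
      finally have "real (n choose s) * 2 ^ s \<le> 2 * real (n - r choose s) * 2 ^ s"
        by (intro mult_right_mono) auto
      then show ?thesis by (simp add: card_sign_vecs M)
    qed
    have "real (card ?S) \<le> real (card ?T)"
      using card_mono[OF _ sub] fin by simp
    also have "\<dots> \<le> real (r choose m) * real (card (sign_vecs {..<n} (s - m)))"
      using card_sign_vecs_agree_le[OF _ _ v, of "{..<n}" s m]
      by (simp only: of_nat_mult[symmetric] of_nat_le_iff finite_lessThan)
    also have "\<dots> \<le> (2 * real k) ^ m * (real s ^ m * real (card (sign_vecs {..<n} s)) / real n ^ m)"
    proof (intro mult_mono)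
      have "r choose m \<le> r ^ m"
      proof (cases "m \<le> r")
        case True then show ?thesis by (rule binomial_le_pow)
      qed (simp add: binomial_eq_0)
      also have "\<dots> \<le> (2 * k) ^ m" using r by (intro power_mono) auto
      finally show "real (r choose m) \<le> (2 * real k) ^ m"
        by (metis of_nat_le_iff of_nat_mult of_nat_numeral of_nat_power)
      have "real (card (sign_vecs {..<n} (s - m))) * real n ^ m
        \<le> real (card (sign_vecs {..<n} (s - m))) * (2 * (real n - real s)) ^ m"
        using kn(3) s' by (intro mult_left_mono power_mono) auto
      also have "\<dots> \<le> real s ^ m * real (card (sign_vecs {..<n} s))"
        using card_sign_vecs_ratio[of "{..<n}" m s] True kn(3) s' by simp
      finally show "real (card (sign_vecs {..<n} (s - m))) \<le> real s ^ m * real (card (sign_vecs {..<n} s)) / real n ^ m"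
        using kn by (simp add: le_divide_eq)
    qed auto
    also have "\<dots> \<le> (2 * real k) ^ m * ((2 * real k) ^ m * (2 * exp (log_count (n - r) s)) / real n ^ m)"
      using s' kn by (intro mult_left_mono divide_right_mono mult_mono power_mono half) auto
    also have "\<dots> = 2 * ((4 * (real k)\<^sup>2 / real n) ^ m * exp (log_count (n - r) s))"
      by (simp add: power_mult_distrib power_divide power2_eq_square power_mult[symmetric])
        (simp add: power_mult_distrib[symmetric])
    \<comment> \<open>Since m is at least 1, the factor 2 can be moved into the base, and 4 k^2
      becomes 8 k^2.\<close>
    also have "\<dots> \<le> 2 ^ m * ((4 * (real k)\<^sup>2 / real n) ^ m * exp (log_count (n - r) s))"
    proof (rule mult_right_mono)
      show "(2::real) \<le> 2 ^ m" using power_increasing[OF m, of "2::real"] by simp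
    qed (use kn in auto)
    also have "\<dots> = (8 * (real k)\<^sup>2 / real n) ^ m * exp (log_count (n - r) s)"
      by (simp add: power_mult_distrib[symmetric] mult.assoc[symmetric])
    also have "(8 * (real k)\<^sup>2 / real n) ^ m = exp (- (real m * ln (real n / (8 * (real k)\<^sup>2))))"
    proof -
      have "exp (- ln (real n / (8 * (real k)\<^sup>2))) = 8 * (real k)\<^sup>2 / real n"
        using kn by (simp add: exp_minus)
      then show ?thesis by (metis exp_of_nat_mult mult_minus_right)
    qed
    finally show ?thesis by (simp add: exp_diff exp_minus field_simps)
  qed
qed

text \<open>The third bound is the whole loss budget per unit of overlap: 17 = 1 + 16 for the gain
  and the mean of the envelope, 4 log(2k) for the factor s^4 in the level, 3 for the expected
  maximum, log(4k) for the union over sizes.\<close>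

lemma very_sparse_ln_ratio:
  assumes "very_sparse n k"
  shows "1 \<le> ln (real n / real k)" "1 \<le> ln (real n)"
    "17 + 4 * ln (2 * real k) + 3 + ln (4 * real k) \<le> ln (real n / (8 * (real k)\<^sup>2))"
proof -
  note d = very_sparseD[OF assms]
  define l where "l = ln (2 * real k)"
  have kn: "0 < real k" "0 < real n" "1 \<le> real k" using d(1,3) by auto
  have l: "2 \<le> l" "200 * l \<le> ln (real n)" using d(4,5) by (simp_all add: l_def)
  have "ln (real k) \<le> l" unfolding l_def using kn by (intro ln_mono) auto
  then show "1 \<le> ln (real n / real k)" using l kn by (simp add: ln_div)
  show "1 \<le> ln (real n)" using l by linarith
  have "ln (8 * (real k)\<^sup>2) \<le> ln ((2 * real k) ^ 3)"
    using kn by (intro ln_mono) (auto simp: power2_eq_square power3_eq_cube)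
  also have "\<dots> = 3 * l" unfolding l_def using kn by (subst ln_realpow) auto
  finally have 8: "ln (8 * (real k)\<^sup>2) \<le> 3 * l" .
  have "ln (4 * real k) \<le> ln ((2 * real k) ^ 2)"
    using kn by (intro ln_mono) (auto simp: power2_eq_square)
  also have "\<dots> = 2 * l" unfolding l_def using kn by (subst ln_realpow) auto
  finally have 4: "ln (4 * real k) \<le> 2 * l" .
  have "ln (real n / (8 * (real k)\<^sup>2)) = ln (real n) - ln (8 * (real k)\<^sup>2)"
    using kn by (subst ln_div) auto
  then show "17 + 4 * ln (2 * real k) + 3 + ln (4 * real k) \<le> ln (real n / (8 * (real k)\<^sup>2))"
    using 8 4 l unfolding l_def[symmetric] by linarith
qed

text \<open>A form of y - x \<ge> c without subtraction, for c of either sign and y possibly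
  infinite. One of the two summands \<open>ennreal c\<close> and \<open>ennreal (- c)\<close> is
  always 0.\<close>

lemma ennreal_gap:
  assumes "x \<le> ennreal a" "0 \<le> a" "ennreal b \<le> y" "c \<le> b - a"
  shows "x + ennreal c \<le> y + ennreal (- c)"
proof -
  have "x + ennreal c \<le> ennreal a + ennreal (max c 0)"
    using assms(1) by (intro add_mono ennreal_leI) auto
  also have "\<dots> = ennreal (a + max c 0)"
    using assms(2) by (simp add: ennreal_plus)
  also have "\<dots> \<le> ennreal (max b 0 + max (- c) 0)"
    using assms(4) by (intro ennreal_leI) auto
  also have "\<dots> = ennreal b + ennreal (- c)"
    by (simp add: ennreal_plus max_def ennreal_neg)
  also have "\<dots> \<le> y + ennreal (- c)" using assms(3) by (intro add_right_mono)
  finally show ?thesis .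
qed

section \<open>Comparison of the two slices at a fixed signal\<close>

definition gap_bound :: "nat \<Rightarrow> nat \<Rightarrow> real \<Rightarrow> real \<Rightarrow> real" where
  "gap_bound n k lam q = - (lam\<^sup>2) * q - 6 * real k * ln (real n / real k)
     + 1 / 4 * lam * real k * root 3 q / sqrt (ln (real n))"

text \<open>A first-moment upper bound at overlap m meets the second-moment lower bound in the
  orthogonal slice, both for the same size and with the same \<open>peak\<close> and log
  count.\<close>

lemma slice_potential_gap_attained:
  assumes vs: "very_sparse n k" and lam: "0 < lam" and r: "r \<in> sizes k" and v: "v \<in> sign_vecs {..<n} r"
    and m: "1 \<le> m"
  shows "slice_potential n k (lam\<^sup>2) 0 (tensor_cube v) + ennreal (gap_bound n k lam (real m ^ 3))
    \<le> slice_potential n k (lam\<^sup>2) (real m ^ 3) (tensor_cube v) + ennreal (- gap_bound n k lam (real m ^ 3))"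
proof -
  note d = very_sparseD[OF vs]
  note lr = very_sparse_ln_ratio[OF vs]
  have kn: "0 < k" "k < n" "2 * k \<le> n" using d(1,3) by auto
  have r': "r \<le> 2 * k" using r by (simp add: sizes_def)
  define U where "U = {..<n} - {i. v i \<noteq> 0}"
  have cU: "card U = n - r"
    unfolding U_def using sign_vecsD(2,3)[OF v] finite_subset[of "{i. v i \<noteq> 0}" "{..<n}"]
    by (subst card_Diff_subset) auto
  have U: "U \<subseteq> {..<n}" by (auto simp: U_def)
  define L where "L = sqrt (ln (real n))"
  have L: "0 < L" using lr by (simp add: L_def)
  define \<kappa> where "\<kappa> = ln (real n / (8 * (real k)\<^sup>2))"
  define h where "h = ln (4 * real k)"
  define g where "g = unit_gap (n - r)"
  define T where "T = peak (n - r)"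
  define \<Lambda> where "\<Lambda> = log_count (n - r)"
  \<comment> \<open>First-moment level: \<open>(T s)\<^sup>2 / 2\<close> is the logarithm of the
    exponential moment at temperature \<open>g s\<close>,
    \<open>\<Lambda> s - real m * \<kappa>\<close> bounds the log number of vectors, and
    \<open>h\<close> pays for at most 4k sizes.\<close>
  define a where "a s = g s * ((T s)\<^sup>2 / 2 + \<Lambda> s - real m * \<kappa> + h)" for s
  define W where "W s = {w \<in> sign_vecs {..<n} s. dot n v w = real m}" for s
  \<comment> \<open>By x \<le> exp x, this soft maximum dominates every
    \<open>cube_form n w Z - a s\<close> in the slice. The temperature \<open>g s\<close> makes the
    exponential moment of a form exactly \<open>exp ((T s)\<^sup>2 / 2)\<close>.\<close>
  define R where "R Z = (\<Sum>s\<in>sizes k. \<Sum>w\<in>W s. g s * exp (1 / g s * cube_form n w Z - a s / g s))" for Z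
  have reg: "sparse_regime (card U) s" if "s \<in> sizes k" for s
    unfolding cU by (rule very_sparse_regime[OF vs that r'])
  have s1: "1 \<le> real s" "real s \<le> 2 * real k" if "s \<in> sizes k" for s
    using that d(1) by (auto simp: sizes_def)
  note pk = peak_bounds[OF reg, unfolded cU, folded T_def \<Lambda>_def]
  have gb: "real k / (4 * L) \<le> g s" "g s \<le> 4 * real k / L" if "s \<in> sizes k" for s
    using unit_gap_bounds[OF vs that r'] by (simp_all add: g_def L_def)
  have g0: "0 < g s" if "s \<in> sizes k" for s
  proof -
    have "0 < real k / (4 * L)" using kn L by simp
    then show ?thesis using gb(1)[OF that] by linarith
  qed
  have fW: "finite (W s)" for s unfolding W_def by (simp add: card_sign_vecs)
  have gT: "(1 / g s)\<^sup>2 * real s ^ 3 = (T s)\<^sup>2" if "s \<in> sizes k" for s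
    using s1[OF that] by (simp add: g_def unit_gap_def T_def power_divide)

  have shift: "exp (1 / g s * x - a s / g s) = exp (1 / g s * x) * exp (- a s / g s)" for s x
    by (simp add: exp_add[symmetric])
  have ie: "integrable (noise_measure n) (\<lambda>Z. g s * exp (1 / g s * cube_form n w Z - a s / g s))"
    if "w \<in> W s" for s w
    unfolding shift using that cube_form_mgf(1)[of w n s "1 / g s"] by (simp add: W_def)
  have Rint: "integrable (noise_measure n) R"
    unfolding R_def[abs_def] using ie by (intro Bochner_Integration.integrable_sum)
  have ER: "(\<integral>Z. R Z \<partial>noise_measure n) \<le> 4 * real k / L"
  proof -
    have "(\<integral>Z. R Z \<partial>noise_measure n)
      = (\<Sum>s\<in>sizes k. \<Sum>w\<in>W s. \<integral>Z. g s * exp (1 / g s * cube_form n w Z - a s / g s) \<partial>noise_measure n)"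
      unfolding R_def using ie
      by (subst Bochner_Integration.integral_sum)
        (auto intro!: Bochner_Integration.integrable_sum sum.cong Bochner_Integration.integral_sum)
    also have "\<dots> \<le> (\<Sum>s\<in>sizes k. 1 / L)"
    proof (rule sum_mono)
      fix s assume s: "s \<in> sizes k"
      have ag: "a s / g s = (T s)\<^sup>2 / 2 + \<Lambda> s - real m * \<kappa> + h"
        using g0[OF s] by (simp add: a_def)
      have "(\<integral>Z. g s * exp (1 / g s * cube_form n w Z - a s / g s) \<partial>noise_measure n)
        = g s * exp (- (\<Lambda> s - real m * \<kappa>) - h)" if w: "w \<in> W s" for w
      proof -
        have ws: "w \<in> sign_vecs {..<n} s" using w by (simp add: W_def)
        have "(\<integral>Z. g s * exp (1 / g s * cube_form n w Z - a s / g s) \<partial>noise_measure n)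
          = g s * (exp ((1 / g s)\<^sup>2 * real s ^ 3 / 2) * exp (- a s / g s))"
          unfolding shift using cube_form_mgf(2)[OF ws, of "1 / g s"] by simp
        also have "\<dots> = g s * exp (- (\<Lambda> s - real m * \<kappa>) - h)"
          unfolding gT[OF s] exp_add[symmetric] minus_divide_left[symmetric] ag by simp
        finally show ?thesis .
      qed
      then have "(\<Sum>w\<in>W s. \<integral>Z. g s * exp (1 / g s * cube_form n w Z - a s / g s) \<partial>noise_measure n)
        = (\<Sum>w\<in>W s. g s * exp (- (\<Lambda> s - real m * \<kappa>) - h))"
        by (intro sum.cong refl)
      also have "\<dots> = real (card (W s)) * (g s * exp (- (\<Lambda> s - real m * \<kappa>) - h))"
        by simp
      also have "\<dots> \<le> exp (\<Lambda> s - real m * \<kappa>) * (g s * exp (- (\<Lambda> s - real m * \<kappa>) - h))"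
        using card_overlap_slice[OF vs v r' s m] g0[OF s]
        by (intro mult_right_mono) (auto simp: W_def \<Lambda>_def \<kappa>_def)
      also have "\<dots> = g s * exp (- h)"
        by (simp add: mult.left_commute exp_add[symmetric])
      also have "\<dots> = g s / (4 * real k)" using kn by (simp add: h_def exp_minus field_simps)
      also have "\<dots> \<le> (4 * real k / L) / (4 * real k)"
        using gb(2)[OF s] by (intro divide_right_mono) auto
      also have "\<dots> = 1 / L" using kn by simp
      finally show "(\<Sum>w\<in>W s. \<integral>Z. g s * exp (1 / g s * cube_form n w Z - a s / g s) \<partial>noise_measure n) \<le> 1 / L" .
    qed
    also have "\<dots> = real (card (sizes k)) / L" by simp
    also have "\<dots> \<le> (4 * real k) / L"
      using card_sizes[of k] kn L by (intro divide_right_mono) auto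
    finally show ?thesis .
  qed

  \<comment> \<open>The penalty depends on the size, so the best size \<open>s0\<close> for overlap
    m is selected here. The same size is used below in the orthogonal slice, and the penalties
    cancel.\<close>
  define f where "f s = lam * a s - lam\<^sup>2 * real s ^ 3 / 2" for s
  define c where "c = Max (f ` sizes k)"
  have "c \<in> f ` sizes k" unfolding c_def using sizes_self[of k] by (intro Max_in) auto
  then obtain s0 where s0: "s0 \<in> sizes k" "c = f s0" by auto
  have fc: "f s \<le> c" if "s \<in> sizes k" for s unfolding c_def using that by (intro Max_ge) auto

  have lower: "ennreal ((\<integral>Z. quadratic_energy n lam (tensor_cube v) Z \<partial>noise_measure n)
      - lam\<^sup>2 * real m ^ 3 - c - lam * (\<integral>Z. R Z \<partial>noise_measure n))
    \<le> slice_potential n k (lam\<^sup>2) (real m ^ 3) (tensor_cube v)"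
  proof (rule slice_potential_lower[OF less_imp_le[OF kn(2)] lam _ Rint])
    fix s w Z assume s: "s \<in> sizes k" and w: "w \<in> sign_vecs {..<n} s"
      and ov: "tensor_inner n (tensor_cube v) (tensor_cube w) = real m ^ 3"
    have "dot n v w = real m"
      using ov unfolding tensor_inner_cube by (metis odd_numeral numeral_3_eq_3 odd_real_root_power_cancel odd_Suc_minus_one)
    then have wW: "w \<in> W s" using w by (simp add: W_def)
    have "cube_form n w Z - a s = g s * (1 / g s * cube_form n w Z - a s / g s)"
      using g0[OF s] by (simp add: field_simps)
    also have "\<dots> \<le> g s * exp (1 / g s * cube_form n w Z - a s / g s)"
    proof (rule mult_left_mono)
      show "1 / g s * cube_form n w Z - a s / g s \<le> exp (1 / g s * cube_form n w Z - a s / g s)"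
        using exp_ge_add_one_self[of "1 / g s * cube_form n w Z - a s / g s"] by linarith
    qed (use g0[OF s] in simp)
    also have "\<dots> \<le> (\<Sum>w\<in>W s. g s * exp (1 / g s * cube_form n w Z - a s / g s))"
      by (rule member_le_sum[OF wW]) (use fW g0[OF s] in auto)
    also have "\<dots> \<le> R Z"
      unfolding R_def
      by (rule member_le_sum[OF s, of "\<lambda>s. \<Sum>w\<in>W s. g s * exp (1 / g s * cube_form n w Z - a s / g s)"])
        (use g0 in \<open>auto intro!: sum_nonneg mult_nonneg_nonneg dest: less_imp_le\<close>)
    finally have "lam * (cube_form n w Z - a s) \<le> lam * R Z" using lam by simp
    then show "lam * cube_form n w Z - lam\<^sup>2 * real s ^ 3 / 2 \<le> c + lam * R Z"
      using fc[OF s] by (simp add: f_def right_diff_distrib)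
  qed

  note reg0 = reg[OF s0(1)]
  \<comment> \<open>Vectors off the support of v are only part of the orthogonal slice, but their
    log count is the \<open>\<Lambda> s0\<close> that enters \<open>a s0\<close>.\<close>
  define W0 where "W0 = sign_vecs U s0"
  have W0: "finite W0" "W0 \<noteq> {}"
  proof -
    have fU: "finite U" using U by (rule finite_subset) simp
    show "finite W0" unfolding W0_def by (rule card_sign_vecs[OF fU])
    have "s0 \<le> card U" using sparse_regimeD(2)[OF reg0] by simp
    then have "0 < real (card W0)"
      unfolding W0_def using exp_log_count[OF fU] exp_gt_zero by metis
    then show "W0 \<noteq> {}" by auto
  qed
  note mx = expected_max_cube_form_lower[OF U reg0, folded W0_def, unfolded cU]
  define EM where "EM = (\<integral>Z. Max ((\<lambda>w. cube_form n w Z) ` W0) \<partial>noise_measure n)"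
  define A where "A = (\<integral>Z. quadratic_energy n lam (tensor_cube v) Z \<partial>noise_measure n) - lam\<^sup>2 * 0
    - ln (min_mass n k) - lam * EM + lam\<^sup>2 * real s0 ^ 3 / 2"
  have orth: "tensor_inner n (tensor_cube v) (tensor_cube w) = 0" if "w \<in> W0" for w
  proof -
    have "v i * w i = 0" for i using that sign_vecsD(2)[of w U s0 i] by (auto simp: W0_def U_def)
    then have "dot n v w = 0" unfolding dot_def by (intro sum.neutral) blast
    then show ?thesis unfolding tensor_inner_cube by simp
  qed
  have upper: "slice_potential n k (lam\<^sup>2) 0 (tensor_cube v) \<le> ennreal A" "0 \<le> A"
    unfolding A_def EM_def
    using slice_potential_upper[OF kn(1,2) lam s0(1) W0 _ orth mx(1)] sign_vecs_mono[OF U, of s0]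
    by (auto simp: W0_def)

  \<comment> \<open>In units \<open>g s0\<close>, and up to the 3 units lost in the expected
    maximum, \<open>EM\<close> is at least T^2. As T^2/2 + \<Lambda> = T^2 + 4 log s, the level
    \<open>a s0\<close> is T^2 - (m \<kappa> - 4 log s - h). Of the difference, m + 16 units are
    kept: m for the claim and 16 for the mean of \<open>R\<close>, since 16 k / (4 L) = 4 k /
    L.\<close>
  have EMa: "real k / (4 * L) * (real m + 16) \<le> EM - a s0"
  proof -
    have gs: "real k / (4 * L) \<le> g s0" by (rule gb(1)[OF s0(1)])
    have "ln (real s0) \<le> ln (2 * real k)" using s1[OF s0(1)] by (intro ln_mono) auto
    moreover have "1 * (4 * ln (2 * real k) + 3 + h) \<le> real m * (4 * ln (2 * real k) + 3 + h)"
      using m d(5) kn by (intro mult_right_mono) (auto simp: h_def)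
    moreover have "real m * (17 + (4 * ln (2 * real k) + 3 + h)) \<le> real m * \<kappa>"
      using lr(3) by (intro mult_left_mono) (auto simp: h_def \<kappa>_def)
    ultimately have "real m + 16 \<le> real m * \<kappa> - 4 * ln (real s0) - 3 - h"
      using m by (simp add: distrib_left)
    then have "real k / (4 * L) * (real m + 16) \<le> g s0 * (real m * \<kappa> - 4 * ln (real s0) - 3 - h)"
      using gs g0[OF s0(1)] by (intro mult_mono) auto
    also have "\<dots> = g s0 * ((T s0)\<^sup>2 - 3) - a s0"
      unfolding a_def pk(1)[OF s0(1)] by (simp add: field_simps)
    also have "\<dots> \<le> EM - a s0"
      using mx(2) by (simp add: EM_def g_def unit_gap_def T_def)
    finally show ?thesis .
  qed
  have rt: "root 3 (real m ^ 3) = real m" by (simp add: real_root_power_cancel)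
  have "gap_bound n k lam (real m ^ 3) \<le>
     ((\<integral>Z. quadratic_energy n lam (tensor_cube v) Z \<partial>noise_measure n)
      - lam\<^sup>2 * real m ^ 3 - c - lam * (\<integral>Z. R Z \<partial>noise_measure n)) - A"
  proof -
    have "real k / (4 * L) * (real m + 16) = 1 / 4 * real k * real m / L + 4 * real k / L"
      using L by (simp add: field_simps)
    then have "1 / 4 * real k * real m / L \<le> EM - a s0 - (\<integral>Z. R Z \<partial>noise_measure n)"
      using EMa ER by linarith
    then have "lam * (1 / 4 * real k * real m / L) \<le> lam * (EM - a s0 - (\<integral>Z. R Z \<partial>noise_measure n))"
      using lam by (intro mult_left_mono) auto
    moreover have "lam * (1 / 4 * real k * real m / L) = 1 / 4 * lam * real k * real m / L" by simp
    moreover have "- ln (min_mass n k) \<le> 6 * real k * ln (real n / real k)"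
      by (rule ln_min_mass[OF kn(1,3) lr(1)])
    ultimately show ?thesis
      unfolding gap_bound_def rt L_def[symmetric] A_def s0(2) f_def by (simp add: right_diff_distrib)
  qed
  then show ?thesis using ennreal_gap[OF upper lower] by simp
qed

text \<open>Inner products of sign vectors are integers, so q is either the cube of a positive
  integer or not attained. In the second case the partition function vanishes and the potential is
  infinite.\<close>

lemma slice_potential_gap:
  assumes vs: "very_sparse n k" and lam: "0 < lam" and v: "v \<in> signals n k" and q: "1 \<le> q"
  shows "slice_potential n k (lam\<^sup>2) 0 (tensor_cube v) + ennreal (gap_bound n k lam q)
    \<le> slice_potential n k (lam\<^sup>2) q (tensor_cube v) + ennreal (- gap_bound n k lam q)"
proof -
  have kn: "k \<le> n" using very_sparseD[OF vs] by simp
  obtain r where r: "r \<in> sizes k" "v \<in> sign_vecs {..<n} r" using v by (auto simp: signals_def)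
  show ?thesis
  proof (cases "\<exists>w\<in>signals n k. dot n v w ^ 3 = q")
    case True
    then obtain w where w: "w \<in> signals n k" "dot n v w ^ 3 = q" by auto
    then obtain s where "w \<in> sign_vecs {..<n} s" by (auto simp: signals_def)
    then have "dot n v w \<in> \<int>" using dot_Ints[OF r(2)] by simp
    then obtain z where z: "dot n v w = of_int z" by (auto elim: Ints_cases)
    have "0 < (of_int z :: real)"
    proof (rule ccontr)
      assume "\<not> 0 < (of_int z :: real)"
      then have "q \<le> 0 ^ 3" unfolding w(2)[symmetric] z by (intro power_mono_odd) auto
      then show False using q by simp
    qed
    then have q_eq: "q = real (nat z) ^ 3" and "1 \<le> nat z" using w(2) z by auto
    then show ?thesis unfolding q_eq by (intro slice_potential_gap_attained[OF vs lam r])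
  next
    case False
    have "overlap_partition n k (lam\<^sup>2) q (tensor_cube v) Y = 0" for Y
      unfolding overlap_partition_sum[OF kn]
    proof (rule sum.neutral, rule ballI)
      fix X' assume "X' \<in> set_pmf (signal_pmf n k)"
      then obtain w where "w \<in> signals n k" "X' = tensor_cube w" using set_signal_pmf[OF kn] by auto
      then show "pmf (signal_pmf n k) X' * (if tensor_inner n (tensor_cube v) X' = q
          then exp (- (\<Sum>t\<in>tensor_index n. (Y t - sqrt (lam\<^sup>2) * X' t)\<^sup>2) / 2) else 0) = 0"
        using False by (auto simp: tensor_inner_cube)
    qed
    then have "slice_potential n k (lam\<^sup>2) q (tensor_cube v) = (\<integral>\<^sup>+Z. \<infinity> \<partial>noise_measure n)"
      by (simp add: slice_potential_def neg_log_def)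
    also have "\<dots> = \<infinity>"
      using prob_space.emeasure_space_1[OF prob_space_noise[of n]] by simp
    finally show ?thesis by simp
  qed
qed

text \<open>The witness copies v on m places of its support and is 1 on k - m places outside, so the
  inner product is exactly m. As a support has at least k/2 elements, 2m \<le> k leaves enough of
  them. The case m = 0 makes differences with the potential at 0 meaningful; positive m supplies
  attained points against monotonicity.\<close>

lemma franz_parisi_finite:
  assumes vs: "very_sparse n k" and snr: "0 < snr" and m: "2 * m \<le> k"
  shows "\<bar>franz_parisi n k snr (real m ^ 3)\<bar> \<noteq> \<infinity>"
proof -
  note d = very_sparseD[OF vs]
  have kn: "0 < k" "k < n" "k \<le> n" using d(1,3) by auto
  define lam where "lam = sqrt snr"
  have lam: "0 < lam" "snr = lam\<^sup>2" using snr by (simp_all add: lam_def)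
  have fin: "slice_potential n k snr (real m ^ 3) X < \<infinity>" if X: "X \<in> set_pmf (signal_pmf n k)" for X
  proof -
    obtain v where v: "v \<in> signals n k" "X = tensor_cube v" using set_signal_pmf[OF kn(3)] X by auto
    then obtain r where r: "r \<in> sizes k" "v \<in> sign_vecs {..<n} r" by (auto simp: signals_def)
    let ?V = "{i. v i \<noteq> 0}"
    have V: "?V \<subseteq> {..<n}" "card ?V = r" "finite ?V"
      using sign_vecsD(2,3)[OF r(2)] finite_subset[of ?V "{..<n}"] by auto
    have "m \<le> card ?V" using r(1) m V(2) by (auto simp: sizes_def)
    then obtain D where D: "D \<subseteq> ?V" "card D = m" using obtain_subset_with_card_n by metis
    have "card ({..<n} - ?V) = n - r" using V by (subst card_Diff_subset) auto
    moreover have "r \<le> 2 * k" using r(1) by (simp add: sizes_def)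
    ultimately have "k - m \<le> card ({..<n} - ?V)" using d(3) by linarith
    then obtain A where A: "A \<subseteq> {..<n} - ?V" "card A = k - m" using obtain_subset_with_card_n by metis
    define w where "w i = (if i \<in> D then v i else if i \<in> A then 1 else 0)" for i
    have fDA: "finite D" "finite A" "D \<inter> A = {}" using D A V finite_subset[of A "{..<n}"] by (auto dest: finite_subset)
    have supp: "{i. w i \<noteq> 0} = D \<union> A" using D by (auto simp: w_def)
    have "card (D \<union> A) = k" using fDA D A m by (subst card_Un_disjoint) auto
    then have w: "w \<in> sign_vecs {..<n} k"
      unfolding sign_vecs_def mem_Collect_eq supp using D A V sign_vecsD(1)[OF r(2)] by (auto simp: w_def)
    have "dot n v w = (\<Sum>i<n. if i \<in> D then 1 else 0)"
      unfolding dot_def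
    proof (rule sum.cong)
      fix i show "v i * w i = (if i \<in> D then 1 else 0)"
        using D A sign_vecsD(1)[OF r(2), of i] by (auto simp: w_def)
    qed simp
    also have "\<dots> = real (card ({..<n} \<inter> D))" by (simp add: sum.If_cases)
    also have "{..<n} \<inter> D = D" using D V by auto
    finally have "dot n v w = real m" using D by simp
    then have "tensor_inner n X (tensor_cube w) = real m ^ 3" by (simp add: v tensor_inner_cube)
    then show ?thesis
      unfolding lam(2)
      using slice_potential_upper(1)[OF kn(1,2) lam(1) sizes_self,
          where W = "{w}" and X = X and q = "real m ^ 3"]
        cube_form_moments(1)[OF w kn(1)] w by (auto intro: le_less_trans)
  qed
  have "(\<integral>\<^sup>+X. slice_potential n k snr (real m ^ 3) X \<partial>measure_pmf (signal_pmf n k))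
    = (\<Sum>X\<in>set_pmf (signal_pmf n k). slice_potential n k snr (real m ^ 3) X * ennreal (pmf (signal_pmf n k) X))"
    by (rule nn_integral_measure_pmf_finite) (simp_all add: finite_set_signal_pmf[OF kn(3)])
  also have "\<dots> < \<infinity>"
    using fin finite_set_signal_pmf[OF kn(3)]
    by (simp add: less_top[symmetric] ennreal_mult_eq_top_iff)
  finally have "(\<integral>\<^sup>+X. slice_potential n k snr (real m ^ 3) X \<partial>measure_pmf (signal_pmf n k)) < \<infinity>" .
  then show ?thesis
    unfolding franz_parisi_average[OF kn(3)]
    by (cases "\<integral>\<^sup>+X. slice_potential n k snr (real m ^ 3) X \<partial>measure_pmf (signal_pmf n k)") auto
qed

section \<open>Averaging over the signal\<close>

lemma franz_parisi_gap:
  assumes vs: "very_sparse n k" and lam: "0 < lam" and q: "1 \<le> q"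
  shows "\<bar>franz_parisi n k (lam\<^sup>2) 0\<bar> \<noteq> \<infinity>"
    and "ereal (gap_bound n k lam q) \<le> franz_parisi n k (lam\<^sup>2) q - franz_parisi n k (lam\<^sup>2) 0"
proof -
  have kn: "k \<le> n" using very_sparseD[OF vs] by simp
  show fin: "\<bar>franz_parisi n k (lam\<^sup>2) 0\<bar> \<noteq> \<infinity>"
    using franz_parisi_finite[OF vs, of "lam\<^sup>2" 0] lam by simp
  define F where "F q = (\<integral>\<^sup>+X. slice_potential n k (lam\<^sup>2) q X \<partial>measure_pmf (signal_pmf n k))" for q
  have fp: "franz_parisi n k (lam\<^sup>2) q = enn2ereal (F q)" for q
    unfolding F_def by (rule franz_parisi_average[OF kn])
  let ?B = "gap_bound n k lam q"
  have const: "(\<integral>\<^sup>+X. slice_potential n k (lam\<^sup>2) x X + ennreal b \<partial>measure_pmf (signal_pmf n k))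
    = F x + ennreal b" for x b
    unfolding F_def by (subst nn_integral_add) (auto simp: measure_pmf.emeasure_space_1)
  have "F 0 + ennreal ?B \<le> F q + ennreal (- ?B)"
    unfolding const[symmetric]
  proof (intro nn_integral_mono_AE AE_pmfI)
    fix X assume "X \<in> set_pmf (signal_pmf n k)"
    then obtain v where "v \<in> signals n k" "X = tensor_cube v" using set_signal_pmf[OF kn] by auto
    then show "slice_potential n k (lam\<^sup>2) 0 X + ennreal ?B \<le> slice_potential n k (lam\<^sup>2) q X + ennreal (- ?B)"
      using slice_potential_gap[OF vs lam _ q] by simp
  qed
  then show "ereal ?B \<le> franz_parisi n k (lam\<^sup>2) q - franz_parisi n k (lam\<^sup>2) 0"
    using fin unfolding fp
  proof (cases "F 0"; cases "F q")
    fix x y assume xy: "F 0 = ennreal x" "0 \<le> x" "F q = ennreal y" "0 \<le> y"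
    assume "F 0 + ennreal ?B \<le> F q + ennreal (- ?B)"
    moreover have "ennreal (max b 0) = ennreal b" for b by (simp add: max_def ennreal_neg)
    ultimately have "ennreal x + ennreal (max ?B 0) \<le> ennreal y + ennreal (max (- ?B) 0)"
      by (simp only: xy)
    then have "ennreal (x + max ?B 0) \<le> ennreal (y + max (- ?B) 0)"
      using xy by (simp add: ennreal_plus)
    then have "x + max ?B 0 \<le> y + max (- ?B) 0" using xy by (subst (asm) ennreal_le_iff) auto
    then show "ereal ?B \<le> enn2ereal (F q) - enn2ereal (F 0)" using xy by simp
  qed auto
qed

subsection \<open>Asymptotics\<close>

lemma power_scale_eventually:
  assumes "power_scale a b e" "0 < t"
  shows "\<forall>\<^sub>F n in sequentially. \<exists>e'. \<bar>e' - e\<bar> < t \<and> a n = b n powr e'"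
proof -
  obtain \<eta> where \<eta>: "\<eta> \<longlonglongrightarrow> 0" "\<forall>\<^sub>F n in sequentially. a n = b n powr (e + \<eta> n)"
    using assms(1) by (auto simp: power_scale_def)
  have "\<forall>\<^sub>F n in sequentially. \<bar>\<eta> n\<bar> < t"
    using \<eta>(1) assms(2) by (auto simp: tendsto_iff dist_real_def)
  with \<eta>(2) show ?thesis
  proof eventually_elim
    case (elim n)
    then show ?case by (intro exI[of _ "e + \<eta> n"]) auto
  qed
qed

text \<open>The exponent of k is eventually between \<beta>/2 and 3\<beta>/2. With \<beta> < 1/1000
  this gives k \<le> n^(1/500), hence 2k \<le> n^(1/200), which is the power 200 in
  \<open>very_sparse\<close>. The lower bound on k beats log n.\<close>

lemma sparsity_eventually:
  fixes k :: "nat \<Rightarrow> nat"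
  assumes \<beta>: "0 < \<beta>" "\<beta> < 1 / 1000" and k: "power_scale (\<lambda>n. real (k n)) real \<beta>"
  shows "\<forall>\<^sub>F n in sequentially. real n powr (\<beta> / 2) \<le> real (k n)"
    and "\<forall>\<^sub>F n in sequentially. very_sparse n (k n)"
proof -
  have ev: "\<forall>\<^sub>F n in sequentially. real n powr (\<beta> / 2) \<le> real (k n) \<and> real (k n) \<le> real n powr (1 / 500)"
    using power_scale_eventually[OF k half_gt_zero[OF \<beta>(1)]] eventually_ge_at_top[of 1]
  proof eventually_elim
    case (elim n)
    then obtain e where e: "\<bar>e - \<beta>\<bar> < \<beta> / 2" "real (k n) = real n powr e" by auto
    have "\<beta> / 2 \<le> e" "e \<le> 1 / 500" using e(1) \<beta> by linarith+
    then show ?case using elim unfolding e(2) by (auto intro!: powr_mono)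
  qed
  then show "\<forall>\<^sub>F n in sequentially. real n powr (\<beta> / 2) \<le> real (k n)"
    by (rule eventually_mono) simp
  have 1: "\<forall>\<^sub>F n in sequentially. 12 \<le> real n powr (\<beta> / 2)" using \<beta> by real_asymp
  have 2: "\<forall>\<^sub>F n in sequentially. 4 * ln (2 * real n) \<le> real n powr (\<beta> / 2)" using \<beta> by real_asymp
  have 3: "\<forall>\<^sub>F n in sequentially. 2 * real n powr (1 / 500) \<le> real n powr (1 / 200)" by real_asymp
  show "\<forall>\<^sub>F n in sequentially. very_sparse n (k n)"
    using ev 1 2 3 eventually_ge_at_top[of 1]
  proof eventually_elim
    case (elim n)
    have "(2 * real (k n)) ^ 200 \<le> (real n powr (1 / 200)) ^ 200"
      using elim by (intro power_mono) auto
    also have "\<dots> = real n" using elim by (simp add: powr_realpow[symmetric] powr_powr)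
    finally have "real ((2 * k n) ^ 200) \<le> real n"
      by (simp only: of_nat_power of_nat_mult of_nat_numeral)
    then have "(2 * k n) ^ 200 \<le> n" by (simp only: of_nat_le_iff)
    moreover have "12 \<le> real (k n)" using elim by linarith
    ultimately show ?case unfolding very_sparse_def using elim by simp
  qed
qed

text \<open>The positive term is at least k a / (4 sqrt(log n)), which is split as 1/16 + 1/16 +
  1/8. The first share covers a^2 q because a P^3 \<le> k, the second covers 6 k log(n/k) because a
  is large against log(n)^2, and the third exceeds k P. The constant 96 is 6 times 16.\<close>

lemma gap_bound_large:
  assumes k: "1 \<le> real k" and x: "1 \<le> ln (real n)" and d: "0 < d"
    and P: "96 * ln (real n) powr (d + 2) \<le> P" "P ^ 3 \<le> a" "a * P ^ 3 \<le> real k"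
    and q: "1 \<le> q" "q \<le> ln (real n) powr d"
  shows "real k * P \<le> gap_bound n k a q"
proof -
  define x where "x = ln (real n)"
  have x1: "1 \<le> x" using x by (simp add: x_def)
  define w where "w = sqrt x"
  have w: "1 \<le> w" "w \<le> x" "w * w = x"
  proof -
    show "1 \<le> w" using x1 by (simp add: w_def)
    show ww: "w * w = x" using x1 by (simp add: w_def)
    have "w * 1 \<le> w * w" using \<open>1 \<le> w\<close> by (intro mult_left_mono) auto
    then show "w \<le> x" using ww by simp
  qed
  have pw: "x powr (d + 2) = x powr d * x\<^sup>2" using x1 by (simp add: powr_add)
  have xd: "1 \<le> x powr d" using x1 d by (simp add: ge_one_powr_ge_zero)
  have "1 * x\<^sup>2 \<le> x powr d * x\<^sup>2" using xd by (intro mult_right_mono) auto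
  then have P1: "96 * x\<^sup>2 \<le> P" using P(1) pw by (simp add: x_def)
  have xx: "x \<le> x\<^sup>2" using x1 by (simp add: power2_eq_square)
  have P2: "96 * (x powr d * x) \<le> P"
  proof -
    have "x powr d * x \<le> x powr d * x\<^sup>2" using xx by (intro mult_left_mono) auto
    then show ?thesis using P(1) pw by (simp add: x_def)
  qed
  have P0: "1 \<le> P" using P1 xx x1 by linarith
  have PP: "P \<le> P ^ 3" using power_increasing[of 1 3 P] P0 by simp
  have a: "0 < a" "P \<le> a" using P(2) P0 PP by linarith+
  have rq: "1 \<le> root 3 q" using q(1) real_root_ge_1_iff[of 3 q] by simp
  have kpos: "0 < real k" using k by simp
  have lnk: "ln (real n / real k) \<le> x"
  proof -
    have "0 < n" using x by (cases n) auto
    then show ?thesis using k by (simp add: ln_div x_def)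
  qed
  have "a * a * q \<le> real k * a / (16 * w)"
  proof -
    have "a * (16 * w * q) \<le> a * P ^ 3"
    proof (rule mult_left_mono)
      have "w * q \<le> x * x powr d" using w q x1 by (intro mult_mono) (auto simp: x_def)
      then have "16 * w * q \<le> 16 * (x powr d * x)" by (simp add: mult.commute)
      also have "\<dots> \<le> 96 * (x powr d * x)" using x1 by (intro mult_right_mono) auto
      also have "\<dots> \<le> P ^ 3" using P2 PP by linarith
      finally show "16 * w * q \<le> P ^ 3" .
    qed (use a in simp)
    then have "a * (16 * w * q) \<le> real k" using P(3) by linarith
    then have "a * (a * (16 * w * q)) \<le> a * real k" using a by (intro mult_left_mono) auto
    then show ?thesis using w(1) by (simp add: le_divide_eq mult_ac)
  qed
  moreover have "6 * real k * ln (real n / real k) \<le> real k * a / (16 * w)"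
  proof -
    have "6 * x * (16 * w) \<le> 6 * x * (16 * x)" using w x1 by (intro mult_left_mono) auto
    also have "\<dots> = 96 * x\<^sup>2" by (simp add: power2_eq_square)
    also have "\<dots> \<le> a" using P1 a by linarith
    finally have "6 * x \<le> a / (16 * w)" using w(1) by (simp add: le_divide_eq)
    then have "real k * (6 * x) \<le> real k * (a / (16 * w))" using kpos by (intro mult_left_mono) auto
    moreover have "6 * real k * ln (real n / real k) \<le> 6 * real k * x"
      using lnk kpos by (intro mult_left_mono) auto
    ultimately show ?thesis by simp
  qed
  moreover have "real k * P \<le> real k * a / (8 * w)"
  proof -
    have "8 * w \<le> P" using w xx P1 x1 by linarith
    then have "P * (8 * w) \<le> P * P" using P0 by (intro mult_left_mono) auto
    also have "\<dots> \<le> P ^ 3" using P0 by (simp add: power3_eq_cube)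
    also have "\<dots> \<le> a" by (rule P(2))
    finally have "P \<le> a / (8 * w)" using w(1) by (simp add: le_divide_eq)
    then have "real k * P \<le> real k * (a / (8 * w))" using kpos by (intro mult_left_mono) auto
    then show ?thesis by simp
  qed
  moreover have "real k * a / (4 * w) \<le> 1 / 4 * a * real k * root 3 q / w"
  proof -
    have "real k * a / (4 * w) * 1 \<le> real k * a / (4 * w) * root 3 q"
      using rq a kpos w by (intro mult_left_mono) auto
    then show ?thesis by (simp add: mult_ac)
  qed
  moreover have "real k * a / (4 * w) = real k * a / (16 * w) + real k * a / (16 * w) + real k * a / (8 * w)"
    using w(1) by (simp add: field_simps)
  moreover have "C \<le> - A - B + D" if "A \<le> u" "B \<le> u" "C \<le> v" "t \<le> D" "t = u + u + v"
    for A B C D t u v :: real using that by linarith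
  ultimately have "real k * P \<le> - (a * a * q) - 6 * real k * ln (real n / real k)
      + 1 / 4 * a * real k * root 3 q / w" by blast
  then show ?thesis
    unfolding gap_bound_def x_def[symmetric] w_def[symmetric] power2_eq_square[of a] by simp
qed

text \<open>The exponent of the amplitude is within \<tau> of e, and e lies at distance at least
  4\<tau> from both 0 and 1; this leaves 3\<tau> on either side.\<close>

lemma amplitude_bounds:
  assumes k: "1 \<le> real k" and e: "0 < e" "e < 1" and a: "a = real k powr e'" "\<bar>e' - e\<bar> < min e (1 - e) / 4"
  defines "\<tau> \<equiv> min e (1 - e) / 4"
  shows "(real k powr \<tau>) ^ 3 \<le> a" "a * (real k powr \<tau>) ^ 3 \<le> real k" "0 < a"
proof -
  have k0: "0 < real k" using k by simp
  have p3: "(real k powr \<tau>) ^ 3 = real k powr (3 * \<tau>)"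
    using k0 by (simp add: powr_realpow[symmetric] powr_powr mult.commute)
  have \<tau>: "4 * \<tau> \<le> e" "4 * \<tau> \<le> 1 - e" by (auto simp: \<tau>_def)
  have "3 * \<tau> \<le> e'" using a(2) \<tau> unfolding \<tau>_def[symmetric] by linarith
  then show "(real k powr \<tau>) ^ 3 \<le> a" unfolding p3 a(1) using k by (intro powr_mono)
  have "e' + 3 * \<tau> \<le> 1" using a(2) \<tau> unfolding \<tau>_def[symmetric] by linarith
  then have "real k powr (e' + 3 * \<tau>) \<le> real k powr 1" using k by (intro powr_mono)
  then show "a * (real k powr \<tau>) ^ 3 \<le> real k" unfolding p3 a(1) using k0 by (simp add: powr_add)
  show "0 < a" unfolding a(1) using k0 by simp
qed

text \<open>The amplitude exceeds n^\<delta>, so its square contains two such factors: one remains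
  and the other dominates the polylogarithmic threshold.\<close>

lemma snr_above_threshold:
  fixes k :: "nat \<Rightarrow> nat" and a :: "nat \<Rightarrow> real"
  assumes \<beta>: "0 < \<beta>" "\<beta> < 1 / 1000" and k: "power_scale (\<lambda>n. real (k n)) real \<beta>"
    and e: "0 < e" "e < 1"
    and a: "\<forall>\<^sub>F n in sequentially. \<exists>e'. \<bar>e' - e\<bar> < min e (1 - e) / 4 \<and> a n = real (k n) powr e'"
    and L: "soft_Theta_one L"
  shows "\<exists>\<delta>>0. \<forall>\<^sub>F n in sequentially. real n powr \<delta> * L n \<le> (a n)\<^sup>2"
proof -
  define \<tau> where "\<tau> = min e (1 - e) / 4"
  have \<tau>: "0 < \<tau>" using e by (simp add: \<tau>_def)
  define \<delta> where "\<delta> = \<beta> / 2 * \<tau>"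
  have \<delta>: "0 < \<delta>" using \<beta> \<tau> by (simp add: \<delta>_def)
  obtain D where D: "\<forall>\<^sub>F n in sequentially. ln (real n) powr (- D) \<le> L n \<and> L n \<le> ln (real n) powr D"
    using L by (auto simp: soft_Theta_one_def)
  have "\<forall>\<^sub>F n in sequentially. ln (real n) powr D \<le> real n powr \<delta>" using \<delta> by real_asymp
  with D a sparsity_eventually[OF \<beta> k]
  have "\<forall>\<^sub>F n in sequentially. real n powr \<delta> * L n \<le> (a n)\<^sup>2"
  proof eventually_elim
    case (elim n)
    note d = very_sparseD[OF elim(4)]
    have kn: "1 \<le> real (k n)" "0 < real n" using d(1,3) by auto
    obtain e' where e': "\<bar>e' - e\<bar> < min e (1 - e) / 4" "a n = real (k n) powr e'" using elim(2) by auto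
    note ab = amplitude_bounds[OF kn(1) e e'(2,1), folded \<tau>_def]
    have P1: "1 \<le> real (k n) powr \<tau>" using kn \<tau> by (intro ge_one_powr_ge_zero) auto
    have "real n powr \<delta> = (real n powr (\<beta> / 2)) powr \<tau>" by (simp add: powr_powr \<delta>_def)
    also have "\<dots> \<le> real (k n) powr \<tau>" using elim(3) \<tau> by (intro powr_mono2) auto
    also have "\<dots> \<le> (real (k n) powr \<tau>) ^ 3" using power_increasing[of 1 3 "real (k n) powr \<tau>"] P1 by simp
    finally have na: "real n powr \<delta> \<le> a n" using ab(1) by linarith
    have "real n powr \<delta> * L n \<le> real n powr \<delta> * real n powr \<delta>"
      using elim(1,5) by (intro mult_left_mono) auto
    also have "\<dots> \<le> a n * a n" using na ab(3) by (intro mult_mono) auto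
    finally show ?case by (simp add: power2_eq_square)
  qed
  then show ?thesis using \<delta> by auto
qed

lemma potential_gap_growth:
  fixes k :: "nat \<Rightarrow> nat" and a :: "nat \<Rightarrow> real"
  assumes \<beta>: "0 < \<beta>" "\<beta> < 1 / 1000" and k: "power_scale (\<lambda>n. real (k n)) real \<beta>"
    and e: "0 < e" "e < 1" and d: "3 < d"
    and a: "\<forall>\<^sub>F n in sequentially. \<exists>e'. \<bar>e' - e\<bar> < min e (1 - e) / 4 \<and> a n = real (k n) powr e'"
  defines "\<tau> \<equiv> min e (1 - e) / 4"
  shows "\<forall>\<^sub>F n in sequentially. \<forall>q. 6 * ln (real n) ^ 3 \<le> q \<and> q \<le> ln (real n) powr d \<longrightarrow>
    ereal (real (k n) powr (1 + \<tau>)) \<le> franz_parisi n (k n) ((a n)\<^sup>2) q - franz_parisi n (k n) ((a n)\<^sup>2) 0"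
proof -
  have \<tau>: "0 < \<tau>" using e by (simp add: \<tau>_def)
  define \<delta> where "\<delta> = \<beta> / 2 * \<tau>"
  have \<delta>: "0 < \<delta>" using \<beta> \<tau> by (simp add: \<delta>_def)
  have "\<forall>\<^sub>F n in sequentially. 96 * ln (real n) powr (d + 2) \<le> real n powr \<delta>" using \<delta> by real_asymp
  with a sparsity_eventually[OF \<beta> k] show ?thesis
  proof eventually_elim
    case (elim n)
    note vs = elim(3)
    note d' = very_sparseD[OF vs]
    have kn: "1 \<le> real (k n)" "0 < real n" using d'(1,3) by auto
    have x: "1 \<le> ln (real n)" by (rule very_sparse_ln_ratio(2)[OF vs])
    obtain e' where e': "\<bar>e' - e\<bar> < min e (1 - e) / 4" "a n = real (k n) powr e'" using elim(1) by auto
    note ab = amplitude_bounds[OF kn(1) e e'(2,1), folded \<tau>_def]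
    have "real n powr \<delta> = (real n powr (\<beta> / 2)) powr \<tau>" by (simp add: powr_powr \<delta>_def)
    also have "\<dots> \<le> real (k n) powr \<tau>" using elim(2) \<tau> by (intro powr_mono2) auto
    finally have P: "96 * ln (real n) powr (d + 2) \<le> real (k n) powr \<tau>" using elim(4) by linarith
    show ?case
    proof (intro allI impI)
      fix q assume q: "6 * ln (real n) ^ 3 \<le> q \<and> q \<le> ln (real n) powr d"
      have "1 \<le> ln (real n) ^ 3" using x by (rule one_le_power)
      then have q1: "1 \<le> q" using q by linarith
      have "real (k n) powr (1 + \<tau>) = real (k n) * real (k n) powr \<tau>" using kn by (simp add: powr_add)
      also have "\<dots> \<le> gap_bound n (k n) (a n) q"
        using d q q1 x P ab by (intro gap_bound_large[OF kn(1)]) auto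
      finally have "ereal (real (k n) powr (1 + \<tau>)) \<le> ereal (gap_bound n (k n) (a n) q)" by simp
      also note franz_parisi_gap(2)[OF vs ab(3) q1]
      finally show "ereal (real (k n) powr (1 + \<tau>))
        \<le> franz_parisi n (k n) ((a n)\<^sup>2) q - franz_parisi n (k n) ((a n)\<^sup>2) 0" .
    qed
  qed
qed

text \<open>At unattained q the potential is infinite and would refute monotonicity trivially. Hence
  the restriction to finite values, and an attained q inside the window has to be produced.\<close>

lemma franz_parisi_not_antimono:
  assumes vs: "very_sparse n k" and snr: "0 < snr" and d: "27 * ln (real n) ^ 3 \<le> ln (real n) powr d"
    and gap: "\<And>q. 6 * ln (real n) ^ 3 \<le> q \<Longrightarrow> q \<le> ln (real n) powr d \<Longrightarrow>
      ereal g \<le> franz_parisi n k snr q - franz_parisi n k snr 0"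
    and g: "0 < g"
  shows "\<not> antimono_on {q \<in> {0 .. ln (real n) powr d}. franz_parisi n k snr q \<noteq> \<infinity>} (franz_parisi n k snr)"
proof
  assume anti: "antimono_on {q \<in> {0 .. ln (real n) powr d}. franz_parisi n k snr q \<noteq> \<infinity>} (franz_parisi n k snr)"
  define x where "x = ln (real n)"
  have x: "1 \<le> x" unfolding x_def by (rule very_sparse_ln_ratio(2)[OF vs])
  \<comment> \<open>The cube of m then lies between 8 and 27 times log(n)^3, above the threshold 6
    log(n)^3 and below log(n)^d.\<close>
  define m where "m = nat \<lceil>2 * x\<rceil>"
  have m: "2 * x \<le> real m" "real m \<le> 3 * x" "real m \<le> 2 * x + 1" using x unfolding m_def by linarith+
  have "0 < real n" using very_sparseD(1,3)[OF vs] by simp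
  then have "ln (2 * real n) = ln 2 + x" by (simp add: ln_mult x_def)
  moreover have "1 / 2 \<le> ln (2::real)"
  proof -
    have "exp 1 \<le> (2 * 2 :: real)" using exp_le by simp
    then have "1 \<le> ln (2 * 2 :: real)" by (subst ln_ge_iff) auto
    also have "\<dots> = ln 2 + ln 2" by (rule ln_mult_pos) auto
    finally show ?thesis by simp
  qed
  \<comment> \<open>\<open>2 * m\<close> is at most 4x + 2, and ln 2 \<ge> 1/2 puts this below 4
    ln(2n) \<le> k.\<close>
  ultimately have "real (2 * m) \<le> real k" using m(3) very_sparseD(6)[OF vs] by simp
  then have "2 * m \<le> k" by (simp only: of_nat_le_iff)
  then have fin: "\<bar>franz_parisi n k snr (real m ^ 3)\<bar> \<noteq> \<infinity>" by (rule franz_parisi_finite[OF vs snr])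
  have fin0: "\<bar>franz_parisi n k snr 0\<bar> \<noteq> \<infinity>" using franz_parisi_finite[OF vs snr, of 0] by simp
  have "(2 * x) ^ 3 \<le> real m ^ 3" using m(1) x by (intro power_mono) auto
  then have "8 * x ^ 3 \<le> real m ^ 3" by (simp add: power_mult_distrib)
  moreover have "0 \<le> x ^ 3" using x by simp
  ultimately have lo: "6 * ln (real n) ^ 3 \<le> real m ^ 3"
    unfolding x_def[symmetric] by linarith
  have "real m ^ 3 \<le> (3 * x) ^ 3" using m(2) by (intro power_mono) auto
  then have hi: "real m ^ 3 \<le> ln (real n) powr d" using d by (simp add: x_def power_mult_distrib)
  have "franz_parisi n k snr (real m ^ 3) \<le> franz_parisi n k snr 0"
    using monotone_onD[OF anti, of 0 "real m ^ 3"] fin fin0 hi by auto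
  moreover have "ereal g \<le> franz_parisi n k snr (real m ^ 3) - franz_parisi n k snr 0"
    by (rule gap[OF lo hi])
  ultimately show False using fin fin0 g
    by (cases "franz_parisi n k snr (real m ^ 3)"; cases "franz_parisi n k snr 0") auto
qed

text \<open>The terms lam^2 q and lam k q^(1/3) belong to amplitude \<open>lam\<close>, that is, to
  signal-to-noise ratio lam^2. The consequences for lam = k^(\<epsilon> + o(1)) are proved for both
  readings, with the ratio equal to lam (p = 1) and to lam^2 (p = 2).\<close>

theorem theoremA9:
  shows "\<exists>c>0. \<exists>C>0. \<exists>C'>(0::real). \<exists>\<beta>0>0. \<beta>0 \<le> 1 / 2 \<and>
    (\<forall>\<beta> (k :: nat \<Rightarrow> nat).
      0 < \<beta> \<and> \<beta> < \<beta>0 \<and> power_scale (\<lambda>n. real (k n)) real \<beta> \<longrightarrow>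
      (\<forall>\<^sub>F n in sequentially. \<forall>lam>0.
         \<bar>franz_parisi n (k n) (lam\<^sup>2) 0\<bar> \<noteq> \<infinity> \<and>
         (\<forall>q\<ge>1.
            franz_parisi n (k n) (lam\<^sup>2) q - franz_parisi n (k n) (lam\<^sup>2) 0
            \<ge> ereal (- (lam\<^sup>2) * q - C * real (k n) * ln (real n / real (k n))
                     + c * lam * real (k n) * root 3 q / sqrt (ln (real n))))) \<and>
      (\<forall>\<epsilon> (lam :: nat \<Rightarrow> real).
         0 < \<epsilon> \<and> \<epsilon> < 1 \<and> power_scale lam (\<lambda>n. real (k n)) \<epsilon> \<longrightarrow>
         (\<forall>p\<in>{1, 2 :: nat}.
            (\<forall>L. soft_Theta_one L \<longrightarrow>
               (\<exists>\<delta>>0. \<forall>\<^sub>F n in sequentially. real n powr \<delta> * L n \<le> lam n ^ p)) \<and>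
            (\<forall>d>3. \<exists>\<delta>>0. \<forall>\<^sub>F n in sequentially.
               \<forall>q. C * ln (real n) ^ 3 \<le> q \<and> q \<le> ln (real n) powr d \<longrightarrow>
                 franz_parisi n (k n) (lam n ^ p) q - franz_parisi n (k n) (lam n ^ p) 0
                   \<ge> ereal (real (k n) powr (1 + \<delta>)) \<and>
                 real (k n) powr (1 + \<delta>) > 0) \<and>
            (\<forall>d>3. \<forall>\<^sub>F n in sequentially.
               \<not> antimono_on
                   {q \<in> {0 .. ln (real n) powr d}. franz_parisi n (k n) (lam n ^ p) q \<noteq> \<infinity>}
                   (franz_parisi n (k n) (lam n ^ p))))))"
proof (rule exI[of _ "1 / 4"], rule conjI, simp, rule exI[of _ 6], rule conjI, simp, rule exI[of _ 1],
    rule conjI, simp, rule exI[of _ "1 / 1000"], intro conjI allI impI ballI; (elim conjE)?)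
  show "(0::real) < 1 / 1000" "(1 / 1000 :: real) \<le> 1 / 2" by simp_all
next
  fix \<beta> and k :: "nat \<Rightarrow> nat"
  assume \<beta>: "0 < \<beta>" "\<beta> < 1 / 1000" and k: "power_scale (\<lambda>n. real (k n)) real \<beta>"
  show "\<forall>\<^sub>F n in sequentially. \<forall>lam>0.
         \<bar>franz_parisi n (k n) (lam\<^sup>2) 0\<bar> \<noteq> \<infinity> \<and>
         (\<forall>q\<ge>1.
            franz_parisi n (k n) (lam\<^sup>2) q - franz_parisi n (k n) (lam\<^sup>2) 0
            \<ge> ereal (- (lam\<^sup>2) * q - 6 * real (k n) * ln (real n / real (k n))
                     + 1 / 4 * lam * real (k n) * root 3 q / sqrt (ln (real n))))"
    using sparsity_eventually(2)[OF \<beta> k]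
  proof eventually_elim
    case (elim n)
    show ?case
    proof (intro allI impI conjI)
      fix lam q :: real assume lam: "0 < lam"
      show "\<bar>franz_parisi n (k n) (lam\<^sup>2) 0\<bar> \<noteq> \<infinity>" by (rule franz_parisi_gap(1)[OF elim lam order_refl])
      assume "1 \<le> q"
      from franz_parisi_gap(2)[OF elim lam this, unfolded gap_bound_def]
      show "ereal (- (lam\<^sup>2) * q - 6 * real (k n) * ln (real n / real (k n))
          + 1 / 4 * lam * real (k n) * root 3 q / sqrt (ln (real n)))
        \<le> franz_parisi n (k n) (lam\<^sup>2) q - franz_parisi n (k n) (lam\<^sup>2) 0" .
    qed
  qed
next
  fix \<beta> \<epsilon> :: real and k :: "nat \<Rightarrow> nat" and lam :: "nat \<Rightarrow> real" and p :: nat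
  assume \<beta>: "0 < \<beta>" "\<beta> < 1 / 1000" and k: "power_scale (\<lambda>n. real (k n)) real \<beta>"
    and \<epsilon>: "0 < \<epsilon>" "\<epsilon> < 1" and lam: "power_scale lam (\<lambda>n. real (k n)) \<epsilon>" and p: "p \<in> {1, 2}"
  \<comment> \<open>The exponent, in base k, of the amplitude sqrt(lam^p). It stays in (0, 1) for
    both values of p, so the same growth lemma applies.\<close>
  define e where "e = \<epsilon> * (real p / 2)"
  have e: "0 < e" "e < 1" using \<epsilon> p by (auto simp: e_def)
  define \<tau> where "\<tau> = min e (1 - e) / 4"
  have \<tau>: "0 < \<tau>" using e by (simp add: \<tau>_def)
  define a where "a n = sqrt (lam n ^ p)" for n
  have sparse: "\<forall>\<^sub>F n in sequentially. very_sparse n (k n)" by (rule sparsity_eventually(2)[OF \<beta> k])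
  have a: "\<forall>\<^sub>F n in sequentially. (\<exists>e'. \<bar>e' - e\<bar> < min e (1 - e) / 4 \<and> a n = real (k n) powr e')
      \<and> lam n ^ p = (a n)\<^sup>2 \<and> 0 < lam n ^ p"
    using power_scale_eventually[OF lam \<tau>] sparse
  proof eventually_elim
    case (elim n)
    then obtain e' where e': "\<bar>e' - \<epsilon>\<bar> < \<tau>" "lam n = real (k n) powr e'" by auto
    have kn: "0 < real (k n)" using very_sparseD(1)[OF elim(2)] by simp
    have pos: "0 < lam n ^ p" unfolding e'(2) using kn by simp
    have "lam n ^ p = real (k n) powr (e' * real p)"
      unfolding e'(2) using kn by (simp add: powr_realpow[symmetric] powr_powr)
    then have "a n = real (k n) powr (e' * real p * (1 / 2))"
      unfolding a_def by (simp add: powr_half_sqrt[symmetric] powr_powr)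
    moreover have "\<bar>e' * real p * (1 / 2) - e\<bar> < \<tau>"
    proof -
      have "e' * real p * (1 / 2) - e = (e' - \<epsilon>) * (real p / 2)" by (simp add: e_def algebra_simps)
      then have "\<bar>e' * real p * (1 / 2) - e\<bar> = \<bar>e' - \<epsilon>\<bar> * (real p / 2)" by (simp only: abs_mult)
      also have "\<dots> \<le> \<bar>e' - \<epsilon>\<bar> * 1" using p by (intro mult_left_mono) auto
      finally show ?thesis using e'(1) by simp
    qed
    moreover have "lam n ^ p = (a n)\<^sup>2" using pos by (simp add: a_def)
    ultimately show ?case using pos unfolding \<tau>_def by blast
  qed
  have a': "\<forall>\<^sub>F n in sequentially. \<exists>e'. \<bar>e' - e\<bar> < min e (1 - e) / 4 \<and> a n = real (k n) powr e'"
    using a by (rule eventually_mono) simp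
  have growth: "\<forall>\<^sub>F n in sequentially. \<forall>q. 6 * ln (real n) ^ 3 \<le> q \<and> q \<le> ln (real n) powr d \<longrightarrow>
      franz_parisi n (k n) (lam n ^ p) q - franz_parisi n (k n) (lam n ^ p) 0
        \<ge> ereal (real (k n) powr (1 + \<tau>)) \<and> real (k n) powr (1 + \<tau>) > 0" if d: "3 < d" for d
    using potential_gap_growth[OF \<beta> k e d a'] a sparse
  proof eventually_elim
    case (elim n)
    have "0 < k n" using very_sparseD(1)[OF elim(3)] by simp
    moreover have "lam n ^ p = (a n)\<^sup>2" using elim(2) by simp
    ultimately show ?case using elim(1) by (auto simp: \<tau>_def)
  qed
  show "\<exists>\<delta>>0. \<forall>\<^sub>F n in sequentially. real n powr \<delta> * L n \<le> lam n ^ p" if L: "soft_Theta_one L" for L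
  proof -
    obtain \<delta> where \<delta>: "0 < \<delta>" "\<forall>\<^sub>F n in sequentially. real n powr \<delta> * L n \<le> (a n)\<^sup>2"
      using snr_above_threshold[OF \<beta> k e a' L] by auto
    have "\<forall>\<^sub>F n in sequentially. real n powr \<delta> * L n \<le> lam n ^ p"
      using \<delta>(2) a by eventually_elim simp
    then show ?thesis using \<delta>(1) by auto
  qed
  show "\<exists>\<delta>>0. \<forall>\<^sub>F n in sequentially.
               \<forall>q. 6 * ln (real n) ^ 3 \<le> q \<and> q \<le> ln (real n) powr d \<longrightarrow>
                 franz_parisi n (k n) (lam n ^ p) q - franz_parisi n (k n) (lam n ^ p) 0
                   \<ge> ereal (real (k n) powr (1 + \<delta>)) \<and>
                 real (k n) powr (1 + \<delta>) > 0" if "3 < d" for d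
    using growth[OF that] \<tau> by auto
  show "\<forall>\<^sub>F n in sequentially.
               \<not> antimono_on
                   {q \<in> {0 .. ln (real n) powr d}. franz_parisi n (k n) (lam n ^ p) q \<noteq> \<infinity>}
                   (franz_parisi n (k n) (lam n ^ p))" if d: "3 < d" for d
  proof -
    have "\<forall>\<^sub>F n in sequentially. 27 * ln (real n) ^ 3 \<le> ln (real n) powr d" using d by real_asymp
    with growth[OF d] a sparse show ?thesis
    proof eventually_elim
      case (elim n)
      have "0 < real (k n) powr (1 + \<tau>)" using very_sparseD(1)[OF elim(3)] by simp
      then show ?case
        using elim(1,2,4) by (intro franz_parisi_not_antimono[OF elim(3)]) auto
    qed
  qed
qed

end
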